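(* There exist constants $c_2>0$ and $\beta_0<\infty$, depending only on $\Gamma$, $(V_\Lambda,\Lambda)$ (with its counting directions), the constant $c$ of the lower bound on $H_{\mathrm{disl}}$, and the form function $\varphi$, such that for all $\beta>\beta_0$ and all $t\in\mathbb{R}$, $$\inf_{E\Subset\Lambda}\ \inf_{x,y\in\mathbb{R}^3}\ \min_{i,j\in\{1,2,3\}}\ \mathrm{E}_{P_{\beta,E}}\Big[e^{\mathrm{i}t\,(w^*_{ij}(x,I)-w^*_{ij}(y,I))}\Big]\ \ge\ \exp\Big\{-\frac{t^2}{2}e^{-c_2\beta}\Big\},$$ and consequently $$\sup_{E\Subset\Lambda}\ \sup_{x,y\in\mathbb{R}^3}\ \max_{i,j\in\{1,2,3\}}\ \mathrm{Var}_{P_{\beta,E}}\big(w^*_{ij}(x,I)-w^*_{ij}(y,I)\big)\le e^{-c_2\beta}.$$ Here $I$ denotes the random configuration distributed according to $P_{\beta,E}$.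
   Context: Microscopic lattice: $\Gamma\subset\mathbb{R}^3$ is a lattice (discrete additive subgroup of rank 3). Mesoscopic graph: $(V_\Lambda,\Lambda)$ is a graph with vertex set $V_\Lambda\subset\mathbb{R}^3$ and a set $\Lambda$ of undirected edges $\{x,y\}$, $x\neq y$, which is a periodic lattice graph: vertex set, edge set and the choices below are invariant under translations by a rank-3 lattice $L\subset\mathbb{R}^3$, with finitely many orbits of vertices and of edges; in particular it has bounded degree. Each edge $e$ carries a fixed counting direction from $v_-(e)$ to $v_+(e)$ (chosen $L$-invariantly); $n_e=(v_+(e)-v_-(e))/|v_+(e)-v_-(e)|$ and $\lambda_e$ denotes one-dimensional Lebesgue measure on the segment $[v_-(e),v_+(e)]$. The signed incidence matrix is $s_{ve}=1$ if $v=v_+(e)$, $s_{ve}=-1$ if $v=v_-(e)$, $s_{ve}=0$ otherwise. $E\Subset\Lambda$ means $E$ is a finite subset of $\Lambda$; $V$ is the set of endpoints of edges in $E$, and $$\mathcal I(E)=\Big\{I\in\Gamma^E:\ \textstyle\sum_{e\in E}s_{ve}I_e=0\ \text{for all } v\in V\Big\}\quad\text{(Kirchhoff's node law)}.$$ Write $\|I\|_1=\sum_{e\in E}|I_e|$ and $\mathrm{supp}\,I=\{e\in E: I_e\neq0\}$. Burgers vector density: $\varphi:\mathbb{R}^3\to\mathbb{R}_{\ge0}$ is smooth, compactly supported, $\int\varphi=1$, $\varphi(0)>0$. For $I\in\mathcal I(E)$ let $J_{jk}(I)=\sum_{e\in E}(n_e)_j(I_e)_k\lambda_e$ (a signed measure,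 $j,k\in\{1,2,3\}$) and $b_{ijk}(I)=\sum_{l=1}^3\epsilon_{ijl}\,\varphi*J_{lk}(I)$, where $\epsilon_{ijl}=\det(e_i,e_j,e_l)$; $b(I)$ is smooth and compactly supported. Elastic energy: fix Lamé constants $\lambda,\mu\in\mathbb{R}$ with $\mu>0$, $\mu+3\lambda/2>0$; $F(U)=\frac{\lambda}{2}(\mathrm{tr}\,U)^2+\mu|U|^2$ ($|\cdot|$ Euclidean/Frobenius norm) and $H_{\mathrm{el}}(w)=\int_{\mathbb{R}^3}F(w(x)+w(x)^t)\,dx$ for $w:\mathbb{R}^3\to\mathbb{R}^{3\times3}$. $(d_1w)_{ijk}=\partial_iw_{jk}-\partial_jw_{ik}$. For $I\in\mathcal I(E)$, $H^*_{\mathrm{el}}(I)=\inf\{H_{\mathrm{el}}(w): w\in C^\infty_c(\mathbb{R}^3,\mathbb{R}^{3\times3}),\ d_1w=b(I)\}$. Dislocation energy: for each $E\Subset\Lambda$ a function $H_{\mathrm{disl}}:\mathcal I(E)\to[0,\infty]$ is given with (i) $H_{\mathrm{disl}}(I)=H_{\mathrm{disl}}(-I)$; (ii) $H_{\mathrm{disl}}(0)=0$ and $H_{\mathrm{disl}}(I_1+I_2)=H_{\mathrm{disl}}(I_1)+H_{\mathrm{disl}}(I_2)$ whenever $I_1,I_2\in\mathcal I(E)$ and no edge of $\mathrm{supp}\,I_1$ shares a vertex with an edge of $\mathrm{supp}\,I_2$; (iii) $H_{\mathrm{disl}}(I)\ge c\|I\|_1$ for all $I$, with a constant $c>0$ independent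 of $E$. Gibbs measure: for $\beta>0$, $P_{\beta,E}$ is the probability measure on $\mathcal I(E)$ with $P_{\beta,E}(\{I\})=Z_{\beta,E}^{-1}e^{-\beta(H^*_{\mathrm{el}}(I)+H_{\mathrm{disl}}(I))}$, $Z_{\beta,E}$ the normalizing sum (convention $e^{-\infty}=0$). Observable: with Fourier transform $\hat f(k)=(2\pi)^{-3/2}\int e^{-\mathrm{i}k\cdot x}f(x)\,dx$, let $\partial_l$, $\Delta^{-1}$, $\Delta^{-2}$ denote the Fourier multipliers $\mathrm{i}k_l$, $-|k|^{-2}$, $|k|^{-4}$. For $I\in\mathcal I(E)$ and $b=b(I)$ define $w^*(\cdot,I)=w^b+d_0\psi^*$ with $$w^b_{ij}=\sum_{l=1}^3\Delta^{-1}\partial_lb_{lij},\qquad (d_0\psi^* )_{ij}=-\partial_i\Delta^{-2}\sum_{k,l=1}^3\Big(\partial_k\partial_lb_{ljk}+\frac{\lambda}{2\mu+\lambda}\partial_j\partial_lb_{lkk}\Big),$$ taken as their (bounded, smooth) continuous representatives; $w^*(\cdot,I)$ is the $L^2$-minimizer of $H_{\mathrm{el}}$ subject to $d_1w=b(I)$, and it is linear in $I$. *)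

theory Defs
  imports "HOL-Analysis.Analysis"
begin

type_synonym vec = "real^3"
type_synonym edge = "vec \<times> vec"   \<comment> \<open>oriented edge (v_minus, v_plus)\<close>

definition pd :: "3 \<Rightarrow> (vec \<Rightarrow> 'b::real_normed_vector) \<Rightarrow> vec \<Rightarrow> 'b" where
  "pd i f x = frechet_derivative f (at x) (axis i 1)"

fun iter_pd :: "3 list \<Rightarrow> (vec \<Rightarrow> 'b::real_normed_vector) \<Rightarrow> vec \<Rightarrow> 'b" where
  "iter_pd [] f = f"
| "iter_pd (i # ds) f = pd i (iter_pd ds f)"

definition smooth :: "(vec \<Rightarrow> 'b::real_normed_vector) \<Rightarrow> bool" where
  "smooth f \<longleftrightarrow> (\<forall>ds x. iter_pd ds f differentiable (at x))"

definition compact_supp :: "(vec \<Rightarrow> 'b::real_normed_vector) \<Rightarrow> bool" where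
  "compact_supp f \<longleftrightarrow> (\<exists>R. \<forall>x. R < norm x \<longrightarrow> f x = 0)"

definition is_lattice :: "vec set \<Rightarrow> bool" where
  "is_lattice G \<longleftrightarrow> 0 \<in> G \<and> (\<forall>x\<in>G. \<forall>y\<in>G. x - y \<in> G)
     \<and> (\<exists>\<epsilon>>0. \<forall>x\<in>G. x \<noteq> 0 \<longrightarrow> \<epsilon> \<le> norm x) \<and> span G = UNIV"

definition periodic_graph :: "vec set \<Rightarrow> edge set \<Rightarrow> bool" where
  "periodic_graph VL EL \<longleftrightarrow>
     (\<forall>(a,b)\<in>EL. a \<noteq> b \<and> a \<in> VL \<and> b \<in> VL \<and> (b,a) \<notin> EL) \<and>
     (\<exists>L. is_lattice L \<and>
        (\<forall>l\<in>L. \<forall>v\<in>VL. v + l \<in> VL) \<and>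
        (\<forall>l\<in>L. \<forall>(a,b)\<in>EL. (a + l, b + l) \<in> EL) \<and>
        (\<exists>F. finite F \<and> VL \<subseteq> {v + l |v l. v \<in> F \<and> l \<in> L}) \<and>
        (\<exists>F. finite F \<and> EL \<subseteq> {(a + l, b + l) |a b l. (a,b) \<in> F \<and> l \<in> L}))"

definition verts :: "edge set \<Rightarrow> vec set" where
  "verts E = fst ` E \<union> snd ` E"

definition sinc :: "vec \<Rightarrow> edge \<Rightarrow> real" where
  "sinc v e = (if v = snd e then 1 else if v = fst e then -1 else 0)"

text \<open>Configurations I in Gamma^E, extended by 0 outside E, satisfying Kirchhoff's node law.\<close>
definition Icfg :: "vec set \<Rightarrow> edge set \<Rightarrow> (edge \<Rightarrow> vec) set" where
  "Icfg G E = {I. (\<forall>e\<in>E. I e \<in> G) \<and> (\<forall>e. e \<notin> E \<longrightarrow> I e = 0) \<and>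
                 (\<forall>v\<in>verts E. (\<Sum>e\<in>E. sinc v e *\<^sub>R I e) = 0)}"

definition supp :: "edge set \<Rightarrow> (edge \<Rightarrow> vec) \<Rightarrow> edge set" where
  "supp E I = {e\<in>E. I e \<noteq> 0}"

definition norm1 :: "edge set \<Rightarrow> (edge \<Rightarrow> vec) \<Rightarrow> real" where
  "norm1 E I = (\<Sum>e\<in>E. norm (I e))"

definition form_function :: "(vec \<Rightarrow> real) \<Rightarrow> bool" where
  "form_function \<phi> \<longleftrightarrow> smooth \<phi> \<and> compact_supp \<phi> \<and> (\<forall>x. 0 \<le> \<phi> x)
     \<and> integrable lborel \<phi> \<and> integral\<^sup>L lborel \<phi> = 1 \<and> \<phi> 0 > 0"

definition levi_civita :: "3 \<Rightarrow> 3 \<Rightarrow> 3 \<Rightarrow> real" where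
  "levi_civita i j l = det (vector [axis i 1, axis j 1, axis l 1] :: real^3^3)"

definition edge_dir :: "edge \<Rightarrow> vec" where
  "edge_dir e = (1 / norm (snd e - fst e)) *\<^sub>R (snd e - fst e)"

text \<open>(phi * lambda_e)(x) = integral of phi(x - y) over the segment [v_-,v_+] w.r.t. 1-dim Lebesgue measure.\<close>
definition conv_seg :: "(vec \<Rightarrow> real) \<Rightarrow> edge \<Rightarrow> vec \<Rightarrow> real" where
  "conv_seg \<phi> e x = norm (snd e - fst e) *
     integral {0..1} (\<lambda>s. \<phi> (x - (fst e + s *\<^sub>R (snd e - fst e))))"

definition convJ :: "(vec \<Rightarrow> real) \<Rightarrow> edge set \<Rightarrow> (edge \<Rightarrow> vec) \<Rightarrow> 3 \<Rightarrow> 3 \<Rightarrow> vec \<Rightarrow> real" where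
  "convJ \<phi> E I j k x = (\<Sum>e\<in>E. edge_dir e $ j * I e $ k * conv_seg \<phi> e x)"

definition bfield :: "(vec \<Rightarrow> real) \<Rightarrow> edge set \<Rightarrow> (edge \<Rightarrow> vec) \<Rightarrow> 3 \<Rightarrow> 3 \<Rightarrow> 3 \<Rightarrow> vec \<Rightarrow> real" where
  "bfield \<phi> E I i j k x = (\<Sum>l\<in>UNIV. levi_civita i j l * convJ \<phi> E I l k x)"

definition Fel :: "real \<Rightarrow> real \<Rightarrow> real^3^3 \<Rightarrow> real" where
  "Fel lam mu U = lam / 2 * (trace U)\<^sup>2 + mu * (norm U)\<^sup>2"

definition Hel :: "real \<Rightarrow> real \<Rightarrow> (vec \<Rightarrow> real^3^3) \<Rightarrow> real" where
  "Hel lam mu w = (\<integral>x. Fel lam mu (w x + transpose (w x)) \<partial>lborel)"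

definition d1 :: "(vec \<Rightarrow> real^3^3) \<Rightarrow> vec \<Rightarrow> 3 \<Rightarrow> 3 \<Rightarrow> 3 \<Rightarrow> real" where
  "d1 w x i j k = pd i (\<lambda>y. w y $ j $ k) x - pd j (\<lambda>y. w y $ i $ k) x"

definition Hel_star :: "real \<Rightarrow> real \<Rightarrow> (vec \<Rightarrow> real) \<Rightarrow> edge set \<Rightarrow> (edge \<Rightarrow> vec) \<Rightarrow> real" where
  "Hel_star lam mu \<phi> E I = Inf {Hel lam mu w |w. smooth w \<and> compact_supp w \<and>
       (\<forall>x i j k. d1 w x i j k = bfield \<phi> E I i j k x)}"

definition ft :: "(vec \<Rightarrow> complex) \<Rightarrow> vec \<Rightarrow> complex" where
  "ft f \<xi> = complex_of_real ((2 * pi) powr (-3/2)) * (\<integral>x. cis (- (\<xi> \<bullet> x)) * f x \<partial>lborel)"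

definition ift :: "(vec \<Rightarrow> complex) \<Rightarrow> vec \<Rightarrow> complex" where
  "ift g x = complex_of_real ((2 * pi) powr (-3/2)) * (\<integral>\<xi>. cis (\<xi> \<bullet> x) * g \<xi> \<partial>lborel)"

definition bhat :: "(vec \<Rightarrow> real) \<Rightarrow> edge set \<Rightarrow> (edge \<Rightarrow> vec) \<Rightarrow> 3 \<Rightarrow> 3 \<Rightarrow> 3 \<Rightarrow> vec \<Rightarrow> complex" where
  "bhat \<phi> E I i j k = ft (\<lambda>x. complex_of_real (bfield \<phi> E I i j k x))"

text \<open>Fourier symbols: partial_l = i xi_l, Delta^-1 = -|xi|^-2, Delta^-2 = |xi|^-4.\<close>
definition sym_d :: "3 \<Rightarrow> vec \<Rightarrow> complex" where
  "sym_d l \<xi> = \<i> * complex_of_real (\<xi> $ l)"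

definition sym_invlap :: "vec \<Rightarrow> complex" where
  "sym_invlap \<xi> = complex_of_real (- inverse ((norm \<xi>)\<^sup>2))"

definition sym_invlap2 :: "vec \<Rightarrow> complex" where
  "sym_invlap2 \<xi> = complex_of_real (inverse ((norm \<xi>)^4))"

definition wstar_symbol :: "real \<Rightarrow> real \<Rightarrow> (vec \<Rightarrow> real) \<Rightarrow> edge set \<Rightarrow> (edge \<Rightarrow> vec) \<Rightarrow> 3 \<Rightarrow> 3 \<Rightarrow> vec \<Rightarrow> complex" where
  "wstar_symbol lam mu \<phi> E I i j \<xi> =
     (\<Sum>l\<in>UNIV. sym_invlap \<xi> * sym_d l \<xi> * bhat \<phi> E I l i j \<xi>)
     + (- sym_d i \<xi> * sym_invlap2 \<xi> *
        (\<Sum>k\<in>UNIV. \<Sum>l\<in>UNIV.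
           sym_d k \<xi> * sym_d l \<xi> * bhat \<phi> E I l j k \<xi>
           + complex_of_real (lam / (2 * mu + lam)) * sym_d j \<xi> * sym_d l \<xi> * bhat \<phi> E I l k k \<xi>))"

text \<open>w*_ij(x,I) = w^b_ij(x) + (d_0 psi*)_ij(x), continuous representative via the inverse Fourier integral.\<close>
definition wstar :: "real \<Rightarrow> real \<Rightarrow> (vec \<Rightarrow> real) \<Rightarrow> edge set \<Rightarrow> (edge \<Rightarrow> vec) \<Rightarrow> 3 \<Rightarrow> 3 \<Rightarrow> vec \<Rightarrow> real" where
  "wstar lam mu \<phi> E I i j x = Re (ift (wstar_symbol lam mu \<phi> E I i j) x)"

definition disl_energy :: "vec set \<Rightarrow> edge set \<Rightarrow> real \<Rightarrow> (edge set \<Rightarrow> (edge \<Rightarrow> vec) \<Rightarrow> ereal) \<Rightarrow> bool" where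
  "disl_energy G EL c Hd \<longleftrightarrow> (\<forall>E. finite E \<and> E \<subseteq> EL \<longrightarrow>
      (\<forall>I\<in>Icfg G E. 0 \<le> Hd E I \<and> Hd E (\<lambda>e. - I e) = Hd E I \<and> ereal (c * norm1 E I) \<le> Hd E I) \<and>
      Hd E (\<lambda>_. 0) = 0 \<and>
      (\<forall>I1\<in>Icfg G E. \<forall>I2\<in>Icfg G E.
         (\<forall>e1\<in>supp E I1. \<forall>e2\<in>supp E I2. {fst e1, snd e1} \<inter> {fst e2, snd e2} = {})
         \<longrightarrow> Hd E (\<lambda>e. I1 e + I2 e) = Hd E I1 + Hd E I2))"

definition lame :: "real \<Rightarrow> real \<Rightarrow> bool" where
  "lame lam mu \<longleftrightarrow> 0 < mu \<and> 0 < mu + 3 * lam / 2"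

definition gweight :: "real \<Rightarrow> real \<Rightarrow> real \<Rightarrow> (vec \<Rightarrow> real) \<Rightarrow> (edge set \<Rightarrow> (edge \<Rightarrow> vec) \<Rightarrow> ereal)
     \<Rightarrow> edge set \<Rightarrow> (edge \<Rightarrow> vec) \<Rightarrow> real" where
  "gweight \<beta> lam mu \<phi> Hd E I = (if Hd E I = \<infinity> then 0
      else exp (- \<beta> * (Hel_star lam mu \<phi> E I + real_of_ereal (Hd E I))))"

definition gibbs :: "vec set \<Rightarrow> real \<Rightarrow> real \<Rightarrow> real \<Rightarrow> (vec \<Rightarrow> real) \<Rightarrow> (edge set \<Rightarrow> (edge \<Rightarrow> vec) \<Rightarrow> ereal)
     \<Rightarrow> edge set \<Rightarrow> (edge \<Rightarrow> vec) \<Rightarrow> real" where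
  "gibbs G \<beta> lam mu \<phi> Hd E I = gweight \<beta> lam mu \<phi> Hd E I /
      (\<Sum>\<^sub>\<infinity>J\<in>Icfg G E. gweight \<beta> lam mu \<phi> Hd E J)"

end

theory Submission
  imports Defs "HOL-Probability.Probability" "HOL-Complex_Analysis.Cauchy_Integral_Formula"
begin

text \<open>The obstacle is that the elastic energy couples all edges, so the Gibbs weight does not
  factorise over connected components and has no polymer expansion of its own. Averaging over the
  Gaussian functional removes it, at the price of the weights cos (A I) of both signs. Hence the
  inequality is needed for every A, and partition functions must be shown to have no zeros where
  positivity of the weights would otherwise do. Uniformity in A also hides the Lame constants in the
  measure; in the observable they enter only through a factor of modulus at most 1, so
  \<open>c2\<close> and \<open>\<beta>0\<close> do not see them.

  The infimum over test fields is treated without a minimiser: the parallelogram law is proved for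
  the infimum itself, and polarisation recovers the quadratic form.

  A nonzero current has norm at least \<epsilon>, so an edge with current has weight of order exp (-
  c \<epsilon> \<beta>). Half of this exponent becomes \<open>c2\<close>. The other half absorbs,
  for large \<beta>, the degree of the graph, the number of connected edge sets and the square sum
  of the coefficients of X. None of these constants depends on the truncation, which is therefore
  removed at the end.\<close>

text \<open>
  Truncate the currents, so that all sums over configurations are finite. The minimal elastic energy is a
  positive semidefinite quadratic form in \<open>I\<close>, hence \<open>exp (- \<beta> H)\<close> is a mixture of characters
  \<open>I \<mapsto> cos (A I)\<close> with a Gaussian \<open>A\<close>. It therefore suffices to prove
  \<open>\<Xi> (A + t X) + \<Xi> (A - t X) \<ge> 2 exp (- t\<^sup>2 \<sigma>\<^sup>2 / 2) \<Xi> A\<close> for every real functional \<open>A\<close>, where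
  \<open>\<Xi> A = \<Sum>I. exp (- \<beta> H_disl I) cos (A I)\<close>; by the inequality of the means this follows from
  \<open>(ln \<Xi>)'' \<ge> - \<sigma>\<^sup>2\<close> in the direction \<open>X\<close>. The sum \<open>\<Xi>\<close> factorises over connected components, and removing
  one edge at a time shows by induction that ratios of partition functions stay bounded for complex
  weights too. So the complex expectation of the current through an edge is exponentially small in \<open>\<beta>\<close> on a
  polydisc, and Cauchy's inequality turns this into summability of the covariances along each row. With
  \<open>X I = \<Sum>e. \<gamma> e \<bullet> I e\<close> one gets \<open>\<sigma>\<^sup>2 \<le> exp (- c \<beta>) \<Sum>e. |\<gamma> e|\<^sup>2\<close>. The last sum is bounded uniformly in the
  base point: \<open>\<gamma>\<close> is the inverse Fourier transform of a symbol of size \<open>1 / |\<xi>|\<close> with rapid decay, which is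
  square integrable in dimension three, so a Bessel inequality for exponentials with separated frequencies
  applies. The bound on the variance is the limit \<open>t \<rightarrow> 0\<close>.
\<close>

section \<open>Separated sets and the degree of the graph\<close>

definition separated :: "real \<Rightarrow> vec set \<Rightarrow> bool" where
  "separated \<epsilon> S \<longleftrightarrow> (\<forall>x\<in>S. \<forall>y\<in>S. x \<noteq> y \<longrightarrow> \<epsilon> \<le> norm (x - y))"

lemma separated_subset: "separated \<epsilon> T \<Longrightarrow> S \<subseteq> T \<Longrightarrow> separated \<epsilon> S"
  unfolding separated_def by blast

lemma sum_int_geometric_le:
  fixes q :: real
  assumes q: "0 \<le> q" "q < 1" and "finite N"
  shows "(\<Sum>n\<in>N. q ^ nat \<bar>n - m\<bar>) \<le> 2 / (1 - q)"
proof -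
  have geo: "(\<Sum>n\<in>M. q ^ n) \<le> 1 / (1 - q)" if "finite M" for M :: "nat set"
    using sum_le_suminf[of "\<lambda>n. q ^ n" M] that q suminf_geometric[of q] by (auto intro: summable_geometric)
  let ?A = "{n\<in>N. m \<le> n}" and ?B = "{n\<in>N. n < m}"
  have "(\<Sum>n\<in>N. q ^ nat \<bar>n - m\<bar>) = (\<Sum>n\<in>?A. q ^ nat \<bar>n - m\<bar>) + (\<Sum>n\<in>?B. q ^ nat \<bar>n - m\<bar>)"
    using \<open>finite N\<close> by (subst sum.union_disjoint[symmetric]) (auto intro!: sum.cong)
  also have "(\<Sum>n\<in>?A. q ^ nat \<bar>n - m\<bar>) = (\<Sum>k\<in>(\<lambda>n. nat \<bar>n - m\<bar>) ` ?A. q ^ k)"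
    by (subst sum.reindex) (auto simp: inj_on_def)
  also have "\<dots> \<le> 1 / (1 - q)" by (rule geo) (use \<open>finite N\<close> in auto)
  also have "(\<Sum>n\<in>?B. q ^ nat \<bar>n - m\<bar>) = (\<Sum>k\<in>(\<lambda>n. nat \<bar>n - m\<bar>) ` ?B. q ^ k)"
    by (subst sum.reindex) (auto simp: inj_on_def)
  also have "\<dots> \<le> 1 / (1 - q)" by (rule geo) (use \<open>finite N\<close> in auto)
  finally show ?thesis by simp
qed

lemma sum_vec_le_norm: "\<bar>x$1\<bar> + \<bar>x$2\<bar> + \<bar>x$3\<bar> \<le> 3 * norm (x::vec)"
  using component_le_norm_cart[of x 1] component_le_norm_cart[of x 2] component_le_norm_cart[of x 3] by linarith

lemma norm_vec3_sq: "(norm (x::vec))\<^sup>2 = (x$1)\<^sup>2 + (x$2)\<^sup>2 + (x$3)\<^sup>2"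
  unfolding power2_norm_eq_inner inner_vec_def sum_3 by (simp add: power2_eq_square)

lemma sum_triple_product:
  fixes f :: "'a \<Rightarrow> real"
  shows "(\<Sum>k\<in>A \<times> (B \<times> C). case k of (x,y,z) \<Rightarrow> f x * (g y * h z)) = sum f A * (sum g B * sum h C)"
proof -
  have "sum g B * sum h C = (\<Sum>p\<in>B \<times> C. g (fst p) * h (snd p))"
    by (simp add: sum_product sum.cartesian_product case_prod_unfold)
  then have "sum f A * (sum g B * sum h C) = (\<Sum>k\<in>A \<times> (B \<times> C). f (fst k) * (g (fst (snd k)) * h (snd (snd k))))"
    by (simp add: sum_product sum.cartesian_product case_prod_unfold)
  then show ?thesis by (simp add: case_prod_unfold)
qed

text \<open>Small cubes contain at most one point of \<open>S\<close>, and the exponential is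
  dominated by a product over the three coordinates. Replacing points by cell indices leaves three
  geometric series, whatever \<open>S\<close> and \<open>p\<close> are.\<close>

lemma separated_exp_sum:
  assumes "0 < \<epsilon>" "0 < a"
  shows "\<exists>C>0. \<forall>S p. finite S \<and> separated \<epsilon> S \<longrightarrow> (\<Sum>l\<in>S. exp (- a * norm (p - l))) \<le> C"
proof -
  \<comment> \<open>Two points of one cell differ by less than \<epsilon>/2 in each coordinate,
    hence by less than \<epsilon> in norm, since 3 < 4.\<close>
  define s where "s = \<epsilon> / 2"
  define q where "q = exp (- (a * s / 3))"
  define K where "K = exp (a * s / 3)"
  have s: "0 < s" using assms by (simp add: s_def)
  have q: "0 \<le> q" "q < 1" using assms s by (auto simp: q_def)
  define c where "c l = (\<lfloor>l$1 / s\<rfloor>, \<lfloor>l$2 / s\<rfloor>, \<lfloor>l$3 / s\<rfloor>)" for l :: vec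
  have floor_close: "\<bar>x - y\<bar> < s" if "\<lfloor>x / s\<rfloor> = \<lfloor>y / s\<rfloor>" for x y :: real
  proof -
    have "\<bar>x / s - y / s\<bar> < 1" using that by linarith
    then have "\<bar>x - y\<bar> / s < 1" using s by (simp add: diff_divide_distrib[symmetric] abs_divide)
    then show ?thesis using s by (simp add: field_simps)
  qed
  \<comment> \<open>Rounding changes a difference of coordinates by less than one cell, which costs
    the factor \<open>K\<close>.\<close>
  have comp: "exp (- (a / 3) * \<bar>x - y\<bar>) \<le> K * q ^ nat \<bar>\<lfloor>y / s\<rfloor> - \<lfloor>x / s\<rfloor>\<bar>" for x y :: real
  proof -
    have "real_of_int \<bar>\<lfloor>y / s\<rfloor> - \<lfloor>x / s\<rfloor>\<bar> \<le> \<bar>x / s - y / s\<bar> + 1" by linarith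
    also have "\<bar>x / s - y / s\<bar> = \<bar>x - y\<bar> / s" using s by (simp add: diff_divide_distrib[symmetric] abs_divide)
    finally have "s * real_of_int \<bar>\<lfloor>y / s\<rfloor> - \<lfloor>x / s\<rfloor>\<bar> \<le> \<bar>x - y\<bar> + s" using s by (simp add: field_simps)
    then have "(a / 3) * (s * real_of_int \<bar>\<lfloor>y / s\<rfloor> - \<lfloor>x / s\<rfloor>\<bar>) \<le> (a / 3) * (\<bar>x - y\<bar> + s)"
      by (rule mult_left_mono) (use assms in auto)
    then have "- (a / 3) * \<bar>x - y\<bar> \<le> a * s / 3 + real (nat \<bar>\<lfloor>y / s\<rfloor> - \<lfloor>x / s\<rfloor>\<bar>) * (- (a * s / 3))"
      by (simp add: algebra_simps)
    then have "exp (- (a / 3) * \<bar>x - y\<bar>) \<le> exp (a * s / 3 + real (nat \<bar>\<lfloor>y / s\<rfloor> - \<lfloor>x / s\<rfloor>\<bar>) * (- (a * s / 3)))"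
      by simp
    then show ?thesis by (simp only: exp_add exp_of_nat_mult K_def q_def)
  qed
  define C where "C = K ^ 3 * (2 / (1 - q)) ^ 3"
  have "(\<Sum>l\<in>S. exp (- a * norm (p - l))) \<le> C" if S: "finite S" "separated \<epsilon> S" for S p
  proof -
    have inj: "inj_on c S"
    proof (rule inj_onI, rule ccontr)
      fix x y assume xy: "x \<in> S" "y \<in> S" "c x = c y" "x \<noteq> y"
      then have "\<epsilon> \<le> norm (x - y)" using S by (auto simp: separated_def)
      have "\<bar>x$1 - y$1\<bar> < s" "\<bar>x$2 - y$2\<bar> < s" "\<bar>x$3 - y$3\<bar> < s"
        using xy(3) floor_close by (auto simp: c_def)
      then have "(x$1 - y$1)\<^sup>2 < s\<^sup>2" "(x$2 - y$2)\<^sup>2 < s\<^sup>2" "(x$3 - y$3)\<^sup>2 < s\<^sup>2"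
        using power_strict_mono[of "\<bar>x$1 - y$1\<bar>" s 2] power_strict_mono[of "\<bar>x$2 - y$2\<bar>" s 2]
          power_strict_mono[of "\<bar>x$3 - y$3\<bar>" s 2] by simp_all
      then have "(norm (x - y))\<^sup>2 < 4 * s\<^sup>2" using zero_le_power2[of s]
        unfolding norm_vec3_sq vector_minus_component by linarith
      also have "\<dots> = \<epsilon>\<^sup>2" by (simp add: s_def power2_eq_square)
      finally have "norm (x - y) < \<epsilon>" using assms by (simp add: power2_less_imp_less)
      then show False using \<open>\<epsilon> \<le> norm (x - y)\<close> by simp
    qed
    let ?m1 = "\<lfloor>p$1 / s\<rfloor>" and ?m2 = "\<lfloor>p$2 / s\<rfloor>" and ?m3 = "\<lfloor>p$3 / s\<rfloor>"
    let ?g = "\<lambda>m n. q ^ nat \<bar>n - m\<bar>"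
    have "(\<Sum>l\<in>S. exp (- a * norm (p - l)))
       \<le> (\<Sum>l\<in>S. K ^ 3 * (case c l of (x,y,z) \<Rightarrow> ?g ?m1 x * (?g ?m2 y * ?g ?m3 z)))"
    proof (rule sum_mono)
      fix l
      have "- a * norm (p - l) \<le> - (a/3) * \<bar>p$1 - l$1\<bar> + (- (a/3) * \<bar>p$2 - l$2\<bar> + - (a/3) * \<bar>p$3 - l$3\<bar>)"
        using mult_left_mono[OF sum_vec_le_norm[of "p - l"], of "a / 3"] assms by (simp add: algebra_simps)
      then have "exp (- a * norm (p - l)) \<le> exp (- (a/3) * \<bar>p$1 - l$1\<bar>) * (exp (- (a/3) * \<bar>p$2 - l$2\<bar>) * exp (- (a/3) * \<bar>p$3 - l$3\<bar>))"
        by (simp only: exp_add[symmetric] exp_le_cancel_iff)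
      also have "\<dots> \<le> (K * ?g ?m1 \<lfloor>l$1 / s\<rfloor>) * ((K * ?g ?m2 \<lfloor>l$2 / s\<rfloor>) * (K * ?g ?m3 \<lfloor>l$3 / s\<rfloor>))"
        using q by (intro mult_mono comp) (auto simp: K_def)
      finally show "exp (- a * norm (p - l)) \<le> K ^ 3 * (case c l of (x,y,z) \<Rightarrow> ?g ?m1 x * (?g ?m2 y * ?g ?m3 z))"
        by (simp add: c_def power3_eq_cube mult_ac)
    qed
    also have "\<dots> = K ^ 3 * (\<Sum>k\<in>c ` S. case k of (x,y,z) \<Rightarrow> ?g ?m1 x * (?g ?m2 y * ?g ?m3 z))"
      by (simp add: sum.reindex[OF inj] sum_distrib_left)
    also have "\<dots> \<le> K ^ 3 * (\<Sum>k\<in>(fst ` c ` S) \<times> ((fst ` snd ` c ` S) \<times> (snd ` snd ` c ` S)). case k of (x,y,z) \<Rightarrow> ?g ?m1 x * (?g ?m2 y * ?g ?m3 z))"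
    proof (intro mult_left_mono sum_mono2)
      show "finite ((fst ` c ` S) \<times> ((fst ` snd ` c ` S) \<times> (snd ` snd ` c ` S)))" using S by auto
      show "c ` S \<subseteq> (fst ` c ` S) \<times> ((fst ` snd ` c ` S) \<times> (snd ` snd ` c ` S))"
        by (rule subsetI) (simp only: mem_Times_iff, intro conjI imageI)
      show "0 \<le> (case k of (x,y,z) \<Rightarrow> ?g ?m1 x * (?g ?m2 y * ?g ?m3 z))" for k
        using q by (simp split: prod.splits)
      show "0 \<le> K ^ 3" by (simp add: K_def)
    qed
    also have "\<dots> = K ^ 3 * ((\<Sum>x\<in>fst ` c ` S. ?g ?m1 x) * ((\<Sum>y\<in>fst ` snd ` c ` S. ?g ?m2 y) * (\<Sum>z\<in>snd ` snd ` c ` S. ?g ?m3 z)))"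
      by (simp only: sum_triple_product)
    also have "\<dots> \<le> K ^ 3 * (2 / (1 - q) * (2 / (1 - q) * (2 / (1 - q))))"
      using S q by (intro mult_left_mono mult_mono sum_int_geometric_le) (auto simp: K_def intro!: sum_nonneg mult_nonneg_nonneg)
    also have "\<dots> = C" by (simp add: C_def power3_eq_cube)
    finally show ?thesis .
  qed
  moreover have "C > 0" using q by (simp add: C_def K_def)
  ultimately show ?thesis by blast
qed

lemma lattice_separated:
  assumes "is_lattice G"
  shows "\<exists>\<epsilon>>0. separated \<epsilon> G"
  using assms unfolding is_lattice_def separated_def by (metis right_minus_eq)

text \<open>Every point of the ball contributes at least exp (- R) to the sum of
  \<open>separated_exp_sum\<close>. An infinite \<open>S\<close> is excluded through a finite subset
  that is one point too large.\<close>

lemma separated_card_ball: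
  assumes "0 < \<epsilon>"
  shows "\<exists>N::nat. \<forall>S p. separated \<epsilon> S \<and> (\<forall>x\<in>S. norm (p - x) \<le> R) \<longrightarrow> finite S \<and> card S \<le> N"
proof -
  obtain C where C: "0 < C" "\<And>S p. finite S \<Longrightarrow> separated \<epsilon> S \<Longrightarrow> (\<Sum>l\<in>S. exp (- 1 * norm (p - l))) \<le> C"
    using separated_exp_sum[OF assms, of 1] by auto
  define N where "N = nat \<lceil>C * exp R\<rceil>"
  have fin: "card S \<le> N" if "finite S" "separated \<epsilon> S" "\<forall>x\<in>S. norm (p - x) \<le> R" for S p
  proof -
    have "real (card S) * exp (- R) = (\<Sum>l\<in>S. exp (- R))" by simp
    also have "\<dots> \<le> (\<Sum>l\<in>S. exp (- 1 * norm (p - l)))" by (rule sum_mono) (use that in auto)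
    also have "\<dots> \<le> C" using C that by blast
    finally have "real (card S) \<le> C * exp R" by (simp add: exp_minus field_simps)
    then show ?thesis unfolding N_def by linarith
  qed
  have "finite S \<and> card S \<le> N" if "separated \<epsilon> S" "\<forall>x\<in>S. norm (p - x) \<le> R" for S p
  proof -
    have "finite S"
    proof (rule ccontr)
      assume "infinite S"
      then obtain T where "T \<subseteq> S" "finite T" "card T = Suc N" using infinite_arbitrarily_large by blast
      then show False using fin[of T p] that separated_subset[OF that(1)] by (metis not_less_eq_eq order_refl subsetD)
    qed
    then show ?thesis using fin that by blast
  qed
  then show ?thesis by blast
qed

lemma lattice_bounded_finite:
  assumes "is_lattice G"
  shows "finite {g\<in>G. norm g \<le> R}"
proof -
  obtain \<epsilon> where \<epsilon>: "0 < \<epsilon>" "separated \<epsilon> G" using lattice_separated[OF assms] by blast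
  obtain N where "\<And>S p. separated \<epsilon> S \<Longrightarrow> \<forall>x\<in>S. norm (p - x) \<le> R \<Longrightarrow> finite S \<and> card S \<le> N"
    using separated_card_ball[OF \<epsilon>(1), of R] by blast
  from this[of "{g\<in>G. norm g \<le> R}" 0] show ?thesis using separated_subset[OF \<epsilon>(2)] by auto
qed

section \<open>Bounded degree of a periodic graph\<close>

definition touch :: "edge \<Rightarrow> edge \<Rightarrow> bool" where
  "touch e f \<longleftrightarrow> {fst e, snd e} \<inter> {fst f, snd f} \<noteq> {}"

text \<open>Write both edges as translates of representatives. If they share a vertex, their shifts
  \<open>l\<close> and \<open>m\<close> differ by a difference of endpoints of representatives,
  which is bounded; separation of the period lattice leaves boundedly many \<open>m\<close> for
  given \<open>l\<close>.\<close>

lemma periodic_graph_degree: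
  assumes "periodic_graph VL EL"
  shows "\<exists>D::nat. \<forall>e\<in>EL. \<forall>E\<subseteq>EL. card {f\<in>E. touch e f} \<le> D"
proof -
  obtain L Fe where L: "is_lattice L" and Fe: "finite Fe" "EL \<subseteq> {(a + l, b + l) |a b l. (a,b) \<in> Fe \<and> l \<in> L}"
    using assms unfolding periodic_graph_def by blast
  obtain \<epsilon> where \<epsilon>: "0 < \<epsilon>" "separated \<epsilon> L" using lattice_separated[OF L] by blast
  define M where "M = (\<Sum>(a,b)\<in>Fe. norm a + norm b)"
  have M: "norm a \<le> M" "norm b \<le> M" if "(a,b) \<in> Fe" for a b
  proof -
    have "(case (a,b) of (a,b) \<Rightarrow> norm a + norm b) \<le> M"
      unfolding M_def by (rule member_le_sum[OF that]) (use Fe(1) in auto)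
    then show "norm a \<le> M" "norm b \<le> M" using norm_ge_zero[of a] norm_ge_zero[of b]
      unfolding prod.case by linarith+
  qed
  obtain N :: nat where N: "\<And>S p. separated \<epsilon> S \<Longrightarrow> \<forall>x\<in>S. norm (p - x) \<le> 4 * M \<Longrightarrow> finite S \<and> card S \<le> N"
    using separated_card_ball[OF \<epsilon>(1), of "4 * M"] by blast
  have "card {f\<in>E. touch e f} \<le> card Fe * N" if e: "e \<in> EL" and E: "E \<subseteq> EL" for e E
  proof -
    obtain a b l where el: "e = (a + l, b + l)" "(a,b) \<in> Fe" "l \<in> L" using e Fe by blast
    let ?S = "{m\<in>L. norm (l - m) \<le> 4 * M}"
    have "separated \<epsilon> ?S" by (rule separated_subset[OF \<epsilon>(2)]) auto
    then have "finite ?S \<and> card ?S \<le> N" by (rule N[of _ l]) simp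
    then have S: "finite ?S" "card ?S \<le> N" by blast+
    have "{f\<in>E. touch e f} \<subseteq> (\<lambda>((a,b),m). (a + m, b + m)) ` (Fe \<times> ?S)"
    proof
      fix f assume f: "f \<in> {f\<in>E. touch e f}"
      then obtain a' b' m where fm: "f = (a' + m, b' + m)" "(a',b') \<in> Fe" "m \<in> L" using E Fe by blast
      have n: "norm a \<le> M" "norm b \<le> M" "norm a' \<le> M" "norm b' \<le> M" using M el(2) fm(2) by blast+
      have "a + l = a' + m \<or> a + l = b' + m \<or> b + l = a' + m \<or> b + l = b' + m"
        using f el(1) fm(1) by (auto simp: touch_def)
      then have "\<exists>x y. norm x \<le> M \<and> norm y \<le> M \<and> x + l = y + m" using n by blast
      then obtain x y where xy: "norm x \<le> M" "norm y \<le> M" "x + l = y + m" by blast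
      then have "l - m = y - x" by (simp add: algebra_simps)
      then have "norm (l - m) \<le> M + M" using xy norm_triangle_ineq4[of y x] by simp
      moreover have "0 \<le> M" using xy(1) norm_ge_zero order_trans by blast
      ultimately have "m \<in> ?S" using fm by simp
      then show "f \<in> (\<lambda>((a,b),m). (a + m, b + m)) ` (Fe \<times> ?S)" using fm by force
    qed
    then have "card {f\<in>E. touch e f} \<le> card (Fe \<times> ?S)"
      using S Fe by (meson card_image_le card_mono finite_SigmaI finite_imageI le_trans)
    also have "\<dots> \<le> card Fe * N" using S by (simp add: card_cartesian_product)
    finally show ?thesis .
  qed
  then show ?thesis by blast
qed

section \<open>Polymer expansion of configurations into connected components\<close>

definition csupp :: "('e \<Rightarrow> 'v::zero) \<Rightarrow> 'e set" where
  "csupp I = {e. I e \<noteq> 0}"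

text \<open>Exactly what a polymer expansion asks of the configurations: those with non-adjacent
  supports can be joined, and a configuration can be cut between non-adjacent parts of its support.
  Kirchhoff's law enters only through these two closure properties. Finiteness of \<open>F\<close>
  keeps all partition functions finite sums.\<close>

locale config_space =
  fixes E :: "'e set" and adj :: "'e \<Rightarrow> 'e \<Rightarrow> bool" and F :: "('e \<Rightarrow> 'v::real_inner) set"
    and D :: nat
  assumes finE: "finite E" and finF: "finite F"
    and adj_refl: "adj e e" and adj_sym: "adj e f \<Longrightarrow> adj f e"
    and deg: "e \<in> E \<Longrightarrow> card {f \<in> E. adj e f} \<le> D"
    and F0: "(\<lambda>_. 0) \<in> F"
    and Fsupp: "I \<in> F \<Longrightarrow> csupp I \<subseteq> E"
    and Fsplit: "I \<in> F \<Longrightarrow> (\<And>e f. e \<in> csupp I \<Longrightarrow> e \<in> S \<Longrightarrow> f \<in> csupp I \<Longrightarrow> f \<notin> S \<Longrightarrow> \<not> adj e f)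
        \<Longrightarrow> (\<lambda>e. if e \<in> S then I e else 0) \<in> F"
    and Fjoin: "I1 \<in> F \<Longrightarrow> I2 \<in> F \<Longrightarrow> (\<And>e f. e \<in> csupp I1 \<Longrightarrow> f \<in> csupp I2 \<Longrightarrow> \<not> adj e f)
        \<Longrightarrow> (\<lambda>e. I1 e + I2 e) \<in> F"
begin

definition nbhd :: "'e set \<Rightarrow> 'e set" where
  "nbhd S = {f \<in> E. \<exists>g\<in>S. adj g f}"

text \<open>Connected edge sets with root \<open>e\<close>, as in the counting of lattice animals.
  Growth by one edge at a time is the form in which both maximality and the covering walk are
  proved.\<close>

inductive animal :: "'e \<Rightarrow> 'e set \<Rightarrow> bool" for e where
  single: "animal e {e}"
| grow: "animal e S \<Longrightarrow> t \<in> S \<Longrightarrow> adj t s \<Longrightarrow> s \<notin> S \<Longrightarrow> animal e (insert s S)"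

definition mult_weight :: "(('e \<Rightarrow> 'v) \<Rightarrow> 'a::comm_ring_1) \<Rightarrow> bool" where
  "mult_weight w \<longleftrightarrow> w (\<lambda>_. 0) = 1 \<and> (\<forall>I1\<in>F. \<forall>I2\<in>F.
     (\<forall>e\<in>csupp I1. \<forall>f\<in>csupp I2. \<not> adj e f) \<longrightarrow> w (\<lambda>e. I1 e + I2 e) = w I1 * w I2)"

definition pf :: "(('e \<Rightarrow> 'v) \<Rightarrow> complex) \<Rightarrow> 'e set \<Rightarrow> complex" where
  "pf w U = (\<Sum>I\<in>{I\<in>F. csupp I \<subseteq> U}. w I)"

text \<open>The polymers through \<open>e\<close>: configurations whose support is a single
  connected piece that contains \<open>e\<close>.\<close>

definition polys :: "'e \<Rightarrow> 'e set \<Rightarrow> ('e \<Rightarrow> 'v) set" where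
  "polys e U = {I\<in>F. animal e (csupp I) \<and> csupp I \<subseteq> U}"

lemma animal_mem: "animal e S \<Longrightarrow> e \<in> S"
  by (induction rule: animal.induct) auto

lemma animal_finite: "animal e S \<Longrightarrow> finite S"
  by (induction rule: animal.induct) auto

lemma animal_subset_closed:
  "animal e S \<Longrightarrow> S \<subseteq> T \<Longrightarrow> e \<in> C \<Longrightarrow> (\<And>f g. f \<in> C \<Longrightarrow> g \<in> T - C \<Longrightarrow> \<not> adj f g) \<Longrightarrow> S \<subseteq> C"
  by (induction rule: animal.induct) blast+

text \<open>An animal of maximal size inside \<open>T\<close> is closed under adjacency in
  \<open>T\<close>, since otherwise it could grow.\<close>

lemma component_exists:
  assumes "finite T" "e \<in> T"
  shows "\<exists>C. animal e C \<and> C \<subseteq> T \<and> (\<forall>f\<in>C. \<forall>g\<in>T - C. \<not> adj f g)"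
proof -
  let ?A = "{C. animal e C \<and> C \<subseteq> T}"
  have fin: "finite ?A" using assms(1) by (auto intro: finite_subset[of _ "Pow T"])
  have ne: "{e} \<in> ?A" using assms single by auto
  obtain C where C: "C \<in> ?A" and mx: "\<And>C'. C' \<in> ?A \<Longrightarrow> card C' \<le> card C"
  proof -
    have "Max (card ` ?A) \<in> card ` ?A" by (rule Max_in) (use fin ne in auto)
    then obtain C where "C \<in> ?A" "card C = Max (card ` ?A)" by auto
    then show thesis using that fin by (metis (no_types, lifting) Max_ge finite_imageI imageI)
  qed
  have "\<not> adj f g" if f: "f \<in> C" and g: "g \<in> T - C" for f g
  proof
    assume "adj f g"
    then have "insert g C \<in> ?A" using C f g grow by auto
    then have "card (insert g C) \<le> card C" by (rule mx)
    moreover have "finite C" using C animal_finite by auto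
    ultimately show False using g by simp
  qed
  then show ?thesis using C by auto
qed

definition component :: "'e \<Rightarrow> 'e set \<Rightarrow> 'e set" where
  "component e T = (SOME C. animal e C \<and> C \<subseteq> T \<and> (\<forall>f\<in>C. \<forall>g\<in>T - C. \<not> adj f g))"

lemma component_props:
  assumes "finite T" "e \<in> T"
  shows "animal e (component e T)" "component e T \<subseteq> T"
    "\<And>f g. f \<in> component e T \<Longrightarrow> g \<in> T \<Longrightarrow> g \<notin> component e T \<Longrightarrow> \<not> adj f g"
  using someI_ex[OF component_exists[OF assms]] unfolding component_def[symmetric] by blast+

lemma component_unique:
  assumes "finite T" "e \<in> T" "animal e C" "C \<subseteq> T" "\<And>f g. f \<in> C \<Longrightarrow> g \<in> T - C \<Longrightarrow> \<not> adj f g"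
  shows "component e T = C"
proof
  note p = component_props[OF assms(1,2)]
  show "component e T \<subseteq> C"
    by (rule animal_subset_closed[OF p(1,2) animal_mem[OF assms(3)]]) (use assms(5) in blast)
  show "C \<subseteq> component e T"
    by (rule animal_subset_closed[OF assms(3,4) animal_mem[OF p(1)]]) (use p(3) in blast)
qed

text \<open>A configuration with current through \<open>e\<close> is the same as a polymer through
  \<open>e\<close> (its component at \<open>e\<close>) together with a configuration that avoids the
  neighbourhood of that polymer. The factor \<open>t (I e)\<close> sees only the polymer, and the
  weight is multiplicative, so the remainders sum to a partition function.\<close>

lemma sum_through_edge:
  assumes w: "mult_weight w" and U: "U \<subseteq> E"
  shows "(\<Sum>I\<in>{I\<in>F. csupp I \<subseteq> U \<and> I e \<noteq> 0}. t (I e) * w I)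
       = (\<Sum>I\<in>polys e U. t (I e) * w I * pf w (U - nbhd (csupp I)))"
proof -
  let ?S = "{I\<in>F. csupp I \<subseteq> U \<and> I e \<noteq> 0}"
  let ?R = "\<lambda>I. {J\<in>F. csupp J \<subseteq> U - nbhd (csupp I)}"
  let ?c = "\<lambda>I. component e (csupp I)"
  let ?i = "\<lambda>I. ((\<lambda>f. if f \<in> ?c I then I f else 0), (\<lambda>f. if f \<in> - ?c I then I f else 0))"
  let ?j = "\<lambda>p. (\<lambda>f. fst p f + snd p f)"
  have fs: "finite (csupp I)" if "I \<in> F" for I
    using Fsupp[OF that] finE finite_subset by blast
  have nadj: "\<not> adj f g" if "I \<in> F" "J \<in> ?R I" "f \<in> csupp I" "g \<in> csupp J" for I J f g
    using that Fsupp[of J] unfolding nbhd_def by blast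
  have fin: "finite (polys e U)" using finF by (auto simp: polys_def)
  have "(\<Sum>I\<in>polys e U. t (I e) * w I * pf w (U - nbhd (csupp I)))
     = (\<Sum>I\<in>polys e U. \<Sum>J\<in>?R I. t (I e) * w I * w J)"
    by (simp add: pf_def sum_distrib_left)
  also have "\<dots> = (\<Sum>(I,J)\<in>Sigma (polys e U) ?R. t (I e) * w I * w J)"
    by (rule sum.Sigma) (use fin finF in auto)
  also have "\<dots> = (\<Sum>I\<in>?S. t (I e) * w I)"
  proof (rule sum.reindex_bij_witness[where i = ?i and j = ?j])
    fix p assume p: "p \<in> Sigma (polys e U) ?R"
    obtain I J where IJ: "p = (I,J)" by force
    have I: "I \<in> F" "animal e (csupp I)" "csupp I \<subseteq> U" and J: "J \<in> ?R I" "J \<in> F"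
      using p IJ by (auto simp: polys_def)
    have na: "\<not> adj f g" if "f \<in> csupp I" "g \<in> csupp J" for f g
      using nadj[OF I(1) J(1) that] .
    have disj: "csupp I \<inter> csupp J = {}" using na adj_refl by blast
    then have d: "\<And>f. I f = 0 \<or> J f = 0" by (auto simp: csupp_def)
    have un: "csupp (?j p) = csupp I \<union> csupp J"
      using d IJ by (force simp: csupp_def)
    have eI: "e \<in> csupp I" using animal_mem I by auto
    have jF: "?j p \<in> F" using Fjoin[OF I(1) J(2) na] IJ by simp
    have c: "?c (?j p) = csupp I"
      by (rule component_unique) (use un fs[OF jF] eI I(2) na in auto)
    show "?i (?j p) = p"
      unfolding c using d IJ by (auto simp: fun_eq_iff csupp_def)
    have "I e \<noteq> 0" "J e = 0" using eI d[of e] by (auto simp: csupp_def)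
    then show "?j p \<in> ?S" using jF un I J IJ by auto
    have "w (?j p) = w I * w J" using w na I(1) J(2) IJ by (auto simp: mult_weight_def)
    then show "t (?j p e) * w (?j p) = (case p of (I,J) \<Rightarrow> t (I e) * w I * w J)"
      using IJ \<open>J e = 0\<close> by simp
  next
    fix I assume I: "I \<in> ?S"
    then have IF: "I \<in> F" and e: "e \<in> csupp I" by (auto simp: csupp_def)
    note p = component_props[OF fs[OF IF] e]
    show "?j (?i I) = I" by auto
    have s1: "csupp (fst (?i I)) = ?c I" using p(2) by (auto simp: csupp_def)
    have s2: "csupp (snd (?i I)) = csupp I - ?c I" by (auto simp: csupp_def)
    have "fst (?i I) \<in> F" unfolding fst_conv by (rule Fsplit[OF IF]) (use p in blast)
    moreover have "snd (?i I) \<in> F" unfolding snd_conv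
      by (rule Fsplit[OF IF]) (use p adj_sym in blast)
    ultimately show "?i I \<in> Sigma (polys e U) ?R"
      using p s1 s2 I unfolding polys_def nbhd_def by fastforce
  qed
  finally show ?thesis by simp
qed

lemma pf_split:
  assumes w: "mult_weight w" and U: "U \<subseteq> E"
  shows "pf w U = pf w (U - {e}) + (\<Sum>I\<in>polys e U. w I * pf w (U - nbhd (csupp I)))"
proof -
  have "pf w U = (\<Sum>I\<in>{I\<in>F. csupp I \<subseteq> U - {e}} \<union> {I\<in>F. csupp I \<subseteq> U \<and> I e \<noteq> 0}. w I)"
    unfolding pf_def by (rule sum.cong) (auto simp: csupp_def)
  also have "\<dots> = pf w (U - {e}) + (\<Sum>I\<in>{I\<in>F. csupp I \<subseteq> U \<and> I e \<noteq> 0}. w I)"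
    unfolding pf_def by (rule sum.union_disjoint) (use finF in \<open>auto simp: csupp_def\<close>)
  finally show ?thesis
    using sum_through_edge[OF assms, of "\<lambda>_. 1" e] by simp
qed

lemma card_nbhd: 
  assumes "S \<subseteq> E" shows "card (nbhd S) \<le> D * card S"
proof -
  have "nbhd S = (\<Union>g\<in>S. {f\<in>E. adj g f})" by (auto simp: nbhd_def)
  then have "card (nbhd S) \<le> (\<Sum>g\<in>S. card {f\<in>E. adj g f})"
    by (metis card_UN_le assms finE finite_subset)
  also have "\<dots> \<le> (\<Sum>g\<in>S. D)" by (rule sum_mono) (use deg assms in auto)
  finally show ?thesis by (simp add: mult.commute)
qed

lemma pf_remove_many:
  assumes r: "\<And>V f. V \<subseteq> U \<Longrightarrow> f \<in> V \<Longrightarrow> norm (pf w (V - {f})) \<le> 2 * norm (pf w V)"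
    and fin: "finite N"
  shows "V \<subseteq> U \<Longrightarrow> norm (pf w (V - N)) \<le> 2 ^ card N * norm (pf w V)"
  using fin
proof (induction N arbitrary: V rule: finite_induct)
  case (insert f N)
  have "V - insert f N = (V - {f}) - N" by auto
  then have "norm (pf w (V - insert f N)) \<le> 2 ^ card N * norm (pf w (V - {f}))"
    using insert.IH[of "V - {f}"] insert.prems by auto
  also have "norm (pf w (V - {f})) \<le> 2 * norm (pf w V)"
  proof (cases "f \<in> V")
    case False
    then have "V - {f} = V" by auto
    then show ?thesis by simp
  qed (use r insert.prems in auto)
  finally show ?case using insert.hyps by simp
qed simp

lemma pf_nbhd_le:
  assumes r: "\<And>V f. V \<subseteq> U \<Longrightarrow> f \<in> V \<Longrightarrow> norm (pf w (V - {f})) \<le> 2 * norm (pf w V)"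
    and "S \<subseteq> E" "V \<subseteq> U"
  shows "norm (pf w (V - nbhd S)) \<le> 2 ^ (D * card S) * norm (pf w V)"
proof -
  have "finite (nbhd S)" using finE by (auto simp: nbhd_def)
  then have "norm (pf w (V - nbhd S)) \<le> 2 ^ card (nbhd S) * norm (pf w V)"
    using pf_remove_many[where U = U and w = w] r assms(3) by blast
  also have "\<dots> \<le> 2 ^ (D * card S) * norm (pf w V)"
    by (intro mult_right_mono power_increasing card_nbhd assms) auto
  finally show ?thesis .
qed

text \<open>The induction runs over all subsets of edges, so that deleting the neighbourhood of a polymer costs a factor \<open>2\<close> per edge.\<close>
lemma pf_ratio:
  assumes w: "mult_weight w"
    and small: "\<And>e. e \<in> E \<Longrightarrow> (\<Sum>I\<in>polys e E. norm (w I) * 2 ^ (D * card (csupp I))) \<le> 1/2"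
  shows "U \<subseteq> E \<Longrightarrow> pf w U \<noteq> 0 \<and> (\<forall>e\<in>U. norm (pf w (U - {e})) \<le> 2 * norm (pf w U))"
proof (induction "card U" arbitrary: U rule: less_induct)
  case less
  have finU: "finite U" using less.prems finE finite_subset by blast
  have main: "norm (pf w (U - {e})) \<le> 2 * norm (pf w U)" "pf w U \<noteq> 0" if e: "e \<in> U" for e
  proof -
    let ?V = "U - {e}"
    have IH: "pf w V \<noteq> 0 \<and> (\<forall>f\<in>V. norm (pf w (V - {f})) \<le> 2 * norm (pf w V))" if "V \<subseteq> ?V" for V
    proof (rule less.hyps)
      show "card V < card U" using that e finU by (intro psubset_card_mono) auto
      show "V \<subseteq> E" using that less.prems by auto
    qed
    \<comment> \<open>The neighbourhood of a polymer through \<open>e\<close> contains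
      \<open>e\<close> itself, as adjacency is reflexive. Deleting it from \<open>U\<close> or from
      \<open>?V\<close> is thus the same, and in \<open>?V\<close> the induction hypothesis
      applies.\<close>
    have b: "norm (pf w (U - nbhd (csupp I))) \<le> 2 ^ (D * card (csupp I)) * norm (pf w ?V)"
      if "I \<in> polys e U" for I
    proof -
      have "e \<in> csupp I" "csupp I \<subseteq> E" "e \<in> E"
        using that animal_mem less.prems e by (auto simp: polys_def)
      then have "U - nbhd (csupp I) = ?V - nbhd (csupp I)"
        using adj_refl by (auto simp: nbhd_def)
      moreover have "norm (pf w (?V - nbhd (csupp I))) \<le> 2 ^ (D * card (csupp I)) * norm (pf w ?V)"
        by (rule pf_nbhd_le[where U = ?V]) (use IH \<open>csupp I \<subseteq> E\<close> in auto)
      ultimately show ?thesis by simp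
    qed
    have "norm (pf w U - pf w ?V) = norm (\<Sum>I\<in>polys e U. w I * pf w (U - nbhd (csupp I)))"
      using pf_split[OF w less.prems, of e] by simp
    also have "\<dots> \<le> (\<Sum>I\<in>polys e U. norm (w I) * (2 ^ (D * card (csupp I)) * norm (pf w ?V)))"
      by (intro order_trans[OF norm_sum] sum_mono) (simp add: norm_mult b mult_left_mono)
    also have "\<dots> = (\<Sum>I\<in>polys e U. norm (w I) * 2 ^ (D * card (csupp I))) * norm (pf w ?V)"
      by (simp add: sum_distrib_right mult.assoc)
    also have "\<dots> \<le> (\<Sum>I\<in>polys e E. norm (w I) * 2 ^ (D * card (csupp I))) * norm (pf w ?V)"
      by (intro mult_right_mono sum_mono2) (use finF less.prems in \<open>auto simp: polys_def\<close>)
    also have "\<dots> \<le> 1/2 * norm (pf w ?V)"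
      by (intro mult_right_mono small) (use e less.prems in auto)
    \<comment> \<open>A relative change of at most 1/2 leaves the partition function nonzero and
      gives the ratio bound 2.\<close>
    finally have *: "norm (pf w U - pf w ?V) \<le> 1/2 * norm (pf w ?V)" .
    have "norm (pf w ?V) \<le> norm (pf w U) + norm (pf w U - pf w ?V)"
      by (metis add.commute norm_minus_commute norm_triangle_sub)
    then show "norm (pf w (U - {e})) \<le> 2 * norm (pf w U)" using * by simp
    moreover have "pf w ?V \<noteq> 0" using IH by auto
    ultimately show "pf w U \<noteq> 0" by auto
  qed
  show ?case
  proof (cases "U = {}")
    case True
    have "{I\<in>F. csupp I \<subseteq> {}} = {\<lambda>_. 0}" using F0 by (auto simp: csupp_def)
    then show ?thesis using True w by (auto simp: pf_def mult_weight_def)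
  qed (use main in blast)
qed

text \<open>By \<open>sum_through_edge\<close> the numerator is a sum over polymers through
  \<open>e\<close> alone. Each is weighted by a ratio of partition functions, which
  \<open>pf_ratio\<close> bounds by 2 per deleted edge even for complex weights. Stated without
  division, so that it reads as a bound of the expectation by \<eta>.\<close>

lemma edge_expectation_bound:
  fixes w :: "('e \<Rightarrow> 'v) \<Rightarrow> complex"
  assumes w: "mult_weight w"
    and small: "\<And>e. e \<in> E \<Longrightarrow> (\<Sum>I\<in>polys e E. norm (w I) * 2 ^ (D * card (csupp I))) \<le> 1/2"
    and t0: "t 0 = 0"
    and t: "(\<Sum>I\<in>polys e E. norm (t (I e)) * norm (w I) * 2 ^ (D * card (csupp I))) \<le> \<eta>"
  shows "norm (\<Sum>I\<in>F. t (I e) * w I) \<le> \<eta> * norm (\<Sum>I\<in>F. w I)"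
proof -
  have Feq: "{I\<in>F. csupp I \<subseteq> E} = F" using Fsupp by auto
  have pfE: "pf w E = (\<Sum>I\<in>F. w I)" by (simp add: pf_def Feq)
  have "(\<Sum>I\<in>F. t (I e) * w I) = (\<Sum>I\<in>{I\<in>F. csupp I \<subseteq> E \<and> I e \<noteq> 0}. t (I e) * w I)"
    by (rule sum.mono_neutral_right) (use finF t0 Fsupp in auto)
  also have "\<dots> = (\<Sum>I\<in>polys e E. t (I e) * w I * pf w (E - nbhd (csupp I)))"
    by (rule sum_through_edge[OF w]) simp
  also have "norm \<dots> \<le> (\<Sum>I\<in>polys e E. norm (t (I e)) * norm (w I) * (2 ^ (D * card (csupp I)) * norm (pf w E)))"
  proof (intro order_trans[OF norm_sum] sum_mono)
    fix I assume "I \<in> polys e E"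
    then have "norm (pf w (E - nbhd (csupp I))) \<le> 2 ^ (D * card (csupp I)) * norm (pf w E)"
      by (intro pf_nbhd_le[where U = E]) (use pf_ratio[OF w small] in \<open>auto simp: polys_def\<close>)
    then show "norm (t (I e) * w I * pf w (E - nbhd (csupp I)))
        \<le> norm (t (I e)) * norm (w I) * (2 ^ (D * card (csupp I)) * norm (pf w E))"
      by (simp add: norm_mult mult_left_mono)
  qed
  also have "\<dots> = (\<Sum>I\<in>polys e E. norm (t (I e)) * norm (w I) * 2 ^ (D * card (csupp I))) * norm (pf w E)"
    by (simp add: sum_distrib_right mult.assoc)
  also have "\<dots> \<le> \<eta> * norm (pf w E)" by (intro mult_right_mono t) auto
  finally show ?thesis by (simp add: pfE)
qed


end

section \<open>Counting connected edge sets by walks\<close>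

context config_space begin
definition walks :: "nat \<Rightarrow> 'e \<Rightarrow> 'e list set" where
  "walks n e = {xs. successively adj xs \<and> hd xs = e \<and> length xs = Suc n \<and> set xs \<subseteq> E}"

lemma walks_count: "e \<in> E \<Longrightarrow> finite (walks n e) \<and> card (walks n e) \<le> D ^ n"
proof (induction n arbitrary: e)
  case 0
  have "walks 0 e \<subseteq> {[e]}" by (auto simp: walks_def length_Suc_conv)
  then show ?case
    using finite_subset[of "walks 0 e" "{[e]}"] card_mono[of "{[e]}" "walks 0 e"] by simp
next
  case (Suc n)
  let ?B = "{f\<in>E. adj e f}"
  have finB: "finite ?B" using finE by auto
  have sub: "walks (Suc n) e \<subseteq> (\<Union>f\<in>?B. (#) e ` walks n f)"
  proof
    fix xs assume xs: "xs \<in> walks (Suc n) e"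
    then obtain f ys where "xs = e # f # ys" by (auto simp: walks_def length_Suc_conv)
    then show "xs \<in> (\<Union>f\<in>?B. (#) e ` walks n f)" using xs by (auto simp: walks_def)
  qed
  have fin: "finite (\<Union>f\<in>?B. (#) e ` walks n f)" using finB Suc.IH by auto
  have "card (walks (Suc n) e) \<le> card (\<Union>f\<in>?B. (#) e ` walks n f)" by (rule card_mono[OF fin sub])
  also have "\<dots> \<le> (\<Sum>f\<in>?B. card ((#) e ` walks n f))" by (rule card_UN_le[OF finB])
  also have "\<dots> \<le> (\<Sum>f\<in>?B. D ^ n)"
  proof (rule sum_mono)
    fix f assume "f \<in> ?B"
    then have "finite (walks n f)" "card (walks n f) \<le> D ^ n" using Suc.IH by auto
    then show "card ((#) e ` walks n f) \<le> D ^ n" using card_image_le le_trans by blast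
  qed
  also have "\<dots> \<le> D * D ^ n" using deg[OF Suc.prems] by simp
  finally show ?case using finite_subset[OF sub fin] by simp
qed

text \<open>A walk covering \<open>S\<close> is extended to a new edge \<open>s\<close> by a detour from its neighbour \<open>t\<close>.\<close>
lemma animal_walk:
  "animal e S \<Longrightarrow> \<exists>xs. successively adj xs \<and> hd xs = e \<and> length xs = 2 * card S - 1 \<and> set xs = S"
proof (induction rule: animal.induct)
  case single
  show ?case by (rule exI[of _ "[e]"]) auto
next
  case (grow S t s)
  then obtain xs where xs: "successively adj xs" "hd xs = e" "length xs = 2 * card S - 1" "set xs = S"
    by auto
  then obtain ys zs where sp: "xs = ys @ t # zs" using grow.hyps by (metis split_list)
  have c: "card S \<ge> 1" using grow.hyps animal_finite
    by (metis One_nat_def Suc_leI card_gt_0_iff empty_iff)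
  have "successively adj (ys @ t # s # t # zs)"
    using xs(1) grow.hyps adj_sym unfolding sp by (auto simp: successively_append_iff)
  moreover have "hd (ys @ t # s # t # zs) = e" using xs(2) sp by (cases ys) auto
  moreover have "length (ys @ t # s # t # zs) = 2 * card (insert s S) - 1"
    using xs(3) sp c grow.hyps animal_finite by auto
  moreover have "set (ys @ t # s # t # zs) = insert s S" using xs(4) sp by auto
  ultimately show ?case by blast
qed

text \<open>An animal is the range of a covering walk from \<open>e\<close>, so it is determined by
  at most 2 n - 2 choices among \<open>D\<close> neighbours. The case \<open>n = 0\<close> is
  separate because of the truncated subtraction.\<close>

lemma animals_count:
  assumes "e \<in> E"
  shows "card {S. animal e S \<and> S \<subseteq> E \<and> card S = n} \<le> (D\<^sup>2) ^ n"
proof (cases "n = 0")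
  case True
  then have "{S. animal e S \<and> S \<subseteq> E \<and> card S = n} = {}"
    using animal_mem animal_finite by fastforce
  then show ?thesis by (simp only: card.empty zero_le)
next
  case False
  have D1: "D \<ge> 1"
  proof -
    have "e \<in> {f\<in>E. adj e f}" using assms adj_refl by auto
    moreover have "finite {f\<in>E. adj e f}" using finE by simp
    ultimately have "card {f\<in>E. adj e f} \<ge> 1"
      by (metis One_nat_def Suc_leI card_gt_0_iff empty_iff)
    then show ?thesis using deg[OF assms] by simp
  qed
  have "{S. animal e S \<and> S \<subseteq> E \<and> card S = n} \<subseteq> set ` walks (2 * n - 2) e"
  proof
    fix S assume S: "S \<in> {S. animal e S \<and> S \<subseteq> E \<and> card S = n}"
    then obtain xs where "successively adj xs" "hd xs = e" "length xs = 2 * card S - 1" "set xs = S"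
      using animal_walk by blast
    then show "S \<in> set ` walks (2 * n - 2) e"
      using S False by (intro image_eqI[of _ _ xs]) (auto simp: walks_def)
  qed
  then have "card {S. animal e S \<and> S \<subseteq> E \<and> card S = n} \<le> card (walks (2 * n - 2) e)"
    using walks_count[OF assms] by (meson card_image_le card_mono finite_imageI le_trans)
  also have "\<dots> \<le> D ^ (2 * n - 2)" using walks_count[OF assms] by blast
  also have "\<dots> \<le> D ^ (2 * n)" by (rule power_increasing) (use D1 in auto)
  finally show ?thesis by (simp add: power_mult)
qed

text \<open>Animals are nonempty, so the geometric series starts at exponent 1 and is at most twice
  its first term. This keeps the small factor \<open>x\<close>, which a bound by a mere constant
  would lose.\<close>

lemma animals_sum:
  fixes x :: real
  assumes e: "e \<in> E" and x: "0 \<le> x" "(real D)\<^sup>2 * x \<le> 1/2"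
  shows "(\<Sum>S\<in>{S. animal e S \<and> S \<subseteq> E}. x ^ card S) \<le> 2 * ((real D)\<^sup>2 * x)"
proof -
  let ?A = "{S. animal e S \<and> S \<subseteq> E}"
  let ?y = "(real D)\<^sup>2 * x"
  have fin: "finite ?A" using finE by (auto intro: finite_subset[of _ "Pow E"])
  have img: "card ` ?A \<subseteq> {1..card E}"
  proof
    fix n assume "n \<in> card ` ?A"
    then obtain S where S: "animal e S" "S \<subseteq> E" "n = card S" by auto
    then have "card S > 0" using animal_mem animal_finite by (metis card_gt_0_iff empty_iff)
    then show "n \<in> {1..card E}" using S finE by (auto intro: card_mono)
  qed
  have "(\<Sum>S\<in>?A. x ^ card S) = (\<Sum>n\<in>{1..card E}. \<Sum>S\<in>{S\<in>?A. card S = n}. x ^ card S)"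
    by (rule sum.group[symmetric]) (use fin img in auto)
  also have "\<dots> = (\<Sum>n\<in>{1..card E}. real (card {S. animal e S \<and> S \<subseteq> E \<and> card S = n}) * x ^ n)"
  proof (rule sum.cong[OF refl])
    fix n
    have "(\<Sum>S\<in>{S\<in>?A. card S = n}. x ^ card S) = (\<Sum>S\<in>{S\<in>?A. card S = n}. x ^ n)"
      by (rule sum.cong) auto
    then show "(\<Sum>S\<in>{S\<in>?A. card S = n}. x ^ card S) = real (card {S. animal e S \<and> S \<subseteq> E \<and> card S = n}) * x ^ n"
      by (simp add: conj_assoc)
  qed
  also have "\<dots> \<le> (\<Sum>n\<in>{1..card E}. real ((D\<^sup>2) ^ n) * x ^ n)"
    by (intro sum_mono mult_right_mono of_nat_mono animals_count[OF e] zero_le_power x)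
  also have "\<dots> = (\<Sum>n\<in>{1..card E}. ?y ^ n)" by (simp add: power_mult_distrib)
  also have "\<dots> = (\<Sum>n<card E. ?y * ?y ^ n)"
    by (simp add: sum.atLeast1_atMost_eq)
  also have "\<dots> = ?y * (\<Sum>n<card E. ?y ^ n)" by (simp add: sum_distrib_left)
  also have "\<dots> \<le> ?y * 2"
  proof (rule mult_left_mono)
    have y: "0 \<le> ?y" "?y \<le> 1/2" using x by auto
    have "(\<Sum>n<card E. ?y ^ n) \<le> (\<Sum>n<card E. (1/2) ^ n)"
      by (intro sum_mono power_mono) (use y in auto)
    also have "\<dots> \<le> (\<Sum>n. (1/2) ^ n)" by (rule sum_le_suminf) (auto intro: summable_geometric)
    also have "\<dots> = (2::real)" by (subst suminf_geometric) auto
    finally show "(\<Sum>n<card E. ?y ^ n) \<le> 2" .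
  qed (use x in auto)
  finally show ?thesis by (simp only: mult.commute[of 2])
qed

text \<open>Group the polymers by support. On a fixed support the values are relaxed to independent
  nonzero elements of \<open>V\<close>, so the sum factorises into at most \<open>q\<close> per
  edge; together with the factor 2 ^ D per edge this is a weighted count of animals.\<close>

lemma polys_sum:
  fixes b q :: real
  assumes e: "e \<in> E" and V: "finite V" "\<And>I f. I \<in> F \<Longrightarrow> I f \<in> V"
    and q: "(\<Sum>g\<in>V - {0}. exp (- b * norm g)) \<le> q" and small: "(real D)\<^sup>2 * (2 ^ D * q) \<le> 1/2"
  shows "(\<Sum>I\<in>polys e E. exp (- b * (\<Sum>f\<in>E. norm (I f))) * 2 ^ (D * card (csupp I)))
      \<le> 2 * ((real D)\<^sup>2 * (2 ^ D * q))"
proof -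
  let ?A = "{S. animal e S \<and> S \<subseteq> E}"
  let ?w = "\<lambda>I. exp (- b * (\<Sum>f\<in>E. norm (I f))) * 2 ^ (D * card (csupp I))"
  have q0: "0 \<le> q" using q sum_nonneg[of "V - {0}" "\<lambda>g. exp (- b * norm g)"] by auto
  have finA: "finite ?A" using finE by (auto intro: finite_subset[of _ "Pow E"])
  have "(\<Sum>I\<in>polys e E. ?w I) = (\<Sum>S\<in>?A. \<Sum>I\<in>{I\<in>polys e E. csupp I = S}. ?w I)"
    by (rule sum.group[symmetric]) (use finA finF in \<open>auto simp: polys_def\<close>)
  also have "\<dots> \<le> (\<Sum>S\<in>?A. (2 ^ D * q) ^ card S)"
  proof (rule sum_mono)
    fix S assume S: "S \<in> ?A"
    then have finS: "finite S" using animal_finite by auto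
    let ?P = "{I\<in>polys e E. csupp I = S}"
    \<comment> \<open>\<open>PiE\<close> consists of functions that are undefined off
      \<open>S\<close>; cutting \<open>I\<close> down to \<open>S\<close> is injective because
      \<open>I\<close> vanishes elsewhere.\<close>
    let ?r = "\<lambda>I. restrict I S"
    have inj: "inj_on ?r ?P"
    proof (rule inj_onI)
      fix I J assume IJ: "I \<in> ?P" "J \<in> ?P" "?r I = ?r J"
      show "I = J"
      proof
        fix f
        have "I f = J f" if "f \<in> S" using fun_cong[OF IJ(3), of f] that by simp
        moreover have "I f = 0 \<and> J f = 0" if "f \<notin> S"
        proof -
          have "f \<notin> csupp I" "f \<notin> csupp J" using IJ(1,2) that by blast+
          then show ?thesis by (simp add: csupp_def)
        qed
        ultimately show "I f = J f" by (cases "f \<in> S") simp_all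
      qed
    qed
    have w_eq: "(\<Sum>I\<in>?P. ?w I) = (\<Sum>I\<in>?P. 2 ^ (D * card S) * (\<Prod>f\<in>S. exp (- b * norm (?r I f))))"
    proof (rule sum.cong[OF refl])
      fix I assume I: "I \<in> ?P"
      then have "(\<Sum>f\<in>E. norm (I f)) = (\<Sum>f\<in>S. norm (I f))"
        using S by (intro sum.mono_neutral_right) (auto simp: finE csupp_def)
      then have "exp (- b * (\<Sum>f\<in>E. norm (I f))) = (\<Prod>f\<in>S. exp (- b * norm (I f)))"
        by (simp only: sum_distrib_left exp_sum[OF finS])
      also have "\<dots> = (\<Prod>f\<in>S. exp (- b * norm (?r I f)))" by (rule prod.cong) auto
      finally show "?w I = 2 ^ (D * card S) * (\<Prod>f\<in>S. exp (- b * norm (?r I f)))"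
        using I by (simp only: mem_Collect_eq mult.commute)
    qed
    have w_eq2: "(\<Sum>I\<in>?P. 2 ^ (D * card S) * (\<Prod>f\<in>S. exp (- b * norm (?r I f)))) = 2 ^ (D * card S) * (\<Sum>I\<in>?P. \<Prod>f\<in>S. exp (- b * norm (?r I f)))"
      by (simp only: sum_distrib_left)
    have "(\<Sum>I\<in>?P. \<Prod>f\<in>S. exp (- b * norm (?r I f)))
        = (\<Sum>J\<in>?r ` ?P. \<Prod>f\<in>S. exp (- b * norm (J f)))"
      by (simp only: sum.reindex[OF inj] o_def)
    also have "\<dots> \<le> (\<Sum>J\<in>PiE S (\<lambda>_. V - {0}). \<Prod>f\<in>S. exp (- b * norm (J f)))"
    proof (rule sum_mono2)
      show "finite (PiE S (\<lambda>_. V - {0}))" using finS V by (intro finite_PiE) auto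
      show "?r ` ?P \<subseteq> PiE S (\<lambda>_. V - {0})"
      proof (rule image_subsetI)
        fix I assume I: "I \<in> ?P"
        then have "I f \<in> V" for f using V by (auto simp: polys_def)
        moreover have "I f \<noteq> 0" if "f \<in> S" for f using I that by (auto simp: csupp_def)
        ultimately show "?r I \<in> PiE S (\<lambda>_. V - {0})" by (intro restrict_PiE_iff[THEN iffD2]) auto
      qed
    qed (auto intro: prod_nonneg)
    also have "\<dots> = (\<Prod>f\<in>S. \<Sum>g\<in>V - {0}. exp (- b * norm g))"
      by (rule prod_sum_PiE[symmetric]) (use finS V in auto)
    also have "\<dots> = (\<Sum>g\<in>V - {0}. exp (- b * norm g)) ^ card S" by (rule prod_constant)
    also have "\<dots> \<le> q ^ card S" by (intro power_mono q sum_nonneg) auto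
    finally have B: "(\<Sum>I\<in>?P. \<Prod>f\<in>S. exp (- b * norm (?r I f))) \<le> q ^ card S" .
    have "(\<Sum>I\<in>?P. ?w I) \<le> 2 ^ (D * card S) * q ^ card S"
      unfolding w_eq w_eq2 by (rule mult_left_mono[OF B]) simp
    then show "(\<Sum>I\<in>?P. ?w I) \<le> (2 ^ D * q) ^ card S"
      by (simp only: power_mult_distrib power_mult)
  qed
  also have "\<dots> \<le> 2 * ((real D)\<^sup>2 * (2 ^ D * q))"
    by (rule animals_sum[OF e]) (use q0 small in auto)
  finally show ?thesis .
qed

end

section \<open>Covariances under complex weights\<close>

context config_space begin

definition pair :: "('e \<Rightarrow> 'v) \<Rightarrow> ('e \<Rightarrow> 'v) \<Rightarrow> real" where
  "pair a I = (\<Sum>e\<in>E. a e \<bullet> I e)"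

definition len :: "('e \<Rightarrow> 'v) \<Rightarrow> real" where
  "len I = (\<Sum>e\<in>E. norm (I e))"

lemma pair_add: "pair a (\<lambda>e. I e + J e) = pair a I + pair a J"
  by (simp add: pair_def inner_add_right sum.distrib)

lemma pair_zero [simp]: "pair a (\<lambda>_. 0) = 0"
  by (simp add: pair_def)

lemma pair_minus: "pair a (\<lambda>e. - I e) = - pair a I"
  by (simp add: pair_def sum_negf)

lemma pair_le_len: "(\<And>e. e \<in> E \<Longrightarrow> norm (a e) \<le> 1) \<Longrightarrow> \<bar>pair a I\<bar> \<le> len I"
  unfolding pair_def len_def
  by (intro order_trans[OF sum_abs] sum_mono order_trans[OF Cauchy_Schwarz_ineq2])
    (simp add: mult_left_le_one_le)

lemma norm_le_len: "e \<in> E \<Longrightarrow> norm (I e) \<le> len I"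
  unfolding len_def by (rule member_le_sum) (use finE in auto)

lemma len_nonneg: "0 \<le> len I" by (simp add: len_def sum_nonneg)

end

text \<open>Of the decay rate \<open>b\<close> two units are held back in the assumption on
  \<open>q\<close>: one pays for the complex perturbation by exp (\<i> v Y) with |v| \<le> 1, the
  other for the current in front of the weight. The bound 1/4 is such that \<eta> \<le> 1/2, as
  \<open>pf_ratio\<close> requires.\<close>

locale even_gas = config_space E adj F D
  for E :: "'e set" and adj and F :: "('e \<Rightarrow> 'v::real_inner) set" and D +
  fixes \<rho> :: "('e \<Rightarrow> 'v) \<Rightarrow> real" and b q :: real and V :: "'v set"
  assumes Fneg: "I \<in> F \<Longrightarrow> (\<lambda>e. - I e) \<in> F"
    and rho_nonneg: "I \<in> F \<Longrightarrow> 0 \<le> \<rho> I"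
    and rho_le: "I \<in> F \<Longrightarrow> \<rho> I \<le> exp (- b * len I)"
    and rho_even: "I \<in> F \<Longrightarrow> \<rho> (\<lambda>e. - I e) = \<rho> I"
    and rho_mult: "mult_weight \<rho>"
    and finV: "finite V" and FV: "I \<in> F \<Longrightarrow> I f \<in> V"
    and q: "(\<Sum>g\<in>V - {0}. exp (- (b - 2) * norm g)) \<le> q"
    and small: "(real D)\<^sup>2 * (2 ^ D * q) \<le> 1/4"
begin

definition \<eta> :: real where "\<eta> = 2 * ((real D)\<^sup>2 * (2 ^ D * q))"

lemma odd_sum_zero:
  fixes g :: "('e \<Rightarrow> 'v) \<Rightarrow> real"
  assumes "\<And>I. I \<in> F \<Longrightarrow> g (\<lambda>e. - I e) = - g I"
  shows "(\<Sum>I\<in>F. g I) = 0"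
proof -
  have "(\<Sum>I\<in>F. g I) = (\<Sum>I\<in>F. g (\<lambda>e. - I e))"
    by (rule sum.reindex_bij_witness[of _ "\<lambda>I e. - I e" "\<lambda>I e. - I e"]) (auto simp: Fneg)
  also have "\<dots> = - (\<Sum>I\<in>F. g I)" using assms by (simp add: sum_negf)
  finally show ?thesis by simp
qed

definition L :: "('e \<Rightarrow> 'v) \<Rightarrow> real" where
  "L a = (\<Sum>I\<in>F. \<rho> I * cos (pair a I))"

text \<open>\<open>L1\<close> and \<open>L2\<close> are the first and second partial derivatives of
  \<open>L\<close> at \<open>a\<close>, in the directions \<open>u e\<close> and \<open>u f\<close>
  placed on the edges \<open>e\<close> and \<open>f\<close>. Hence
  \<open>L2 a u e f * L a - L1 a u e * L1 a u f\<close> is \<open>(L a)\<^sup>2\<close> times a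
  second derivative of ln \<open>L\<close>.\<close>

definition L1 :: "('e \<Rightarrow> 'v) \<Rightarrow> ('e \<Rightarrow> 'v) \<Rightarrow> 'e \<Rightarrow> real" where
  "L1 a u e = - (\<Sum>I\<in>F. \<rho> I * (u e \<bullet> I e) * sin (pair a I))"

definition L2 :: "('e \<Rightarrow> 'v) \<Rightarrow> ('e \<Rightarrow> 'v) \<Rightarrow> 'e \<Rightarrow> 'e \<Rightarrow> real" where
  "L2 a u e f = - (\<Sum>I\<in>F. \<rho> I * (u e \<bullet> I e) * (u f \<bullet> I f) * cos (pair a I))"

text \<open>With the signs \<open>\<theta>\<close> of the row entries, the row sum is the derivative at \<open>0\<close> of the complex
  expectation of the current through \<open>e\<close>, perturbed by \<open>exp (\<i> v Y)\<close>, and Cauchy's inequality on the unit disc applies.\<close>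
lemma covariance_row_sum:
  assumes e: "e \<in> E" and u: "\<And>f. norm (u f) \<le> 1"
  shows "L a \<noteq> 0" "(\<Sum>f\<in>E. \<bar>L2 a u e f * L a - L1 a u e * L1 a u f\<bar>) \<le> \<eta> * (L a)\<^sup>2"
proof -
  define \<theta> where "\<theta> f = sgn (L2 a u e f * L a - L1 a u e * L1 a u f)" for f
  define y where "y f = \<theta> f *\<^sub>R u f" for f
  have ny: "norm (y f) \<le> 1" for f using u[of f] by (auto simp: y_def \<theta>_def sgn_real_def)
  define Y where "Y I = pair y I" for I
  \<comment> \<open>The character replaces the cosine because it is multiplicative over components,
    which the cosine is not; the cosine returns at v = 0 by the symmetry I \<mapsto> - I.\<close>
  define w where "w v I = complex_of_real (\<rho> I) * cis (pair a I) * exp (\<i> * v * of_real (Y I))" for v I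
  define \<Phi> where "\<Phi> v = (\<Sum>I\<in>F. w v I)" for v
  \<comment> \<open>The factor \<i> turns the sine part of the character into the real number
    \<open>L1\<close>, so that G 0 / \<Phi> 0 is the logarithmic derivative of
    \<open>L\<close>.\<close>
  define t where "t g = \<i> * complex_of_real (u e \<bullet> g)" for g
  define G where "G v = (\<Sum>I\<in>F. t (I e) * w v I)" for v
  have q0: "0 \<le> q" using q sum_nonneg[of "V - {0}" "\<lambda>g. exp (- (b - 2) * norm g)"] by auto
  have \<eta>: "\<eta> \<le> 1/2" "0 \<le> \<eta>" using small q0 by (auto simp: \<eta>_def)
  have Yl: "\<bar>Y I\<bar> \<le> len I" for I unfolding Y_def by (rule pair_le_len) (rule ny)
  have wn: "norm (w v I) \<le> exp (- (b - 1) * len I)" if "norm v \<le> 1" "I \<in> F" for v I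
  proof -
    have "norm (w v I) = \<rho> I * exp (- (Im v * Y I))"
      using rho_nonneg[OF that(2)] by (simp add: w_def norm_mult norm_exp_eq_Re)
    also have "\<dots> \<le> exp (- b * len I) * exp (len I)"
    proof (intro mult_mono rho_le that)
      have "\<bar>Im v * Y I\<bar> \<le> 1 * len I"
        unfolding abs_mult using that(1) abs_Im_le_cmod[of v] Yl[of I] by (intro mult_mono) auto
      then show "exp (- (Im v * Y I)) \<le> exp (len I)" by simp
    qed auto
    also have "\<dots> = exp (- (b - 1) * len I)" by (simp add: exp_add[symmetric] algebra_simps)
    finally show ?thesis .
  qed
  have wm: "mult_weight (w v)" for v
    using rho_mult unfolding mult_weight_def w_def Y_def
    by (auto simp: pair_add cis_mult[symmetric] exp_add[symmetric] algebra_simps)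
  have psum: "(\<Sum>I\<in>polys f E. exp (- (b - 2) * len I) * 2 ^ (D * card (csupp I))) \<le> \<eta>"
    if "f \<in> E" for f
    unfolding \<eta>_def len_def by (rule polys_sum[where V = V]) (use that finV FV q small in auto)
  have wsum: "(\<Sum>I\<in>polys f E. norm (w v I) * 2 ^ (D * card (csupp I))) \<le> 1/2"
    if "f \<in> E" "norm v \<le> 1" for f v
  proof (rule order_trans[OF _ order_trans[OF psum[OF that(1)] \<eta>(1)]], rule sum_mono)
    fix I assume "I \<in> polys f E"
    then have "norm (w v I) \<le> exp (- (b - 1) * len I)" using wn that by (auto simp: polys_def)
    also have "\<dots> \<le> exp (- (b - 2) * len I)" using len_nonneg[of I] by (simp add: algebra_simps)
    finally show "norm (w v I) * 2 ^ (D * card (csupp I)) \<le> exp (- (b - 2) * len I) * 2 ^ (D * card (csupp I))"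
      by (simp add: mult_right_mono)
  qed
  have tsum: "(\<Sum>I\<in>polys e E. norm (t (I e)) * norm (w v I) * 2 ^ (D * card (csupp I))) \<le> \<eta>"
    if "norm v \<le> 1" for v
  proof (rule order_trans[OF _ psum[OF e]], rule sum_mono)
    fix I assume I: "I \<in> polys e E"
    have "norm (t (I e)) \<le> norm (u e) * norm (I e)"
      by (simp add: t_def norm_mult Cauchy_Schwarz_ineq2)
    also have "\<dots> \<le> 1 * len I" by (intro mult_mono u norm_le_len e) auto
    also have "\<dots> \<le> exp (len I)" using exp_ge_add_one_self[of "len I"] by linarith
    finally have "norm (t (I e)) * norm (w v I) \<le> exp (len I) * exp (- (b - 1) * len I)"
      by (intro mult_mono wn that) (use I in \<open>auto simp: polys_def\<close>)
    also have "\<dots> = exp (- (b - 2) * len I)" by (simp add: exp_add[symmetric] algebra_simps)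
    finally show "norm (t (I e)) * norm (w v I) * 2 ^ (D * card (csupp I)) \<le> exp (- (b - 2) * len I) * 2 ^ (D * card (csupp I))"
      by (simp add: mult_right_mono)
  qed
  have \<Phi>0: "\<Phi> v \<noteq> 0" if "norm v \<le> 1" for v
  proof -
    have "{I\<in>F. csupp I \<subseteq> E} = F" using Fsupp by auto
    then show ?thesis using pf_ratio[OF wm wsum[OF _ that], of E] by (simp add: \<Phi>_def pf_def)
  qed
  have hb: "norm (G v / \<Phi> v) \<le> \<eta>" if "norm v \<le> 1" for v
    using edge_expectation_bound[OF wm wsum[OF _ that] _ tsum[OF that]] \<Phi>0[OF that]
    by (simp add: G_def \<Phi>_def t_def norm_divide divide_le_eq)
  have d\<Phi>: "(\<Phi> has_field_derivative (\<Sum>I\<in>F. w v I * (\<i> * of_real (Y I)))) (at v)" for v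
    unfolding \<Phi>_def[abs_def] w_def by (auto intro!: derivative_eq_intros sum.cong simp: algebra_simps)
  have dG: "(G has_field_derivative (\<Sum>I\<in>F. t (I e) * w v I * (\<i> * of_real (Y I)))) (at v)" for v
    unfolding G_def[abs_def] w_def by (auto intro!: derivative_eq_intros sum.cong simp: algebra_simps)
  let ?h = "\<lambda>v. G v / \<Phi> v"
  let ?G' = "\<Sum>I\<in>F. t (I e) * w 0 I * (\<i> * of_real (Y I))"
  let ?\<Phi>' = "\<Sum>I\<in>F. w 0 I * (\<i> * of_real (Y I))"
  have "?h field_differentiable (at v)" if "norm v \<le> 1" for v
    using DERIV_divide[OF dG d\<Phi> \<Phi>0[OF that]] by (auto simp: field_differentiable_def)
  then have hol: "?h holomorphic_on cball 0 1"
    by (auto simp: holomorphic_on_def intro: field_differentiable_at_within)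
  have "norm ((deriv ^^ 1) ?h 0) \<le> fact 1 * \<eta> / 1 ^ 1"
  proof (rule Cauchy_inequality)
    show "?h holomorphic_on ball 0 1" using hol by (rule holomorphic_on_subset) auto
    show "continuous_on (cball 0 1) ?h" using hol by (rule holomorphic_on_imp_continuous_on)
    show "norm (?h x) \<le> \<eta>" if "norm (0 - x) = 1" for x using hb[of x] that by simp
  qed simp
  moreover have "deriv ?h 0 = (?G' * \<Phi> 0 - G 0 * ?\<Phi>') / (\<Phi> 0 * \<Phi> 0)"
    by (rule DERIV_imp_deriv) (rule DERIV_divide[OF dG d\<Phi> \<Phi>0], simp)
  ultimately have main: "norm ((?G' * \<Phi> 0 - G 0 * ?\<Phi>') / (\<Phi> 0 * \<Phi> 0)) \<le> \<eta>" by simp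
  have mI: "pair c (\<lambda>e. - I e) = - pair c I" for c I by (rule pair_minus)
  \<comment> \<open>At v = 0 the part of each summand that is odd under I \<mapsto> - I cancels, so
    all four quantities are real and expressible by \<open>L\<close>, \<open>L1\<close> and
    \<open>L2\<close>.\<close>
  have s0: "\<Phi> 0 = of_real (L a)"
    using odd_sum_zero[of "\<lambda>I. \<rho> I * sin (pair a I)"]
    by (simp add: \<Phi>_def w_def L_def complex_eq_iff mI rho_even)
  have s1: "G 0 = of_real (L1 a u e)"
    using odd_sum_zero[of "\<lambda>I. \<rho> I * (u e \<bullet> I e) * cos (pair a I)"]
    by (simp add: G_def w_def t_def L1_def complex_eq_iff mI rho_even algebra_simps sum_negf)
  have Yexp: "Y I = (\<Sum>f\<in>E. \<theta> f * (u f \<bullet> I f))" for I by (simp add: Y_def pair_def y_def)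
  have s2: "?\<Phi>' = of_real (\<Sum>f\<in>E. \<theta> f * L1 a u f)"
  proof -
    have "(\<Sum>f\<in>E. \<theta> f * L1 a u f) = - (\<Sum>I\<in>F. \<rho> I * Y I * sin (pair a I))"
      unfolding Yexp L1_def sum_distrib_left sum_distrib_right sum_negf mult_minus_right
      by (subst sum.swap) (simp add: algebra_simps)
    then show ?thesis
      using odd_sum_zero[of "\<lambda>I. \<rho> I * Y I * cos (pair a I)"]
      by (simp add: w_def complex_eq_iff mI Y_def rho_even algebra_simps sum_negf)
  qed
  have s3: "?G' = of_real (\<Sum>f\<in>E. \<theta> f * L2 a u e f)"
  proof -
    have "(\<Sum>f\<in>E. \<theta> f * L2 a u e f) = - (\<Sum>I\<in>F. \<rho> I * (u e \<bullet> I e) * Y I * cos (pair a I))"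
      unfolding Yexp L2_def sum_distrib_left sum_distrib_right sum_negf mult_minus_right
      by (subst sum.swap) (simp add: algebra_simps)
    then show ?thesis
      using odd_sum_zero[of "\<lambda>I. \<rho> I * (u e \<bullet> I e) * Y I * sin (pair a I)"]
      by (simp add: w_def t_def complex_eq_iff mI Y_def rho_even algebra_simps sum_negf)
  qed
  show La: "L a \<noteq> 0" using s0 \<Phi>0[of 0] by auto
  have "(\<Sum>f\<in>E. \<theta> f * L2 a u e f) * L a - L1 a u e * (\<Sum>f\<in>E. \<theta> f * L1 a u f)
      = (\<Sum>f\<in>E. \<theta> f * (L2 a u e f * L a - L1 a u e * L1 a u f))"
    by (simp add: sum_distrib_left sum_distrib_right sum_subtractf algebra_simps)
  also have "\<dots> = (\<Sum>f\<in>E. \<bar>L2 a u e f * L a - L1 a u e * L1 a u f\<bar>)"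
    by (simp add: \<theta>_def abs_sgn mult.commute)
  finally have "norm ((?G' * \<Phi> 0 - G 0 * ?\<Phi>') / (\<Phi> 0 * \<Phi> 0))
      = (\<Sum>f\<in>E. \<bar>L2 a u e f * L a - L1 a u e * L1 a u f\<bar>) / (L a)\<^sup>2"
    unfolding s0 s1 s2 s3 of_real_mult[symmetric] of_real_diff[symmetric] of_real_divide[symmetric] norm_of_real
    by (simp add: power2_eq_square sum_nonneg)
  then show "(\<Sum>f\<in>E. \<bar>L2 a u e f * L a - L1 a u e * L1 a u f\<bar>) \<le> \<eta> * (L a)\<^sup>2"
    using main La by (simp add: divide_le_eq)
qed

end

section \<open>From row sums to the convexity of a corrected logarithm\<close>

context even_gas begin

text \<open>Schur's test: a symmetric matrix whose absolute row sums are at most \<eta>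
  \<open>(L a)\<^sup>2\<close> has a quadratic form of at least - \<eta>
  \<open>(L a)\<^sup>2\<close> times the square norm. It is applied to the lengths of the vectors
  \<gamma> e, their directions being absorbed into \<open>u\<close>.\<close>

lemma log_curvature:
  assumes ne: "E \<noteq> {}"
  shows "L a \<noteq> 0"
    "- (\<eta> * (\<Sum>e\<in>E. (norm (\<gamma> e))\<^sup>2)) * (L a)\<^sup>2 \<le>
      - (\<Sum>I\<in>F. \<rho> I * (pair \<gamma> I)\<^sup>2 * cos (pair a I)) * L a - (\<Sum>I\<in>F. \<rho> I * pair \<gamma> I * sin (pair a I))\<^sup>2"
proof -
  define u where "u e = sgn (\<gamma> e)" for e
  define c where "c e = norm (\<gamma> e)" for e
  define M where "M e f = L2 a u e f * L a - L1 a u e * L1 a u f" for e f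
  have u1: "norm (u f) \<le> 1" for f by (simp add: u_def norm_sgn)
  have row: "(\<Sum>f\<in>E. \<bar>M e f\<bar>) \<le> \<eta> * (L a)\<^sup>2" if "e \<in> E" for e
    unfolding M_def by (rule covariance_row_sum[OF that u1])
  show "L a \<noteq> 0" using ne covariance_row_sum(1)[OF _ u1] by blast
  have \<gamma>: "\<gamma> e \<bullet> g = c e * (u e \<bullet> g)" for e g
  proof -
    have "\<gamma> e = c e *\<^sub>R u e" by (cases "\<gamma> e = 0") (simp_all add: c_def u_def sgn_div_norm)
    then show ?thesis by simp
  qed
  have X: "pair \<gamma> I = (\<Sum>e\<in>E. c e * (u e \<bullet> I e))" for I by (simp add: pair_def \<gamma>)
  have p1: "- (\<Sum>I\<in>F. \<rho> I * pair \<gamma> I * sin (pair a I)) = (\<Sum>e\<in>E. c e * L1 a u e)"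
    unfolding X L1_def sum_distrib_left sum_distrib_right mult_minus_right sum_negf
    by (subst sum.swap) (simp add: algebra_simps)
  have p2: "- (\<Sum>I\<in>F. \<rho> I * (pair \<gamma> I)\<^sup>2 * cos (pair a I)) = (\<Sum>e\<in>E. \<Sum>f\<in>E. c e * c f * L2 a u e f)"
  proof -
    have "(\<Sum>e\<in>E. \<Sum>f\<in>E. c e * c f * L2 a u e f)
       = - (\<Sum>e\<in>E. \<Sum>f\<in>E. \<Sum>I\<in>F. \<rho> I * (c e * (u e \<bullet> I e)) * (c f * (u f \<bullet> I f)) * cos (pair a I))"
      unfolding L2_def sum_distrib_left mult_minus_right sum_negf by (simp add: algebra_simps)
    also have "\<dots> = - (\<Sum>e\<in>E. \<Sum>I\<in>F. \<Sum>f\<in>E. \<rho> I * (c e * (u e \<bullet> I e)) * (c f * (u f \<bullet> I f)) * cos (pair a I))"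
      by (subst sum.swap) simp
    also have "\<dots> = - (\<Sum>I\<in>F. \<Sum>e\<in>E. \<Sum>f\<in>E. \<rho> I * (c e * (u e \<bullet> I e)) * (c f * (u f \<bullet> I f)) * cos (pair a I))"
      by (subst sum.swap) simp
    also have "\<dots> = - (\<Sum>I\<in>F. \<rho> I * (pair \<gamma> I)\<^sup>2 * cos (pair a I))"
    proof -
      have "(pair \<gamma> I)\<^sup>2 = (\<Sum>e\<in>E. \<Sum>f\<in>E. (c e * (u e \<bullet> I e)) * (c f * (u f \<bullet> I f)))" for I
        by (simp add: X power2_eq_square sum_product)
      then show ?thesis by (simp add: sum_distrib_left sum_distrib_right mult.assoc)
    qed
    finally show ?thesis by simp
  qed
  have Msym: "M e f = M f e" for e f by (simp add: M_def L2_def algebra_simps)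
  have "- (\<Sum>I\<in>F. \<rho> I * (pair \<gamma> I)\<^sup>2 * cos (pair a I)) * L a - (\<Sum>I\<in>F. \<rho> I * pair \<gamma> I * sin (pair a I))\<^sup>2
     = (\<Sum>e\<in>E. \<Sum>f\<in>E. c e * c f * L2 a u e f) * L a - (\<Sum>e\<in>E. c e * L1 a u e)\<^sup>2"
    unfolding p1[symmetric] p2 by simp
  also have "\<dots> = (\<Sum>e\<in>E. \<Sum>f\<in>E. c e * c f * M e f)"
  proof -
    have "(\<Sum>e\<in>E. c e * L1 a u e)\<^sup>2 = (\<Sum>e\<in>E. \<Sum>f\<in>E. (c e * L1 a u e) * (c f * L1 a u f))"
      by (simp add: power2_eq_square sum_product)
    then show ?thesis
      by (simp add: M_def sum_distrib_right sum_distrib_left right_diff_distrib sum_subtractf mult_ac)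
  qed
  also have "\<dots> \<ge> (\<Sum>e\<in>E. \<Sum>f\<in>E. - ((c e)\<^sup>2 / 2 * \<bar>M e f\<bar> + (c f)\<^sup>2 / 2 * \<bar>M e f\<bar>))"
  proof (intro sum_mono)
    fix e f
    have "c e * c f * M e f \<ge> - (c e * c f * \<bar>M e f\<bar>)"
      using abs_ge_minus_self[of "c e * c f * M e f"] by (simp add: abs_mult c_def)
    moreover have "c e * c f \<le> (c e)\<^sup>2 / 2 + (c f)\<^sup>2 / 2"
      using sum_squares_bound[of "c e" "c f"] by (simp add: power2_eq_square)
    then have "c e * c f * \<bar>M e f\<bar> \<le> ((c e)\<^sup>2 / 2 + (c f)\<^sup>2 / 2) * \<bar>M e f\<bar>"
      by (rule mult_right_mono) simp
    ultimately show "- ((c e)\<^sup>2 / 2 * \<bar>M e f\<bar> + (c f)\<^sup>2 / 2 * \<bar>M e f\<bar>) \<le> c e * c f * M e f"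
      by (simp add: algebra_simps)
  qed
  also have "(\<Sum>e\<in>E. \<Sum>f\<in>E. - ((c e)\<^sup>2 / 2 * \<bar>M e f\<bar> + (c f)\<^sup>2 / 2 * \<bar>M e f\<bar>))
     = - (\<Sum>e\<in>E. (c e)\<^sup>2 * (\<Sum>f\<in>E. \<bar>M e f\<bar>))"
  proof -
    have "(\<Sum>e\<in>E. \<Sum>f\<in>E. (c f)\<^sup>2 / 2 * \<bar>M e f\<bar>) = (\<Sum>e\<in>E. \<Sum>f\<in>E. (c e)\<^sup>2 / 2 * \<bar>M e f\<bar>)"
      by (subst sum.swap) (simp add: Msym)
    moreover have "(\<Sum>e\<in>E. \<Sum>f\<in>E. (c e)\<^sup>2 / 2 * \<bar>M e f\<bar>) = (\<Sum>e\<in>E. (c e)\<^sup>2 * (\<Sum>f\<in>E. \<bar>M e f\<bar>)) / 2"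
      by (simp add: sum_distrib_left sum_divide_distrib)
    ultimately show ?thesis by (simp only: sum_negf sum.distrib)
  qed
  finally have "- (\<Sum>e\<in>E. (c e)\<^sup>2 * (\<Sum>f\<in>E. \<bar>M e f\<bar>)) \<le>
    - (\<Sum>I\<in>F. \<rho> I * (pair \<gamma> I)\<^sup>2 * cos (pair a I)) * L a - (\<Sum>I\<in>F. \<rho> I * pair \<gamma> I * sin (pair a I))\<^sup>2" .
  moreover have "(\<Sum>e\<in>E. (c e)\<^sup>2 * (\<Sum>f\<in>E. \<bar>M e f\<bar>)) \<le> (\<Sum>e\<in>E. (c e)\<^sup>2 * (\<eta> * (L a)\<^sup>2))"
    by (intro sum_mono mult_left_mono row) auto
  moreover have "(\<Sum>e\<in>E. (c e)\<^sup>2 * (\<eta> * (L a)\<^sup>2)) = \<eta> * (\<Sum>e\<in>E. (norm (\<gamma> e))\<^sup>2) * (L a)\<^sup>2"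
    by (simp add: sum_distrib_right sum_distrib_left c_def algebra_simps)
  ultimately show "- (\<eta> * (\<Sum>e\<in>E. (norm (\<gamma> e))\<^sup>2)) * (L a)\<^sup>2 \<le>
      - (\<Sum>I\<in>F. \<rho> I * (pair \<gamma> I)\<^sup>2 * cos (pair a I)) * L a - (\<Sum>I\<in>F. \<rho> I * pair \<gamma> I * sin (pair a I))\<^sup>2"
    by simp
qed

lemma pair_line: "pair (\<lambda>e. a e + s *\<^sub>R \<gamma> e) I = pair a I + s * pair \<gamma> I"
  by (simp add: pair_def inner_add_left sum.distrib sum_distrib_left)

text \<open>\<open>L\<close> has no zero on the segment from 0 to \<open>a\<close> and is
  nonnegative at 0, where all cosines are 1. So it cannot change sign, although its terms
  do.\<close>

lemma L_pos:
  assumes ne: "E \<noteq> {}"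
  shows "0 < L a"
proof (rule ccontr)
  assume "\<not> 0 < L a"
  define f where "f s = L (\<lambda>e. 0 + s *\<^sub>R a e)" for s
  have p0: "pair (\<lambda>e. 0) I = 0" for I by (simp add: pair_def)
  have f: "f s = (\<Sum>I\<in>F. \<rho> I * cos (s * pair a I))" for s
    unfolding f_def L_def pair_line by (simp add: p0)
  have "f 1 \<le> 0" using \<open>\<not> 0 < L a\<close> by (simp add: f_def)
  moreover have "f 0 \<ge> 0" by (simp add: f sum_nonneg rho_nonneg)
  moreover have "isCont f x" for x unfolding f[abs_def] by (intro continuous_intros)
  ultimately obtain s where "f s = 0" using IVT2[of f 1 0 0] by auto
  then show False using log_curvature(1)[OF ne] by (simp add: f_def)
qed

text \<open>The product cos (t X) cos (A) is the mean of the cosines at A + t X and A - t X, so this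
  is the second-difference inequality for \<open>L\<close>. The spare factor
  \<open>cos (pair a I)\<close> with arbitrary \<open>a\<close> is what the Gaussian averaging acts
  on.\<close>

lemma second_difference:
  "0 \<le> (\<Sum>I\<in>F. \<rho> I * (cos (t * pair \<gamma> I) - exp (- (t\<^sup>2 / 2) * (\<eta> * (\<Sum>e\<in>E. (norm (\<gamma> e))\<^sup>2)))) * cos (pair a I))"
proof (cases "E = {}")
  \<comment> \<open>Without edges there is no row to invoke, but then every bracket is 1 -
    1.\<close>
  case True
  have p: "pair c I = 0" for c I unfolding pair_def using True by simp
  show ?thesis unfolding p using True by simp
next
  case ne: False
  define S where "S = \<eta> * (\<Sum>e\<in>E. (norm (\<gamma> e))\<^sup>2)"
  define l where "l s = (\<Sum>I\<in>F. \<rho> I * cos (pair a I + s * pair \<gamma> I))" for s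
  define l1 where "l1 s = - (\<Sum>I\<in>F. \<rho> I * pair \<gamma> I * sin (pair a I + s * pair \<gamma> I))" for s
  define l2 where "l2 s = - (\<Sum>I\<in>F. \<rho> I * (pair \<gamma> I)\<^sup>2 * cos (pair a I + s * pair \<gamma> I))" for s
  have lL: "l s = L (\<lambda>e. a e + s *\<^sub>R \<gamma> e)" for s by (simp add: l_def L_def pair_line)
  have lpos: "0 < l s" for s unfolding lL by (rule L_pos[OF ne])
  have curv: "- S * (l s)\<^sup>2 \<le> l2 s * l s - (l1 s)\<^sup>2" for s
    using log_curvature(2)[OF ne, of \<gamma> "\<lambda>e. a e + s *\<^sub>R \<gamma> e"]
    by (simp add: lL[symmetric] S_def l1_def l2_def pair_line)
  have d1: "(l has_real_derivative l1 s) (at s)" for s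
    unfolding l_def[abs_def] l1_def
    by (auto intro!: derivative_eq_intros sum.cong simp: sum_negf[symmetric])
  have d2: "(l1 has_real_derivative l2 s) (at s)" for s
    unfolding l1_def[abs_def] l2_def
    by (auto intro!: derivative_eq_intros sum.cong simp: sum_negf[symmetric] power2_eq_square)
  \<comment> \<open>The curvature bound says that the parabola S s^2 / 2 makes ln l convex.
    Convexity at the midpoint of - t and t is all that is used.\<close>
  define k where "k s = ln (l s) + S * s\<^sup>2 / 2" for s
  have "convex_on UNIV k"
  proof (rule f''_ge0_imp_convex)
    show "(k has_real_derivative (l1 s / l s + S * s)) (at s)" for s
      unfolding k_def[abs_def] by (rule derivative_eq_intros d1 lpos refl | simp)+
    show "((\<lambda>s. l1 s / l s + S * s) has_real_derivative ((l2 s * l s - l1 s * l1 s) / (l s * l s) + S)) (at s)" for s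
      by (rule derivative_eq_intros d1 d2 refl | use lpos[of s] in simp)+
    show "0 \<le> (l2 s * l s - l1 s * l1 s) / (l s * l s) + S" for s
      using curv[of s] lpos[of s] by (simp add: field_simps power2_eq_square)
  qed auto
  from convex_onD[OF this, of "1/2" t "-t"] have "k 0 \<le> k t / 2 + k (- t) / 2" by simp
  then have "2 * ln (l 0) - S * t\<^sup>2 \<le> ln (l t) + ln (l (- t))"
    by (simp add: k_def field_simps)
  also have "\<dots> = ln (l t * l (- t))" using lpos[of t] lpos[of "- t"] by (simp add: ln_mult)
  also have "\<dots> \<le> ln (((l t + l (- t)) / 2)\<^sup>2)"
  proof -
    have "l t * l (- t) \<le> ((l t + l (- t)) / 2)\<^sup>2"
      using zero_le_power2[of "l t - l (- t)"] by (simp add: power2_eq_square field_simps)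
    moreover have "0 < l t * l (- t)" using lpos by (rule mult_pos_pos) (rule lpos)
    moreover have "0 < l t + l (- t)" using lpos by (rule add_pos_pos) (rule lpos)
    ultimately show ?thesis by (subst ln_le_cancel_iff) simp_all
  qed
  also have "\<dots> = 2 * ln ((l t + l (- t)) / 2)"
    using lpos[of t] lpos[of "-t"] by (simp add: ln_realpow)
  finally have "ln (l 0) - S * t\<^sup>2 / 2 \<le> ln ((l t + l (- t)) / 2)" by simp
  then have "exp (ln (l 0) - S * t\<^sup>2 / 2) \<le> exp (ln ((l t + l (- t)) / 2))" by simp
  moreover have "exp (ln (l 0) - S * t\<^sup>2 / 2) = l 0 * exp (- (t\<^sup>2 / 2) * S)"
  proof -
    have "ln (l 0) - S * t\<^sup>2 / 2 = ln (l 0) + - (t\<^sup>2 / 2) * S" by simp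
    then show ?thesis using lpos[of 0] by (simp only: exp_add exp_ln)
  qed
  moreover have "exp (ln ((l t + l (- t)) / 2)) = (l t + l (- t)) / 2"
    using lpos[of t] lpos[of "-t"] by simp
  ultimately have "l 0 * exp (- (t\<^sup>2 / 2) * S) \<le> (l t + l (- t)) / 2" by simp
  also have "(l t + l (- t)) / 2 = (\<Sum>I\<in>F. \<rho> I * cos (t * pair \<gamma> I) * cos (pair a I))"
    unfolding l_def sum.distrib[symmetric] sum_divide_distrib
    by (rule sum.cong) (simp_all add: cos_add cos_diff algebra_simps)
  also have "l 0 * exp (- (t\<^sup>2 / 2) * S) = (\<Sum>I\<in>F. \<rho> I * exp (- (t\<^sup>2 / 2) * S) * cos (pair a I))"
    by (simp add: l_def sum_distrib_right algebra_simps)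
  finally show ?thesis
    by (simp add: S_def right_diff_distrib left_diff_distrib sum_subtractf)
qed

end

section \<open>Gaussian averages of characters\<close>

lemma expectation_cos_gaussian:
  "integrable std_normal_distribution (\<lambda>g. cos (\<alpha> + g * \<tau>))"
  "(\<integral>g. cos (\<alpha> + g * \<tau>) \<partial>std_normal_distribution) = cos \<alpha> * exp (- \<tau>\<^sup>2 / 2)"
proof -
  interpret prob_space std_normal_distribution
    by (simp add: prob_space_normal_density)
  show "integrable std_normal_distribution (\<lambda>g. cos (\<alpha> + g * \<tau>))"
    by (rule integrable_const_bound[of _ 1]) auto
  have i: "integrable std_normal_distribution (\<lambda>g. iexp (\<tau> * g))"
    by (rule integrable_const_bound[of _ 1]) auto
  have "(\<integral>g. cos (\<alpha> + g * \<tau>) \<partial>std_normal_distribution)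
      = (\<integral>g. Re (cis \<alpha> * iexp (\<tau> * g)) \<partial>std_normal_distribution)"
    by (rule Bochner_Integration.integral_cong) (auto simp: cos_add Re_exp Im_exp algebra_simps)
  also have "\<dots> = Re (cis \<alpha> * (\<integral>g. iexp (\<tau> * g) \<partial>std_normal_distribution))"
    using i by (subst integral_Re) auto
  also have "(\<integral>g. iexp (\<tau> * g) \<partial>std_normal_distribution) = of_real (exp (- \<tau>\<^sup>2 / 2))"
    using fun_cong[OF char_std_normal_distribution, of \<tau>] by (simp add: char_def)
  finally show "(\<integral>g. cos (\<alpha> + g * \<tau>) \<partial>std_normal_distribution) = cos \<alpha> * exp (- \<tau>\<^sup>2 / 2)"
    by simp
qed

context config_space begin

text \<open>One factor exp (- y^2 / 2) is the mean of a shift of the phase by g y with g standard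
  normal. A shift of the phase is a change of \<open>a\<close>, and the hypothesis holds for all
  \<open>a\<close>, so averaging preserves nonnegativity although \<open>\<kappa>\<close> has no
  sign. The induction inserts one square after another.\<close>

lemma gaussian_factors:
  assumes "finite K" and pos: "\<And>a. 0 \<le> (\<Sum>I\<in>F. \<kappa> I * cos (pair a I))"
  shows "0 \<le> (\<Sum>I\<in>F. \<kappa> I * exp (- (\<Sum>k\<in>K. (pair (c k) I)\<^sup>2) / 2) * cos (pair a I))"
  using assms(1)
proof (induction K arbitrary: a rule: finite_induct)
  case empty
  then show ?case using pos by simp
next
  case (insert k K)
  let ?\<kappa> = "\<lambda>I. \<kappa> I * exp (- (\<Sum>k\<in>K. (pair (c k) I)\<^sup>2) / 2)"
  have line: "pair (\<lambda>e. a e + g *\<^sub>R c k e) I = pair a I + g * pair (c k) I" for g I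
    by (simp add: pair_def inner_add_left sum.distrib sum_distrib_left)
  have "(\<Sum>I\<in>F. \<kappa> I * exp (- (\<Sum>k\<in>insert k K. (pair (c k) I)\<^sup>2) / 2) * cos (pair a I))
     = (\<Sum>I\<in>F. ?\<kappa> I * (\<integral>g. cos (pair a I + g * pair (c k) I) \<partial>std_normal_distribution))"
    unfolding expectation_cos_gaussian(2) using insert.hyps
    by (intro sum.cong) (auto simp: exp_add[symmetric] diff_divide_distrib add_divide_distrib)
  also have "\<dots> = (\<integral>g. (\<Sum>I\<in>F. ?\<kappa> I * cos (pair a I + g * pair (c k) I)) \<partial>std_normal_distribution)"
    by (subst Bochner_Integration.integral_sum) (auto intro!: expectation_cos_gaussian(1) integrable_mult_right)
  also have "\<dots> \<ge> 0"
    using insert.IH[of "\<lambda>e. a e + g *\<^sub>R c k e" for g] by (intro Bochner_Integration.integral_nonneg) (simp add: line)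
  finally show ?case .
qed

end

section \<open>Quadratic forms as sums of squares\<close>

text \<open>Linearity is asked in the first argument only; symmetry supplies the second. Functions
  on an arbitrary index type serve as the vector space, and supports in a finite set make it
  finite-dimensional.\<close>

definition fun_bilinear :: "(('k \<Rightarrow> real) \<Rightarrow> ('k \<Rightarrow> real) \<Rightarrow> real) \<Rightarrow> bool" where
  "fun_bilinear B \<longleftrightarrow> (\<forall>x y. B x y = B y x) \<and> (\<forall>x y z. B (\<lambda>k. x k + y k) z = B x z + B y z) \<and>
     (\<forall>c x z. B (\<lambda>k. c * x k) z = c * B x z)"

lemma
  assumes "fun_bilinear B"
  shows fun_bilinear_sym: "B x y = B y x"
    and fun_bilinear_add: "B (\<lambda>k. x k + y k) z = B x z + B y z"
    and fun_bilinear_scale: "B (\<lambda>k. c * x k) z = c * B x z"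
  by (rule assms[unfolded fun_bilinear_def, THEN conjunct1, rule_format]
      assms[unfolded fun_bilinear_def, THEN conjunct2, THEN conjunct1, rule_format]
      assms[unfolded fun_bilinear_def, THEN conjunct2, THEN conjunct2, rule_format])+

text \<open>Subtracting x f(1) leaves an additive function that vanishes on the integers, hence has
  period 1 and is bounded everywhere. A bounded additive function is 0, as its multiples
  show.\<close>

lemma additive_bounded_linear:
  fixes f :: "real \<Rightarrow> real"
  assumes add: "\<And>x y. f (x + y) = f x + f y" and bd: "\<And>x. \<bar>x\<bar> \<le> 1 \<Longrightarrow> \<bar>f x\<bar> \<le> K"
  shows "f x = x * f 1"
proof -
  define g where "g x = f x - x * f 1" for x
  have gadd: "g (x + y) = g x + g y" for x y by (simp add: g_def add algebra_simps)
  have g1: "g 1 = 0" by (simp add: g_def)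
  have g0: "g 0 = 0" using gadd[of 0 0] by simp
  have gneg: "g (- x) = - g x" for x using gadd[of x "- x"] g0 by simp
  have gnat: "g (real n * x) = real n * g x" for n x
    by (induction n) (simp_all add: g0 gadd algebra_simps)
  have gint: "g (real_of_int n) = 0" for n
    using gnat[of "nat n" 1] gnat[of "nat (- n)" 1] g1 gneg[of "real_of_int n"] by (cases "0 \<le> n") auto
  have bdg: "\<bar>g y\<bar> \<le> K + \<bar>f 1\<bar>" for y
  proof -
    have "g y = g (frac y)" using gadd[of "frac y" "real_of_int \<lfloor>y\<rfloor>"] gint by (simp add: frac_def)
    moreover have fr: "\<bar>frac y\<bar> \<le> 1" using frac_ge_0[of y] frac_lt_1[of y] by simp
    moreover have "\<bar>frac y * f 1\<bar> \<le> 1 * \<bar>f 1\<bar>" unfolding abs_mult by (intro mult_right_mono fr) auto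
    ultimately show ?thesis using bd[OF fr] unfolding g_def by linarith
  qed
  have "g x = 0"
  proof (rule ccontr)
    assume "g x \<noteq> 0"
    then obtain n :: nat where "K + \<bar>f 1\<bar> < real n * \<bar>g x\<bar>"
      using reals_Archimedean3[of "\<bar>g x\<bar>"] by auto
    then show False using bdg[of "real n * x"] by (simp add: gnat abs_mult)
  qed
  then show ?thesis by (simp add: g_def)
qed

text \<open>Polarisation defines the form, and the parallelogram law makes it additive. Real
  homogeneity does not follow from additivity; it comes from local boundedness, since for |t| \<le>
  1 the value at (t x, z) is at most (Q x + Q z) / 2 in modulus.\<close>

lemma jordan_von_neumann:
  fixes Q :: "('k \<Rightarrow> real) \<Rightarrow> real"
  assumes par: "\<And>x y. Q (\<lambda>k. x k + y k) + Q (\<lambda>k. x k - y k) = 2 * Q x + 2 * Q y"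
    and hom: "\<And>c x. Q (\<lambda>k. c * x k) = c\<^sup>2 * Q x" and nonneg: "\<And>x. 0 \<le> Q x"
  shows "\<exists>B. fun_bilinear B \<and> (\<forall>x. Q x = B x x)"
proof -
  define B where "B x y = (Q (\<lambda>k. x k + y k) - Q (\<lambda>k. x k - y k)) / 4" for x y
  have neg: "Q (\<lambda>k. - x k) = Q x" for x using hom[of "-1" x] by simp
  have sym: "B x y = B y x" for x y
  proof -
    have "Q (\<lambda>k. x k - y k) = Q (\<lambda>k. y k - x k)" using neg[of "\<lambda>k. y k - x k"] by simp
    then show ?thesis by (simp add: B_def add.commute)
  qed
  have add: "B (\<lambda>k. x k + y k) z = B x z + B y z" for x y z
  proof -
    \<comment> \<open>In the sum of the first two laws minus the last two, the terms with x - y and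
      y - x cancel because Q is even.\<close>
    have p: "Q (\<lambda>k. x k + y k + z k) + Q (\<lambda>k. x k - y k + z k) = 2 * Q (\<lambda>k. x k + z k) + 2 * Q y" 
      "Q (\<lambda>k. x k + y k + z k) + Q (\<lambda>k. y k - x k + z k) = 2 * Q (\<lambda>k. y k + z k) + 2 * Q x" 
      "Q (\<lambda>k. x k + y k - z k) + Q (\<lambda>k. x k - y k - z k) = 2 * Q (\<lambda>k. x k - z k) + 2 * Q y" 
      "Q (\<lambda>k. x k + y k - z k) + Q (\<lambda>k. y k - x k - z k) = 2 * Q (\<lambda>k. y k - z k) + 2 * Q x" 
      using par[of "\<lambda>k. x k + z k" y] par[of "\<lambda>k. y k + z k" x] par[of "\<lambda>k. x k - z k" y] par[of "\<lambda>k. y k - z k" x]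
      by (simp_all add: algebra_simps)
    have n: "Q (\<lambda>k. y k - x k - z k) = Q (\<lambda>k. x k - y k + z k)" "Q (\<lambda>k. x k - y k - z k) = Q (\<lambda>k. y k - x k + z k)"
      using neg[of "\<lambda>k. x k - y k + z k"] neg[of "\<lambda>k. y k - x k + z k"] by (simp_all add: algebra_simps)
    show ?thesis unfolding B_def using p n by (simp add: field_simps)
  qed
  have scale: "B (\<lambda>k. c * x k) z = c * B x z" for c x z
  proof -
    have "B (\<lambda>k. c * x k) z = c * B (\<lambda>k. 1 * x k) z"
    proof (rule additive_bounded_linear[where f = "\<lambda>c. B (\<lambda>k. c * x k) z"])
      show "B (\<lambda>k. (s + t) * x k) z = B (\<lambda>k. s * x k) z + B (\<lambda>k. t * x k) z" for s t
        by (simp add: add[symmetric] distrib_right)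
      fix t :: real assume t: "\<bar>t\<bar> \<le> 1"
      have "\<bar>B (\<lambda>k. t * x k) z\<bar> \<le> (Q (\<lambda>k. t * x k + z k) + Q (\<lambda>k. t * x k - z k)) / 4"
        unfolding B_def using nonneg[of "\<lambda>k. t * x k + z k"] nonneg[of "\<lambda>k. t * x k - z k"] by simp
      also have "\<dots> = (2 * (t\<^sup>2 * Q x) + 2 * Q z) / 4" by (simp add: par hom)
      also have "\<dots> \<le> (2 * (1 * Q x) + 2 * Q z) / 4"
        using t nonneg by (intro divide_right_mono add_right_mono mult_left_mono mult_right_mono) (auto simp: abs_square_le_1)
      finally show "\<bar>B (\<lambda>k. t * x k) z\<bar> \<le> (2 * (1 * Q x) + 2 * Q z) / 4" .
    qed
    then show ?thesis by simp
  qed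
  have "Q x = B x x" for x
  proof -
    have "B x x = (Q (\<lambda>k. 2 * x k) - Q (\<lambda>k. 0 * x k)) / 4" by (simp add: B_def)
    then show ?thesis by (simp only: hom) simp
  qed
  then show ?thesis using sym add scale unfolding fun_bilinear_def by (intro exI[of _ B]) blast
qed

definition unit_fun :: "'k \<Rightarrow> 'k \<Rightarrow> real" where
  "unit_fun j k = (if k = j then 1 else 0)"

lemma fun_bilinear_expand:
  assumes B: "fun_bilinear B" and "finite K"
  shows "(\<And>k. k \<notin> K \<Longrightarrow> x k = 0) \<Longrightarrow> B x z = (\<Sum>j\<in>K. x j * B (unit_fun j) z)"
  using \<open>finite K\<close>
proof (induction K arbitrary: x rule: finite_induct)
  case empty
  then have "B x z = B (\<lambda>k. 0 * x k) z" by (intro arg_cong[where f = "\<lambda>x. B x z"]) auto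
  also have "\<dots> = 0 * B x z" by (rule fun_bilinear_scale[OF B])
  finally show ?case by simp
next
  case (insert k K)
  let ?x = "x(k := 0)"
  have "B x z = B (\<lambda>i. ?x i + x k * unit_fun k i) z"
    by (intro arg_cong[where f = "\<lambda>x. B x z"]) (auto simp: unit_fun_def)
  also have "\<dots> = B ?x z + B (\<lambda>i. x k * unit_fun k i) z" by (rule fun_bilinear_add[OF B])
  also have "B (\<lambda>i. x k * unit_fun k i) z = x k * B (unit_fun k) z" by (rule fun_bilinear_scale[OF B])
  finally have "B x z = B ?x z + x k * B (unit_fun k) z" .
  also have "B ?x z = (\<Sum>j\<in>K. ?x j * B (unit_fun j) z)" by (rule insert.IH) (use insert.prems in auto)
  also have "\<dots> = (\<Sum>j\<in>K. x j * B (unit_fun j) z)" by (rule sum.cong) (use insert.hyps in auto)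
  finally show ?case using insert.hyps by simp
qed

text \<open>Completing the square: subtracting the square of the functional B(u, -) / sqrt B(u, u)
  makes the coordinate direction \<open>u\<close> degenerate. The remainder is still positive
  semidefinite, being the form at a shifted argument, and depends on one coordinate fewer.\<close>

lemma psd_sum_of_squares:
  fixes B :: "('k \<Rightarrow> real) \<Rightarrow> ('k \<Rightarrow> real) \<Rightarrow> real"
  assumes "finite K" "fun_bilinear B" "\<And>x. 0 \<le> B x x"
  shows "\<exists>(n::nat) l. \<forall>x. (\<forall>k. k \<notin> K \<longrightarrow> x k = 0) \<longrightarrow> B x x = (\<Sum>m<n. (\<Sum>j\<in>K. l m j * x j)\<^sup>2)"
  using assms
proof (induction K arbitrary: B rule: finite_induct)
  case empty
  have "B x x = 0" if "\<forall>k. x k = 0" for x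
  proof -
    have "B x x = (\<Sum>j\<in>{}. x j * B (unit_fun j) x)"
      by (rule fun_bilinear_expand[OF empty.prems(1)]) (use that in auto)
    then show ?thesis by simp
  qed
  then show ?case by (intro exI[of _ 0]) auto
next
  case (insert k K)
  let ?u = "unit_fun k"
  let ?\<alpha> = "B ?u ?u"
  \<comment> \<open>If the diagonal entry vanishes, the whole row does (fact \<open>z\<close>), and
    the subtracted square is 0.\<close>
  define d where "d = (if ?\<alpha> = 0 then 0 else 1 / sqrt ?\<alpha>)"
  define B' where "B' x y = B x y - (d * B ?u x) * (d * B ?u y)" for x y
  have sym: "B x y = B y x" and add: "B (\<lambda>k. x k + y k) z = B x z + B y z" 
    and sc: "B (\<lambda>k. c * x k) z = c * B x z" for x y z c
    by (rule fun_bilinear_sym[OF insert.prems(1)] fun_bilinear_add[OF insert.prems(1)] fun_bilinear_scale[OF insert.prems(1)])+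
  have addr: "B z (\<lambda>k. x k + y k) = B z x + B z y" and scr: "B z (\<lambda>k. c * x k) = c * B z x" for x y z c
    unfolding sym[of z] by (rule add sc)+
  have quad: "B (\<lambda>i. x i + c * ?u i) (\<lambda>i. x i + c * ?u i) = B x x + 2 * c * B ?u x + c\<^sup>2 * ?\<alpha>" for x c
    by (simp add: add addr sc scr sym[of x ?u] power2_eq_square algebra_simps)
  have \<alpha>: "0 \<le> ?\<alpha>" by (rule insert.prems)
  have z: "B ?u x = 0" if "?\<alpha> = 0" for x
  proof (rule ccontr)
    assume n: "B ?u x \<noteq> 0"
    \<comment> \<open>With vanishing diagonal entry the form is affine in \<open>c\<close>; this
      \<open>c\<close> would give it the value - 1.\<close>
    define c where "c = - (B x x + 1) / (2 * B ?u x)"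
    have "2 * c * B ?u x = - (B x x + 1)" using n by (simp add: c_def)
    then have "B (\<lambda>i. x i + c * ?u i) (\<lambda>i. x i + c * ?u i) = - 1" using quad[of x c] that by simp
    then show False using insert.prems(2)[of "\<lambda>i. x i + c * ?u i"] by simp
  qed
  have d2: "d * d * ?\<alpha> * B ?u x = B ?u x" for x
    using z[of x] \<alpha> by (simp add: d_def real_sqrt_mult_self)
  have B'bl: "fun_bilinear B'"
    unfolding fun_bilinear_def B'_def
    using sym by (auto simp: add sc addr scr algebra_simps)
  have B'psd: "0 \<le> B' x x" for x
  proof -
    have "d * d * (d * d * ?\<alpha> * B ?u x) = d * d * B ?u x" by (simp only: d2)
    then have "B' x x = B (\<lambda>i. x i + (- d * d * B ?u x) * ?u i) (\<lambda>i. x i + (- d * d * B ?u x) * ?u i)"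
      unfolding quad B'_def by (simp add: power2_eq_square algebra_simps)
    then show ?thesis using insert.prems(2) by simp
  qed
  obtain n :: nat and l where l: "\<And>x. (\<forall>k. k \<notin> K \<longrightarrow> x k = 0) \<Longrightarrow> B' x x = (\<Sum>m<n. (\<Sum>j\<in>K. l m j * x j)\<^sup>2)"
    using insert.IH[OF B'bl B'psd] by blast
  define l' where "l' m j = (if m < n then (if j = k then 0 else l m j) else d * B (unit_fun j) ?u)" for m j
  have "B x x = (\<Sum>m<Suc n. (\<Sum>j\<in>insert k K. l' m j * x j)\<^sup>2)" if x: "\<forall>i. i \<notin> insert k K \<longrightarrow> x i = 0" for x
  proof -
    let ?x = "x(k := 0)"
    have dec: "x = (\<lambda>i. ?x i + x k * ?u i)" by (auto simp: unit_fun_def)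
    have u0: "B' ?u y = 0" "B' y ?u = 0" for y
      using d2[of y] by (simp_all add: B'_def sym[of y ?u] algebra_simps)
    have drop: "B' x z = B' ?x z" for z
    proof -
      have "B' x z = B' (\<lambda>i. ?x i + x k * ?u i) z" by (rule arg_cong[where f = "\<lambda>x. B' x z", OF dec])
      also have "\<dots> = B' ?x z" by (simp only: fun_bilinear_add[OF B'bl] fun_bilinear_scale[OF B'bl] u0 mult_zero_right add_0_right)
      finally show ?thesis .
    qed
    have "B' x x = B' ?x x" by (rule drop)
    also have "\<dots> = B' x ?x" by (rule fun_bilinear_sym[OF B'bl])
    also have "\<dots> = B' ?x ?x" by (rule drop)
    also have "B' ?x ?x = (\<Sum>m<n. (\<Sum>j\<in>K. l m j * ?x j)\<^sup>2)" by (rule l) (use x in auto)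
    also have "\<dots> = (\<Sum>m<n. (\<Sum>j\<in>insert k K. l' m j * x j)\<^sup>2)"
    proof (rule sum.cong[OF refl])
      fix m assume m: "m \<in> {..<n}"
      have "(\<Sum>j\<in>insert k K. l' m j * x j) = (\<Sum>j\<in>K. l' m j * x j)"
        using insert.hyps m by (simp add: l'_def)
      also have "\<dots> = (\<Sum>j\<in>K. l m j * ?x j)"
        using insert.hyps m by (intro sum.cong) (auto simp: l'_def)
      finally show "(\<Sum>j\<in>K. l m j * ?x j)\<^sup>2 = (\<Sum>j\<in>insert k K. l' m j * x j)\<^sup>2" by simp
    qed
    finally have a: "B' x x = (\<Sum>m<n. (\<Sum>j\<in>insert k K. l' m j * x j)\<^sup>2)" .
    have "B x ?u = (\<Sum>j\<in>insert k K. x j * B (unit_fun j) ?u)"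
      by (rule fun_bilinear_expand[OF insert.prems(1)]) (use insert.hyps x in auto)
    then have "d * B ?u x = (\<Sum>j\<in>insert k K. l' n j * x j)"
      using sym[of x ?u] by (simp add: l'_def sum_distrib_left mult_ac)
    then show ?thesis using a by (simp add: B'_def power2_eq_square)
  qed
  then show ?case by blast
qed

section \<open>Smooth and compactly supported functions\<close>

lemma pd_has_derivative: "(f has_derivative f') (at x) \<Longrightarrow> pd i f x = f' (axis i 1)"
  using frechet_derivative_at by (metis pd_def)

lemma smooth_differentiable: "smooth f \<Longrightarrow> iter_pd ds f differentiable (at x)"
  by (simp add: smooth_def)

lemma smooth_differentiable0: "smooth f \<Longrightarrow> f differentiable (at x)"
  using smooth_differentiable[of f "[]"] by simp

lemma iter_pd_append: "iter_pd ds (iter_pd es f) = iter_pd (ds @ es) f"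
  by (induction ds) auto

lemma smooth_iter_pd: "smooth f \<Longrightarrow> smooth (iter_pd es f)"
  by (simp add: smooth_def iter_pd_append)

lemma smooth_pd: "smooth f \<Longrightarrow> smooth (pd i f)"
  using smooth_iter_pd[of f "[i]"] by simp

lemma smooth_continuous: "smooth f \<Longrightarrow> continuous_on S f"
  by (meson smooth_differentiable0 differentiable_imp_continuous_within continuous_at_imp_continuous_on)

text \<open>Smoothness by invariance: any class of differentiable functions that is stable under
  partial derivatives consists of smooth functions. All closure lemmas below choose such a
  class.\<close>

lemma smoothI_closed:
  assumes P: "P f" and d: "\<And>f x. P f \<Longrightarrow> f differentiable (at x)" and p: "\<And>f i. P f \<Longrightarrow> P (pd i f)"
  shows "smooth f"
proof -
  have "P (iter_pd ds f)" for ds by (induction ds) (auto simp: P p)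
  then show ?thesis using d by (auto simp: smooth_def)
qed

lemma pd_add:
  assumes "f differentiable (at x)" "g differentiable (at x)"
  shows "pd i (\<lambda>x. f x + g x) x = pd i f x + pd i g x"
proof -
  have "((\<lambda>x. f x + g x) has_derivative (\<lambda>h. frechet_derivative f (at x) h + frechet_derivative g (at x) h)) (at x)"
    using assms by (intro has_derivative_add frechet_derivative_works[THEN iffD1])
  from pd_has_derivative[OF this] show ?thesis by (simp add: pd_def)
qed

lemma pd_linear:
  assumes "bounded_linear T" "f differentiable (at x)"
  shows "pd i (\<lambda>x. T (f x)) x = T (pd i f x)"
proof -
  have "((\<lambda>x. T (f x)) has_derivative (\<lambda>h. T (frechet_derivative f (at x) h))) (at x)"
    by (rule bounded_linear.has_derivative[OF assms(1) frechet_derivative_works[THEN iffD1, OF assms(2)]])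
  from pd_has_derivative[OF this] show ?thesis by (simp add: pd_def)
qed

lemma differentiable_linear: "bounded_linear T \<Longrightarrow> f differentiable (at x) \<Longrightarrow> (\<lambda>x. T (f x)) differentiable (at x)"
  unfolding differentiable_def by (elim exE, rule exI, erule (1) bounded_linear.has_derivative)

lemma smooth_add:
  assumes "smooth f" "smooth g" shows "smooth (\<lambda>x. f x + g x)"
proof (rule smoothI_closed[where P = "\<lambda>h. \<exists>f g. smooth f \<and> smooth g \<and> h = (\<lambda>x. f x + g x)"])
  fix h i assume "\<exists>f g. smooth f \<and> smooth g \<and> h = (\<lambda>x. f x + g x)"
  then obtain f g where fg: "smooth f" "smooth g" "h = (\<lambda>x. f x + g x)" by blast
  have "pd i h = (\<lambda>x. pd i f x + pd i g x)"
    unfolding fg(3) by (rule ext, rule pd_add) (use fg smooth_differentiable0 in auto)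
  then show "\<exists>f g. smooth f \<and> smooth g \<and> pd i h = (\<lambda>x. f x + g x)" using fg smooth_pd by blast
qed (use assms smooth_differentiable0 in \<open>auto intro!: differentiable_add\<close>)

lemma smooth_linear:
  assumes "bounded_linear T" "smooth f" shows "smooth (\<lambda>x. T (f x))"
proof (rule smoothI_closed[where P = "\<lambda>h. \<exists>f. smooth f \<and> h = (\<lambda>x. T (f x))"])
  fix h assume "\<exists>f. smooth f \<and> h = (\<lambda>x. T (f x))"
  then obtain f where f: "smooth f" "h = (\<lambda>x. T (f x))" by blast
  have "pd i h = (\<lambda>x. T (pd i f x))" for i
    unfolding f(2) by (rule ext, rule pd_linear[OF assms(1) smooth_differentiable0[OF f(1)]])
  then show "\<exists>f. smooth f \<and> pd i h = (\<lambda>x. T (f x))" for i using smooth_pd[OF f(1)] by blast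
  show "h differentiable (at x)" for x
    unfolding f(2) by (rule differentiable_linear[OF assms(1) smooth_differentiable0[OF f(1)]])
qed (use assms in blast)

lemma smooth_zero: "smooth (\<lambda>x. 0)"
proof (rule smoothI_closed[where P = "\<lambda>h. h = (\<lambda>x. 0)"])
  show "pd i f = (\<lambda>x. 0)" if "f = (\<lambda>x. 0)" for f :: "vec \<Rightarrow> 'a" and i
  proof
    fix x show "pd i f x = 0" using pd_has_derivative[of f "\<lambda>h. 0" x i] that by simp
  qed
qed auto

lemma smooth_sum: "(\<And>k. k \<in> K \<Longrightarrow> smooth (f k)) \<Longrightarrow> smooth (\<lambda>x. \<Sum>k\<in>K. f k x)"
  by (induction K rule: infinite_finite_induct) (auto intro: smooth_zero smooth_add)

lemma compact_supp_add:
  assumes "compact_supp f" "compact_supp g" shows "compact_supp (\<lambda>x. f x + g x)"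
proof -
  obtain R S where "\<forall>x. R < norm x \<longrightarrow> f x = 0" "\<forall>x. S < norm x \<longrightarrow> g x = 0"
    using assms unfolding compact_supp_def by blast
  then show ?thesis unfolding compact_supp_def by (intro exI[of _ "max R S"]) auto
qed

lemma compact_supp_zero: "compact_supp (\<lambda>x. 0)" by (simp add: compact_supp_def)

lemma compact_supp_map: "compact_supp f \<Longrightarrow> T 0 = 0 \<Longrightarrow> compact_supp (\<lambda>x. T (f x))"
  unfolding compact_supp_def by fastforce

lemma compact_supp_sum: "(\<And>k. k \<in> K \<Longrightarrow> compact_supp (f k)) \<Longrightarrow> compact_supp (\<lambda>x. \<Sum>k\<in>K. f k x)"
  by (induction K rule: infinite_finite_induct) (auto intro: compact_supp_zero compact_supp_add)

section \<open>Gradients and differentiation under the integral sign\<close>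

definition grad :: "(vec \<Rightarrow> real) \<Rightarrow> vec \<Rightarrow> vec" where
  "grad f x = (\<chi> i. pd i f x)"

lemma grad_has_derivative:
  assumes "f differentiable (at x)"
  shows "(f has_derivative (\<lambda>h. grad f x \<bullet> h)) (at x)"
proof -
  let ?D = "frechet_derivative f (at x)"
  have D: "(f has_derivative ?D) (at x)" using assms by (rule frechet_derivative_works[THEN iffD1])
  have lin: "linear ?D" using D by (rule has_derivative_linear)
  have "?D h = grad f x \<bullet> h" for h
  proof -
    have "h = (\<Sum>i\<in>UNIV. h$i *\<^sub>R axis i 1)" using basis_expansion[of h] by (simp add: scalar_mult_eq_scaleR)
    then have "?D h = ?D (\<Sum>i\<in>UNIV. h$i *\<^sub>R axis i 1)" by (rule arg_cong)
    also have "\<dots> = (\<Sum>i\<in>UNIV. h$i *\<^sub>R ?D (axis i 1))" by (simp only: linear_sum[OF lin] linear_scale[OF lin])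
    finally show ?thesis by (simp add: inner_vec_def grad_def pd_def mult.commute)
  qed
  then have "?D = (\<lambda>h. grad f x \<bullet> h)" by auto
  then show ?thesis using D by simp
qed

lemma continuous_grad: "smooth f \<Longrightarrow> continuous_on S (grad f)"
  unfolding grad_def[abs_def] by (intro continuous_on_vec_lambda smooth_continuous smooth_pd)

text \<open>Convolution of \<open>f\<close> with the image under \<open>p\<close> of a measure of
  density \<open>c\<close>. Segments (for the Burgers density) and triangles (for its primitive) are
  both of this form.\<close>

definition param_int :: "'b::euclidean_space set \<Rightarrow> ('b \<Rightarrow> real) \<Rightarrow> ('b \<Rightarrow> vec) \<Rightarrow> (vec \<Rightarrow> real) \<Rightarrow> vec \<Rightarrow> real" where
  "param_int S c p f x = integral S (\<lambda>t. c t * f (x - p t))"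

lemma param_int_has_derivative:
  assumes f: "smooth f" and c: "continuous_on (cbox a b) c" and p: "continuous_on (cbox a b) p"
  shows "(param_int (cbox a b) c p f has_derivative
     (\<lambda>h. integral (cbox a b) (\<lambda>t. c t * (grad f (x - p t) \<bullet> h)))) (at x)"
proof -
  define fx where "fx x t = c t *\<^sub>R blinfun_inner_right (grad f (x - p t))" for x t
  have cont_fx: "continuous_on (UNIV \<times> cbox a b) (\<lambda>(x, t). fx x t)"
    unfolding fx_def split_beta
    by (intro continuous_intros bounded_linear.continuous_on[OF bounded_linear_blinfun_inner_right]
        continuous_on_compose2[OF continuous_grad[OF f, of UNIV]]
        continuous_on_compose2[OF c] continuous_on_compose2[OF p]) auto
  have int: "(\<lambda>t. c t * f (x - p t)) integrable_on cbox a b" for x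
    by (intro integrable_continuous continuous_intros c continuous_on_compose2[OF smooth_continuous[OF f, of UNIV]] p) auto
  have fxint: "fx x integrable_on cbox a b" for x
    unfolding fx_def
    by (intro integrable_continuous continuous_intros bounded_linear.continuous_on[OF bounded_linear_blinfun_inner_right]
        continuous_on_compose2[OF continuous_grad[OF f, of UNIV]] c p) auto
  have "((\<lambda>x. integral (cbox a b) (\<lambda>t. c t * f (x - p t))) has_derivative integral (cbox a b) (fx x)) (at x within UNIV)"
  proof (rule leibniz_rule[OF _ _ cont_fx])
    fix x t assume "t \<in> cbox a b"
    have "((\<lambda>x. f (x - p t)) has_derivative (\<lambda>h. grad f (x - p t) \<bullet> h)) (at x)"
    proof -
      have "((\<lambda>x. x - p t) has_derivative (\<lambda>h. h)) (at x)" by (auto intro!: derivative_eq_intros)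
      from has_derivative_compose[OF this grad_has_derivative[OF smooth_differentiable0[OF f]]]
      show ?thesis .
    qed
    then have "((\<lambda>x. c t * f (x - p t)) has_derivative (\<lambda>h. c t * (grad f (x - p t) \<bullet> h))) (at x)"
      by (rule has_derivative_mult_right)
    moreover have "blinfun_apply (fx x t) = (\<lambda>h. c t * (grad f (x - p t) \<bullet> h))"
      by (rule ext) (simp add: fx_def blinfun.scaleR_left)
    ultimately show "((\<lambda>x. c t * f (x - p t)) has_derivative blinfun_apply (fx x t)) (at x within UNIV)"
      by simp
  qed (use int in auto)
  moreover have "blinfun_apply (integral (cbox a b) (fx x)) = (\<lambda>h. integral (cbox a b) (\<lambda>t. c t * (grad f (x - p t) \<bullet> h)))"
    by (rule ext) (simp add: blinfun_apply_integral[OF fxint] fx_def blinfun.scaleR_left)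
  ultimately show ?thesis by (simp add: param_int_def[abs_def])
qed

lemma pd_param_int:
  assumes "smooth f" "continuous_on (cbox a b) c" "continuous_on (cbox a b) p"
  shows "pd i (param_int (cbox a b) c p f) = param_int (cbox a b) c p (pd i f)"
  by (rule ext) (simp add: pd_has_derivative[OF param_int_has_derivative[OF assms]] param_int_def grad_def inner_axis)

lemma smooth_param_int:
  assumes "smooth f" "continuous_on (cbox a b) c" "continuous_on (cbox a b) p"
  shows "smooth (param_int (cbox a b) c p f)"
proof (rule smoothI_closed[where P = "\<lambda>h. \<exists>f. smooth f \<and> h = param_int (cbox a b) c p f"])
  show "h differentiable (at x)" if "\<exists>f. smooth f \<and> h = param_int (cbox a b) c p f" for h x
    using that param_int_has_derivative assms(2,3) unfolding differentiable_def by blast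
  show "\<exists>f. smooth f \<and> pd i h = param_int (cbox a b) c p f"
    if "\<exists>f. smooth f \<and> h = param_int (cbox a b) c p f" for h i
    using that pd_param_int[OF _ assms(2,3)] smooth_pd by blast
qed (use assms in auto)

lemma compact_supp_param_int:
  assumes "compact_supp f" "continuous_on (cbox a b) p"
  shows "compact_supp (param_int (cbox a b) c p f)"
proof -
  obtain R where R: "\<And>x. R < norm x \<Longrightarrow> f x = 0" using assms(1) unfolding compact_supp_def by blast
  have "bounded (p ` cbox a b)" using assms(2) compact_continuous_image compact_cbox compact_imp_bounded by blast
  then obtain M where M: "\<And>t. t \<in> cbox a b \<Longrightarrow> norm (p t) \<le> M" unfolding bounded_iff by blast
  have "param_int (cbox a b) c p f x = 0" if "R + M < norm x" for x
  proof -
    have "f (x - p t) = 0" if "t \<in> cbox a b" for t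
      by (rule R) (use M[OF that] \<open>R + M < norm x\<close> norm_triangle_ineq2[of x "p t"] in linarith)
    then have "integral (cbox a b) (\<lambda>t. c t * f (x - p t)) = integral (cbox a b) (\<lambda>t. 0)"
      by (intro integral_cong) auto
    then show ?thesis by (simp add: param_int_def)
  qed
  then show ?thesis unfolding compact_supp_def by blast
qed

section \<open>A primitive of the Burgers vector density\<close>

lemma segment_derivative:
  assumes f: "smooth f"
  shows "((\<lambda>s. f (x - \<sigma> *\<^sub>R (a + s *\<^sub>R d))) has_vector_derivative
      - (\<sigma> * (grad f (x - \<sigma> *\<^sub>R (a + s *\<^sub>R d)) \<bullet> d))) (at s within S)"
    and "((\<lambda>\<sigma>. f (x - \<sigma> *\<^sub>R p)) has_vector_derivative - (grad f (x - \<sigma> *\<^sub>R p) \<bullet> p)) (at \<sigma> within S)"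
proof -
  have 1: "((\<lambda>s. x - \<sigma> *\<^sub>R (a + s *\<^sub>R d)) has_derivative (\<lambda>h. - ((\<sigma> * h) *\<^sub>R d))) (at s within S)"
    by (auto intro!: derivative_eq_intros simp: algebra_simps)
  show "((\<lambda>s. f (x - \<sigma> *\<^sub>R (a + s *\<^sub>R d))) has_vector_derivative
      - (\<sigma> * (grad f (x - \<sigma> *\<^sub>R (a + s *\<^sub>R d)) \<bullet> d))) (at s within S)"
    unfolding has_vector_derivative_def
    using has_derivative_compose[OF 1 grad_has_derivative[OF smooth_differentiable0[OF f]]]
    by (simp add: mult_ac)
  have 2: "((\<lambda>\<sigma>. x - \<sigma> *\<^sub>R p) has_derivative (\<lambda>h. - (h *\<^sub>R p))) (at \<sigma> within S)"
    by (auto intro!: derivative_eq_intros)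
  show "((\<lambda>\<sigma>. f (x - \<sigma> *\<^sub>R p)) has_vector_derivative - (grad f (x - \<sigma> *\<^sub>R p) \<bullet> p)) (at \<sigma> within S)"
    unfolding has_vector_derivative_def
    using has_derivative_compose[OF 2 grad_has_derivative[OF smooth_differentiable0[OF f]]]
    by simp
qed

text \<open>Stokes' theorem on the triangle with vertices \<open>0\<close>, \<open>a\<close>, \<open>a + d\<close>, parametrised by \<open>(\<sigma>, s) \<mapsto> \<sigma> (a + s d)\<close>.\<close>
lemma triangle_stokes:
  assumes f: "smooth f"
  shows "integral (cbox (0,0) (1,1)) (\<lambda>t::real\<times>real. fst t *
        ((a + snd t *\<^sub>R d)$l * (grad f (x - fst t *\<^sub>R (a + snd t *\<^sub>R d)) \<bullet> d)
         - d$l * (grad f (x - fst t *\<^sub>R (a + snd t *\<^sub>R d)) \<bullet> (a + snd t *\<^sub>R d))))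
    = d$l * integral {0..1} (\<lambda>s. f (x - (a + s *\<^sub>R d)))
      + (a$l * integral {0..1} (\<lambda>\<sigma>. f (x - \<sigma> *\<^sub>R a)) - (a + d)$l * integral {0..1} (\<lambda>\<sigma>. f (x - \<sigma> *\<^sub>R (a + d))))"
proof -
  define P where "P s = a + s *\<^sub>R d" for s
  define G where "G \<sigma> s = grad f (x - \<sigma> *\<^sub>R P s)" for \<sigma> s
  define F1 where "F1 \<sigma> s = \<sigma> * (P s $ l * (G \<sigma> s \<bullet> d))" for \<sigma> s
  define F2 where "F2 \<sigma> s = \<sigma> * (G \<sigma> s \<bullet> P s)" for \<sigma> s
  define Ph where "Ph \<sigma> s = f (x - \<sigma> *\<^sub>R P s)" for \<sigma> s
  note cf = continuous_on_compose2[OF smooth_continuous[OF f, of UNIV] _ subset_UNIV]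
  note cg = continuous_on_compose2[OF continuous_grad[OF f, of UNIV] _ subset_UNIV]
  have c1: "continuous_on S (\<lambda>t. F1 (u t) (v t))" and c2: "continuous_on S (\<lambda>t. F2 (u t) (v t))"
    and c3: "continuous_on S (\<lambda>t. Ph (u t) (v t))"
    if "continuous_on S u" "continuous_on S v" for S :: "'z::topological_space set" and u v
    unfolding F1_def F2_def Ph_def G_def P_def
    by (intro continuous_intros cf cg that)+
  \<comment> \<open>\<open>F1\<close> is integrated by parts in s and \<open>F2\<close> in \<sigma>.
    Each leaves the double integral of \<open>Ph\<close>, and these cancel in F1 - d$l F2; what
    remains are integrals over the three sides of the triangle.\<close>
  have I1: "integral {0..1} (F1 \<sigma>) = d$l * integral {0..1} (Ph \<sigma>) - ((a + d)$l * f (x - \<sigma> *\<^sub>R (a + d)) - a$l * f (x - \<sigma> *\<^sub>R a))" for \<sigma>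
  proof -
    have "((\<lambda>s. d$l * Ph \<sigma> s - F1 \<sigma> s) has_integral (P 1 $ l * Ph \<sigma> 1 - P 0 $ l * Ph \<sigma> 0)) {0..1}"
    proof (rule fundamental_theorem_of_calculus)
      fix s :: real
      have "((\<lambda>s. P s $ l) has_vector_derivative d$l) (at s within {0..1})"
        unfolding P_def by (auto intro!: derivative_eq_intros simp: has_real_derivative_iff_has_vector_derivative[symmetric])
      from has_vector_derivative_mult[OF this segment_derivative(1)[OF f, of x \<sigma> a d s "{0..1}"]]
      show "((\<lambda>s. P s $ l * Ph \<sigma> s) has_vector_derivative (d$l * Ph \<sigma> s - F1 \<sigma> s)) (at s within {0..1})"
        by (simp add: Ph_def F1_def P_def G_def algebra_simps)
    qed simp
    then have "integral {0..1} (\<lambda>s. d$l * Ph \<sigma> s - F1 \<sigma> s) = P 1 $ l * Ph \<sigma> 1 - P 0 $ l * Ph \<sigma> 0"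
      by (rule integral_unique)
    moreover have "integral {0..1} (\<lambda>s. d$l * Ph \<sigma> s - F1 \<sigma> s) = d$l * integral {0..1} (Ph \<sigma>) - integral {0..1} (F1 \<sigma>)"
      by (subst integral_diff) (auto intro!: integrable_continuous_real continuous_intros c1 c3)
    ultimately show ?thesis by (simp add: P_def Ph_def)
  qed
  have I2: "integral {0..1} (\<lambda>\<sigma>. F2 \<sigma> s) = integral {0..1} (\<lambda>\<sigma>. Ph \<sigma> s) - f (x - P s)" for s
  proof -
    have "((\<lambda>\<sigma>. Ph \<sigma> s - F2 \<sigma> s) has_integral (1 * Ph 1 s - 0 * Ph 0 s)) {0..1}"
    proof (rule fundamental_theorem_of_calculus)
      fix \<sigma> :: real
      have "((\<lambda>\<sigma>. \<sigma>) has_vector_derivative (1::real)) (at \<sigma> within {0..1})" by simp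
      from has_vector_derivative_mult[OF this segment_derivative(2)[OF f, of x "P s" \<sigma> "{0..1}"]]
      show "((\<lambda>\<sigma>. \<sigma> * Ph \<sigma> s) has_vector_derivative (Ph \<sigma> s - F2 \<sigma> s)) (at \<sigma> within {0..1})"
        by (simp add: Ph_def F2_def G_def algebra_simps)
    qed simp
    then have "integral {0..1} (\<lambda>\<sigma>. Ph \<sigma> s - F2 \<sigma> s) = f (x - P s)"
      by (simp add: integral_unique Ph_def)
    moreover have "integral {0..1} (\<lambda>\<sigma>. Ph \<sigma> s - F2 \<sigma> s) = integral {0..1} (\<lambda>\<sigma>. Ph \<sigma> s) - integral {0..1} (\<lambda>\<sigma>. F2 \<sigma> s)"
      by (subst integral_diff) (auto intro!: integrable_continuous_real continuous_intros c2 c3)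
    ultimately show ?thesis by simp
  qed
  have "continuous_on ({0..1} \<times> cbox 0 1) (\<lambda>(\<sigma>, s). Ph \<sigma> s)"
    unfolding split_beta by (intro c3 continuous_intros)
  from integral_continuous_on_param[OF this]
  have cPh1: "continuous_on {0..1} (\<lambda>\<sigma>. integral {0..1} (Ph \<sigma>))" by simp
  have "continuous_on ({0..1} \<times> cbox 0 1) (\<lambda>(s, \<sigma>). Ph \<sigma> s)"
    unfolding split_beta by (intro c3 continuous_intros)
  from integral_continuous_on_param[OF this]
  have cPh2: "continuous_on {0..1} (\<lambda>s. integral {0..1} (\<lambda>\<sigma>. Ph \<sigma> s))" by simp
  have Q1: "integral (cbox (0,0) (1,1)) (\<lambda>t. F1 (fst t) (snd t))
     = d$l * integral {0..1} (\<lambda>\<sigma>. integral {0..1} (Ph \<sigma>))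
       - ((a + d)$l * integral {0..1} (\<lambda>\<sigma>. f (x - \<sigma> *\<^sub>R (a + d))) - a$l * integral {0..1} (\<lambda>\<sigma>. f (x - \<sigma> *\<^sub>R a)))"
  proof -
    have "integral (cbox (0,0) (1,1)) (\<lambda>t. F1 (fst t) (snd t)) = integral {0..1} (\<lambda>\<sigma>. integral {0..1} (F1 \<sigma>))"
      by (subst integral_prod_continuous) (auto intro!: c1 continuous_intros)
    also have "\<dots> = integral {0..1} (\<lambda>\<sigma>. d$l * integral {0..1} (Ph \<sigma>) - ((a + d)$l * f (x - \<sigma> *\<^sub>R (a + d)) - a$l * f (x - \<sigma> *\<^sub>R a)))"
      unfolding I1 ..
    also have "\<dots> = d$l * integral {0..1} (\<lambda>\<sigma>. integral {0..1} (Ph \<sigma>))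
       - ((a + d)$l * integral {0..1} (\<lambda>\<sigma>. f (x - \<sigma> *\<^sub>R (a + d))) - a$l * integral {0..1} (\<lambda>\<sigma>. f (x - \<sigma> *\<^sub>R a)))"
      by (subst integral_diff, (intro integrable_continuous_real continuous_intros cPh1 cf)+,
          subst integral_diff, (intro integrable_continuous_real continuous_intros cf)+, simp)
    finally show ?thesis .
  qed
  have Q2: "integral (cbox (0,0) (1,1)) (\<lambda>t. F2 (fst t) (snd t))
     = integral {0..1} (\<lambda>\<sigma>. integral {0..1} (Ph \<sigma>)) - integral {0..1} (\<lambda>s. f (x - P s))"
  proof -
    have "integral (cbox (0,0) (1,1)) (\<lambda>t. F2 (fst t) (snd t)) = integral (cbox 0 1) (\<lambda>\<sigma>. integral (cbox 0 1) (F2 \<sigma>))"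
      by (subst integral_prod_continuous) (auto intro!: c2 continuous_intros)
    also have "\<dots> = integral (cbox 0 1) (\<lambda>s. integral (cbox 0 1) (\<lambda>\<sigma>. F2 \<sigma> s))"
      by (rule integral_swap_continuous) (auto simp: split_beta intro!: c2 continuous_intros)
    also have "\<dots> = integral {0..1} (\<lambda>s. integral {0..1} (\<lambda>\<sigma>. Ph \<sigma> s) - f (x - P s))"
      by (simp add: I2)
    also have "\<dots> = integral {0..1} (\<lambda>s. integral {0..1} (\<lambda>\<sigma>. Ph \<sigma> s)) - integral {0..1} (\<lambda>s. f (x - P s))"
      unfolding P_def by (rule integral_diff) (intro integrable_continuous_real continuous_intros cPh2 cf)+
    also have "integral {0..1} (\<lambda>s. integral {0..1} (\<lambda>\<sigma>. Ph \<sigma> s)) = integral {0..1} (\<lambda>\<sigma>. integral {0..1} (Ph \<sigma>))"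
    proof -
      have "continuous_on (cbox (0,0) (1,1)) (\<lambda>(s, \<sigma>). Ph \<sigma> s)"
        unfolding split_beta by (intro c3 continuous_intros)
      from integral_swap_continuous[OF this] show ?thesis by simp
    qed
    finally show ?thesis .
  qed
  have "integral (cbox (0,0) (1,1)) (\<lambda>t. F1 (fst t) (snd t) - d$l * F2 (fst t) (snd t))
    = integral (cbox (0,0) (1,1)) (\<lambda>t. F1 (fst t) (snd t)) - d$l * integral (cbox (0,0) (1,1)) (\<lambda>t. F2 (fst t) (snd t))"
    by (subst integral_diff) (auto intro!: integrable_continuous continuous_intros c1 c2)
  also have "\<dots> = d$l * integral {0..1} (\<lambda>s. f (x - (a + s *\<^sub>R d)))
      + (a$l * integral {0..1} (\<lambda>\<sigma>. f (x - \<sigma> *\<^sub>R a)) - (a + d)$l * integral {0..1} (\<lambda>\<sigma>. f (x - \<sigma> *\<^sub>R (a + d))))"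
    unfolding Q1 Q2 P_def by (simp add: algebra_simps)
  finally show ?thesis by (simp add: F1_def F2_def G_def P_def algebra_simps)
qed

section \<open>Cones over edges with apex at the origin\<close>

definition cone_pt :: "edge \<Rightarrow> real \<times> real \<Rightarrow> vec" where
  "cone_pt e t = fst t *\<^sub>R (fst e + snd t *\<^sub>R (snd e - fst e))"

text \<open>The density \<open>fst\<close> is the Jacobian of \<open>cone_pt\<close> up to a
  constant: the area element of the triangle is \<sigma> times the norm of the cross product of the
  endpoints. So \<open>cone\<close> times that cross product is the convolution of \<phi> with the
  vector-valued area of the triangle.\<close>

definition cone :: "(vec \<Rightarrow> real) \<Rightarrow> edge \<Rightarrow> vec \<Rightarrow> real" where
  "cone \<phi> e = param_int (cbox (0,0) (1,1)) fst (cone_pt e) \<phi>"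

definition spoke :: "(vec \<Rightarrow> real) \<Rightarrow> vec \<Rightarrow> vec \<Rightarrow> real" where
  "spoke \<phi> x v = integral {0..1} (\<lambda>\<sigma>. \<phi> (x - \<sigma> *\<^sub>R v))"

lemma cone_pt_continuous: "continuous_on S (cone_pt e)"
  unfolding cone_pt_def[abs_def] by (intro continuous_intros)

text \<open>The rule g x (p x d) = p (g . d) - d (g . p), with the antisymmetric pair (i, j) written
  as the dual of a vector.\<close>

lemma levi_civita_cross:
  fixes g p d :: vec
  shows "g$i * cross3 p d $ j - g$j * cross3 p d $ i
    = (\<Sum>l\<in>UNIV. levi_civita i j l * (p$l * (g \<bullet> d) - d$l * (g \<bullet> p)))"
proof -
  have "\<forall>i j. g$i * cross3 p d $ j - g$j * cross3 p d $ i
    = (\<Sum>l\<in>UNIV. levi_civita i j l * (p$l * (g \<bullet> d) - d$l * (g \<bullet> p)))"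
    unfolding forall_3 sum_3 levi_civita_def det_3 inner_vec_def cross3_def
    by (simp add: axis_def algebra_simps)
  then show ?thesis by blast
qed

text \<open>Stokes for a single triangle, whose normal is constant along the parametrisation.
  Besides the edge it has two sides through the apex; each of these contributes a term that depends
  on one vertex only, and this makes a cancellation by the node law possible. The length of the edge
  cancels between \<open>edge_dir\<close> and \<open>conv_seg\<close>.\<close>

lemma cone_curl:
  assumes \<phi>: "smooth \<phi>" and ne: "fst e \<noteq> snd e"
  shows "pd i (cone \<phi> e) x * cross3 (fst e) (snd e) $ j - pd j (cone \<phi> e) x * cross3 (fst e) (snd e) $ i
    = (\<Sum>l\<in>UNIV. levi_civita i j l * (edge_dir e $ l * conv_seg \<phi> e x
        + (fst e $ l * spoke \<phi> x (fst e) - snd e $ l * spoke \<phi> x (snd e))))"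
proof -
  let ?a = "fst e" and ?d = "snd e - fst e"
  let ?Q = "cbox (0,0) (1,1) :: (real \<times> real) set"
  let ?g = "\<lambda>t. grad \<phi> (x - cone_pt e t)"
  let ?p = "\<lambda>t::real\<times>real. ?a + snd t *\<^sub>R ?d"
  have cg: "continuous_on S ?g" for S
    by (rule continuous_on_compose2[OF continuous_grad[OF \<phi>, of UNIV] _ subset_UNIV])
      (intro continuous_intros cone_pt_continuous)
  have pd: "pd i (cone \<phi> e) x = integral ?Q (\<lambda>t. fst t * ?g t $ i)" for i
    unfolding cone_def by (subst pd_param_int[OF \<phi>])
      (auto intro!: continuous_intros cone_pt_continuous simp: param_int_def grad_def)
  have cr: "cross3 ?a (snd e) = cross3 (?p t) ?d" for t
    unfolding cross3_def by (simp add: vec_eq_iff forall_3 algebra_simps)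
  have ing: "(\<lambda>t. fst t * ?g t $ i) integrable_on ?Q" for i
    by (intro integrable_continuous continuous_intros cg)
  have "pd i (cone \<phi> e) x * cross3 ?a (snd e) $ j - pd j (cone \<phi> e) x * cross3 ?a (snd e) $ i
     = integral ?Q (\<lambda>t. fst t * ?g t $ i * cross3 ?a (snd e) $ j - fst t * ?g t $ j * cross3 ?a (snd e) $ i)"
    unfolding pd by (subst integral_diff) (auto intro!: integrable_continuous continuous_intros cg)
  also have "\<dots> = integral ?Q (\<lambda>t. \<Sum>l\<in>UNIV. levi_civita i j l * (fst t * (?p t $ l * (?g t \<bullet> ?d) - ?d$l * (?g t \<bullet> ?p t))))"
  proof (rule integral_cong)
    fix t :: "real \<times> real"
    have "fst t * ?g t $ i * cross3 ?a (snd e) $ j - fst t * ?g t $ j * cross3 ?a (snd e) $ i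
       = fst t * (?g t $ i * cross3 (?p t) ?d $ j - ?g t $ j * cross3 (?p t) ?d $ i)"
      unfolding cr[of t] by (simp only: right_diff_distrib mult.assoc)
    then show "fst t * ?g t $ i * cross3 ?a (snd e) $ j - fst t * ?g t $ j * cross3 ?a (snd e) $ i
      = (\<Sum>l\<in>UNIV. levi_civita i j l * (fst t * (?p t $ l * (?g t \<bullet> ?d) - ?d$l * (?g t \<bullet> ?p t))))"
      unfolding levi_civita_cross sum_distrib_left by (simp add: mult_ac)
  qed
  also have "\<dots> = (\<Sum>l\<in>UNIV. levi_civita i j l * integral ?Q (\<lambda>t. fst t * (?p t $ l * (?g t \<bullet> ?d) - ?d$l * (?g t \<bullet> ?p t))))"
    by (subst integral_sum) (auto intro!: integrable_continuous continuous_intros cg)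
  also have "\<dots> = (\<Sum>l\<in>UNIV. levi_civita i j l * (?d $ l * integral {0..1} (\<lambda>s. \<phi> (x - (?a + s *\<^sub>R ?d)))
        + (?a $ l * spoke \<phi> x ?a - snd e $ l * spoke \<phi> x (snd e))))"
    unfolding cone_pt_def triangle_stokes[OF \<phi>] spoke_def by simp
  also have "\<dots> = (\<Sum>l\<in>UNIV. levi_civita i j l * (edge_dir e $ l * conv_seg \<phi> e x
        + (fst e $ l * spoke \<phi> x (fst e) - snd e $ l * spoke \<phi> x (snd e))))"
    using ne by (simp add: edge_dir_def conv_seg_def)
  finally show ?thesis .
qed

text \<open>By Stokes, the curl of the cone over a closed current is the current itself: the spokes cancel by Kirchhoff's law.\<close>
definition cone_field :: "(vec \<Rightarrow> real) \<Rightarrow> edge set \<Rightarrow> (edge \<Rightarrow> vec) \<Rightarrow> vec \<Rightarrow> real^3^3" where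
  "cone_field \<phi> E I x = (\<Sum>e\<in>E. cone \<phi> e x *\<^sub>R (\<chi> j k. cross3 (fst e) (snd e) $ j * I e $ k))"

lemma smooth_cone: "smooth \<phi> \<Longrightarrow> smooth (cone \<phi> e)"
  unfolding cone_def by (intro smooth_param_int cone_pt_continuous continuous_intros)

lemma smooth_cone_field: "smooth \<phi> \<Longrightarrow> smooth (cone_field \<phi> E I)"
  unfolding cone_field_def[abs_def]
  by (intro smooth_sum smooth_linear[OF bounded_linear_scaleR_left] smooth_cone)

lemma compact_supp_cone_field: "compact_supp \<phi> \<Longrightarrow> compact_supp (cone_field \<phi> E I)"
  unfolding cone_field_def[abs_def] cone_def
  by (intro compact_supp_sum compact_supp_map[where T = "\<lambda>r. r *\<^sub>R M" for M] compact_supp_param_int cone_pt_continuous) auto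

text \<open>Summation by parts on the graph: the node law tested against an arbitrary function of
  the vertices.\<close>

lemma kirchhoff_vertex_sum:
  assumes fin: "finite E" and ne: "\<And>e. e \<in> E \<Longrightarrow> fst e \<noteq> snd e" and I: "I \<in> Icfg G E"
  shows "(\<Sum>e\<in>E. I e $ k * (f (fst e) - f (snd e))) = (0::real)"
proof -
  have finv: "finite (verts E)" using fin by (simp add: verts_def)
  have s: "(\<Sum>v\<in>verts E. Defs.sinc v e * f v) = f (snd e) - f (fst e)" if "e \<in> E" for e
  proof -
    have "(\<Sum>v\<in>verts E. Defs.sinc v e * f v) = (\<Sum>v\<in>{fst e, snd e}. Defs.sinc v e * f v)"
      by (rule sum.mono_neutral_right) (use finv that in \<open>auto simp: verts_def Defs.sinc_def\<close>)
    then show ?thesis using ne[OF that] by (simp add: Defs.sinc_def)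
  qed
  have "(\<Sum>e\<in>E. I e $ k * (f (fst e) - f (snd e))) = (\<Sum>e\<in>E. - (I e $ k * (\<Sum>v\<in>verts E. Defs.sinc v e * f v)))"
    by (rule sum.cong[OF refl], subst s) (simp_all add: algebra_simps)
  also have "\<dots> = - (\<Sum>v\<in>verts E. f v * (\<Sum>e\<in>E. Defs.sinc v e *\<^sub>R I e) $ k)"
    unfolding sum_negf sum_distrib_left sum_component vector_scaleR_component
    by (subst sum.swap) (simp add: mult_ac)
  also have "\<dots> = 0" using I by (simp add: Icfg_def)
  finally show ?thesis .
qed

lemma pd_cone_field:
  assumes "smooth \<phi>"
  shows "pd i (\<lambda>y. cone_field \<phi> E I y $ j $ k) x
    = (\<Sum>e\<in>E. I e $ k * (pd i (cone \<phi> e) x * cross3 (fst e) (snd e) $ j))"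
proof -
  have "((\<lambda>y. \<Sum>e\<in>E. cone \<phi> e y * (cross3 (fst e) (snd e) $ j * I e $ k)) has_derivative
      (\<lambda>h. \<Sum>e\<in>E. (grad (cone \<phi> e) x \<bullet> h) * (cross3 (fst e) (snd e) $ j * I e $ k))) (at x)"
    by (intro has_derivative_sum has_derivative_mult_left grad_has_derivative smooth_differentiable0 smooth_cone assms)
  from pd_has_derivative[OF this, of i] show ?thesis
    by (simp add: cone_field_def sum_component inner_axis grad_def mult_ac)
qed

lemma d1_cone_field:
  assumes \<phi>: "smooth \<phi>" and fin: "finite E" and ne: "\<And>e. e \<in> E \<Longrightarrow> fst e \<noteq> snd e" and I: "I \<in> Icfg G E"
  shows "d1 (cone_field \<phi> E I) x i j k = bfield \<phi> E I i j k x"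
proof -
  let ?N = "\<lambda>e. cross3 (fst e) (snd e)"
  let ?v = "\<lambda>l v. v $ l * spoke \<phi> x v"
  have "d1 (cone_field \<phi> E I) x i j k
     = (\<Sum>e\<in>E. I e $ k * (pd i (cone \<phi> e) x * ?N e $ j - pd j (cone \<phi> e) x * ?N e $ i))"
    unfolding d1_def pd_cone_field[OF \<phi>] by (simp add: sum_subtractf right_diff_distrib)
  also have "\<dots> = (\<Sum>e\<in>E. I e $ k * (\<Sum>l\<in>UNIV. levi_civita i j l * (edge_dir e $ l * conv_seg \<phi> e x
        + (?v l (fst e) - ?v l (snd e)))))"
    by (rule sum.cong[OF refl]) (simp only: cone_curl[OF \<phi> ne])
  also have "\<dots> = (\<Sum>l\<in>UNIV. levi_civita i j l * (\<Sum>e\<in>E. I e $ k * (edge_dir e $ l * conv_seg \<phi> e x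
        + (?v l (fst e) - ?v l (snd e)))))"
    unfolding sum_distrib_left by (subst sum.swap) (simp add: mult_ac)
  also have "\<dots> = (\<Sum>l\<in>UNIV. levi_civita i j l * (\<Sum>e\<in>E. I e $ k * (edge_dir e $ l * conv_seg \<phi> e x)))"
  proof -
    have "(\<Sum>e\<in>E. I e $ k * (?v l (fst e) - ?v l (snd e))) = 0" for l
      by (rule kirchhoff_vertex_sum[OF fin ne I, of k "\<lambda>v. ?v l v"])
    then show ?thesis by (simp only: distrib_left sum.distrib mult_zero_right sum.neutral_const add_0_right)
  qed
  also have "\<dots> = bfield \<phi> E I i j k x"
    by (simp add: bfield_def convJ_def mult_ac)
  finally show ?thesis .
qed

lemma integrable_continuous_compact_supp:
  fixes f :: "vec \<Rightarrow> 'b::{banach, second_countable_topology}"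
  assumes "continuous_on UNIV f" "compact_supp f"
  shows "integrable lborel f"
proof -
  obtain R where R: "\<And>x. R < norm x \<Longrightarrow> f x = 0" using assms(2) unfolding compact_supp_def by blast
  have "integrable lborel (\<lambda>x. indicator (cball 0 R) x *\<^sub>R f x)"
    by (rule borel_integrable_compact) (use assms(1) continuous_on_subset in auto)
  moreover have "(\<lambda>x. indicator (cball 0 R) x *\<^sub>R f x) = f"
  proof
    fix x show "indicator (cball 0 R) x *\<^sub>R f x = f x"
      using R[of x] by (cases "norm x \<le> R") (auto simp: indicator_def)
  qed
  ultimately show ?thesis by simp
qed

section \<open>The elastic energy as a quadratic functional on test fields\<close>

lemma trace_add: "trace (U + V) = trace U + trace (V :: real^3^3)"
  by (simp add: trace_def sum.distrib)

lemma trace_scale: "trace (c *\<^sub>R U) = c * trace (U :: real^3^3)"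
  by (simp add: trace_def sum_distrib_left)

lemma transpose_add: "transpose (U + V) = transpose U + transpose (V :: real^3^3)"
  by (simp add: transpose_def vec_eq_iff)

lemma transpose_scale: "transpose (c *\<^sub>R U) = c *\<^sub>R transpose (U :: real^3^3)"
  by (simp add: transpose_def vec_eq_iff)

lemma Fel_parallelogram: "Fel lam mu (U + V) + Fel lam mu (U - V) = 2 * Fel lam mu U + 2 * Fel lam mu V"
proof -
  have t: "trace (U - V) = trace U - trace V"
    using trace_add[of U "- V"] trace_scale[of "-1" V] by simp
  show ?thesis
    unfolding Fel_def trace_add t power2_norm_eq_inner
    by (simp add: inner_simps inner_commute power2_eq_square algebra_simps)
qed

lemma Fel_scale: "Fel lam mu (c *\<^sub>R U) = c\<^sup>2 * Fel lam mu U"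
  by (simp add: Fel_def trace_scale power_mult_distrib algebra_simps)

lemma trace_sq_le: "(trace U)\<^sup>2 \<le> 3 * (norm (U :: real^3^3))\<^sup>2"
proof -
  have A: "(trace U)\<^sup>2 \<le> 3 * ((U$1$1)\<^sup>2 + (U$2$2)\<^sup>2 + (U$3$3)\<^sup>2)"
    using zero_le_power2[of "U$1$1 - U$2$2"] zero_le_power2[of "U$1$1 - U$3$3"] zero_le_power2[of "U$2$2 - U$3$3"]
    unfolding trace_def sum_3 power2_eq_square by (simp add: algebra_simps)
  have "(norm U)\<^sup>2 = (\<Sum>i\<in>UNIV. \<Sum>j\<in>UNIV. (U$i$j)\<^sup>2)"
    unfolding power2_norm_eq_inner inner_vec_def by (simp add: power2_eq_square)
  then have "(U$1$1)\<^sup>2 + (U$2$2)\<^sup>2 + (U$3$3)\<^sup>2 \<le> (norm U)\<^sup>2"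
    unfolding sum_3 by simp
  then have "3 * ((U$1$1)\<^sup>2 + (U$2$2)\<^sup>2 + (U$3$3)\<^sup>2) \<le> 3 * (norm U)\<^sup>2" by (rule mult_left_mono) simp
  with A show ?thesis by (rule order_trans)
qed

text \<open>For negative \<open>lam\<close> the worst case is a multiple of the identity, where the
  trace term is 3 lam / 2 times the square norm; the second Lame condition covers exactly
  this.\<close>

lemma Fel_nonneg:
  assumes "lame lam mu" shows "0 \<le> Fel lam mu U"
proof (cases "0 \<le> lam")
  case True
  then show ?thesis using assms by (simp add: Fel_def lame_def)
next
  case False
  then have "lam / 2 * (3 * (norm U)\<^sup>2) \<le> lam / 2 * (trace U)\<^sup>2"
    by (intro mult_left_mono_neg trace_sq_le) auto
  moreover have "0 \<le> (mu + 3 * lam / 2) * (norm U)\<^sup>2" using assms by (simp add: lame_def)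
  ultimately show ?thesis unfolding Fel_def by (simp add: algebra_simps)
qed

definition test_field :: "(vec \<Rightarrow> real^3^3) \<Rightarrow> bool" where
  "test_field w \<longleftrightarrow> smooth w \<and> compact_supp w"

lemma test_field_add: "test_field u \<Longrightarrow> test_field v \<Longrightarrow> test_field (\<lambda>x. u x + v x)"
  by (simp add: test_field_def smooth_add compact_supp_add)

lemma test_field_scale: "test_field u \<Longrightarrow> test_field (\<lambda>x. c *\<^sub>R u x)"
  unfolding test_field_def
  using smooth_linear[OF bounded_linear_scaleR_right, of u c] compact_supp_map[of u "\<lambda>M. c *\<^sub>R M"] by simp

lemma test_field_diff:
  assumes "test_field u" "test_field v" shows "test_field (\<lambda>x. u x - v x)"
  using test_field_add[OF assms(1) test_field_scale[OF assms(2), of "-1"]] by simp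

lemma test_field_zero: "test_field (\<lambda>x. 0)"
  by (simp add: test_field_def smooth_zero compact_supp_zero)

lemma Hel_integrable:
  assumes "test_field w" shows "integrable lborel (\<lambda>x. Fel lam mu (w x + transpose (w x)))"
proof (rule integrable_continuous_compact_supp)
  have c: "continuous_on UNIV w" using assms smooth_continuous by (auto simp: test_field_def)
  show "continuous_on UNIV (\<lambda>x. Fel lam mu (w x + transpose (w x)))"
    unfolding Fel_def trace_def transpose_def
    by (intro continuous_intros c continuous_on_vec_lambda)
  show "compact_supp (\<lambda>x. Fel lam mu (w x + transpose (w x)))"
    using assms by (intro compact_supp_map[where T = "\<lambda>M. Fel lam mu (M + transpose M)"])
      (auto simp: test_field_def Fel_def trace_def transpose_def vec_eq_iff)
qed

lemma Hel_parallelogram: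
  assumes "test_field u" "test_field v"
  shows "Hel lam mu (\<lambda>x. u x + v x) + Hel lam mu (\<lambda>x. u x - v x) = 2 * Hel lam mu u + 2 * Hel lam mu v"
proof -
  let ?S = "\<lambda>w x. w x + transpose (w x)"
  have d: "transpose (U - V) = transpose U - transpose (V::real^3^3)" for U V
    by (simp add: transpose_def vec_eq_iff)
  have "Hel lam mu (\<lambda>x. u x + v x) + Hel lam mu (\<lambda>x. u x - v x)
     = (\<integral>x. Fel lam mu (u x + v x + transpose (u x + v x)) + Fel lam mu (u x - v x + transpose (u x - v x)) \<partial>lborel)"
    unfolding Hel_def
    by (rule Bochner_Integration.integral_add[symmetric])
      (use Hel_integrable[OF test_field_add[OF assms]] Hel_integrable[OF test_field_diff[OF assms]] in auto)
  also have "\<dots> = (\<integral>x. 2 * Fel lam mu (?S u x) + 2 * Fel lam mu (?S v x) \<partial>lborel)"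
  proof (rule Bochner_Integration.integral_cong[OF refl])
    fix x
    have "u x + v x + transpose (u x + v x) = ?S u x + ?S v x" "u x - v x + transpose (u x - v x) = ?S u x - ?S v x"
      by (simp_all add: transpose_add d)
    then show "Fel lam mu (u x + v x + transpose (u x + v x)) + Fel lam mu (u x - v x + transpose (u x - v x))
      = 2 * Fel lam mu (?S u x) + 2 * Fel lam mu (?S v x)"
      by (simp only: Fel_parallelogram)
  qed
  also have "\<dots> = 2 * Hel lam mu u + 2 * Hel lam mu v"
    unfolding Hel_def using Hel_integrable[OF assms(1)] Hel_integrable[OF assms(2)] by simp
  finally show ?thesis .
qed

lemma Hel_scale: "Hel lam mu (\<lambda>x. c *\<^sub>R w x) = c\<^sup>2 * Hel lam mu w"
proof -
  have "Fel lam mu (c *\<^sub>R w x + transpose (c *\<^sub>R w x)) = c\<^sup>2 * Fel lam mu (w x + transpose (w x))" for x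
    by (simp add: transpose_scale scaleR_add_right[symmetric] Fel_scale del: scaleR_add_right)
  then show ?thesis by (simp add: Hel_def)
qed

lemma Hel_nonneg: "lame lam mu \<Longrightarrow> 0 \<le> Hel lam mu w"
  unfolding Hel_def by (intro Bochner_Integration.integral_nonneg Fel_nonneg)

lemma bounded_linear_entry: "bounded_linear (\<lambda>M::real^3^3. M $ j $ k)"
  by (rule bounded_linear_compose[OF bounded_linear_vec_nth bounded_linear_vec_nth])

lemma d1_entry:
  assumes "smooth w"
  shows "d1 w x i j k = pd i w x $ j $ k - pd j w x $ i $ k"
  unfolding d1_def using pd_linear[OF bounded_linear_entry smooth_differentiable0[OF assms]] by simp

lemma d1_add:
  assumes "smooth u" "smooth v"
  shows "d1 (\<lambda>x. u x + v x) x i j k = d1 u x i j k + d1 v x i j k"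
  unfolding d1_entry[OF smooth_add[OF assms]] d1_entry[OF assms(1)] d1_entry[OF assms(2)]
  by (simp add: pd_add[OF smooth_differentiable0[OF assms(1)] smooth_differentiable0[OF assms(2)]])

lemma d1_scale:
  assumes "smooth u"
  shows "d1 (\<lambda>x. c *\<^sub>R u x) x i j k = c * d1 u x i j k"
  unfolding d1_entry[OF smooth_linear[OF bounded_linear_scaleR_right assms]] d1_entry[OF assms]
  by (simp add: pd_linear[OF bounded_linear_scaleR_right smooth_differentiable0[OF assms]] algebra_simps)

section \<open>Minimisation over closed fields\<close>

definition closed_field :: "(vec \<Rightarrow> real^3^3) \<Rightarrow> bool" where
  "closed_field u \<longleftrightarrow> test_field u \<and> (\<forall>x i j k. d1 u x i j k = 0)"

lemma closed_field_add: "closed_field u \<Longrightarrow> closed_field v \<Longrightarrow> closed_field (\<lambda>x. u x + v x)"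
  by (simp add: closed_field_def test_field_add) (simp add: test_field_def d1_add)

lemma closed_field_scale: "closed_field u \<Longrightarrow> closed_field (\<lambda>x. c *\<^sub>R u x)"
  by (simp add: closed_field_def test_field_scale) (simp add: test_field_def d1_scale)

lemma closed_field_zero: "closed_field (\<lambda>x. 0)"
proof -
  have "d1 (\<lambda>x. 0 *\<^sub>R 0) x i j k = 0 * d1 (\<lambda>x. 0) x i j k" for x i j k
    by (rule d1_scale[OF smooth_zero])
  then show ?thesis by (simp add: closed_field_def test_field_zero)
qed

text \<open>The square of a quotient seminorm modulo closed fields. Unlike \<open>Hel_star\<close>
  it is defined for every field, so homogeneity and the parallelogram law can be stated for
  it.\<close>

definition coset_energy :: "real \<Rightarrow> real \<Rightarrow> (vec \<Rightarrow> real^3^3) \<Rightarrow> real" where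
  "coset_energy lam mu w = Inf {Hel lam mu (\<lambda>x. w x + u x) |u. closed_field u}"

lemma coset_energy_le:
  assumes "lame lam mu" "closed_field u"
  shows "coset_energy lam mu w \<le> Hel lam mu (\<lambda>x. w x + u x)"
  unfolding coset_energy_def
  by (rule cInf_lower) (use assms Hel_nonneg in \<open>auto intro!: bdd_belowI[of _ 0]\<close>)

lemma coset_energy_ge:
  assumes "\<And>u. closed_field u \<Longrightarrow> m \<le> Hel lam mu (\<lambda>x. w x + u x)"
  shows "m \<le> coset_energy lam mu w"
  unfolding coset_energy_def
  by (rule cInf_greatest) (use assms closed_field_zero in auto)

lemma coset_energy_nonneg: "lame lam mu \<Longrightarrow> 0 \<le> coset_energy lam mu w"
  by (intro coset_energy_ge Hel_nonneg)

lemma coset_energy_scale: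
  assumes L: "lame lam mu"
  shows "coset_energy lam mu (\<lambda>x. c *\<^sub>R w x) = c\<^sup>2 * coset_energy lam mu w"
proof -
  have le: "coset_energy lam mu (\<lambda>x. c *\<^sub>R w x) \<le> c\<^sup>2 * coset_energy lam mu w" if "c \<noteq> 0" for c w
  proof -
    have "coset_energy lam mu (\<lambda>x. c *\<^sub>R w x) / c\<^sup>2 \<le> coset_energy lam mu w"
    proof (rule coset_energy_ge)
      fix u assume u: "closed_field u"
      have "coset_energy lam mu (\<lambda>x. c *\<^sub>R w x) \<le> Hel lam mu (\<lambda>x. c *\<^sub>R w x + c *\<^sub>R u x)"
        by (rule coset_energy_le[OF L closed_field_scale[OF u]])
      also have "\<dots> = c\<^sup>2 * Hel lam mu (\<lambda>x. w x + u x)"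
        by (simp add: scaleR_add_right[symmetric] Hel_scale del: scaleR_add_right)
      finally show "coset_energy lam mu (\<lambda>x. c *\<^sub>R w x) / c\<^sup>2 \<le> Hel lam mu (\<lambda>x. w x + u x)"
        using that by (simp add: field_simps)
    qed
    then show ?thesis using that by (simp add: field_simps)
  qed
  show ?thesis
  proof (cases "c = 0")
    case True
    have "coset_energy lam mu (\<lambda>x. 0) \<le> Hel lam mu (\<lambda>x. 0 + 0)"
      by (rule coset_energy_le[OF L closed_field_zero])
    also have "\<dots> = 0" using Hel_scale[of lam mu 0 "\<lambda>x. 0"] by simp
    finally show ?thesis using True coset_energy_nonneg[OF L, of "\<lambda>x. 0"] by simp
  next
    case False
    have "coset_energy lam mu (\<lambda>x. inverse c *\<^sub>R (c *\<^sub>R w x)) \<le> (inverse c)\<^sup>2 * coset_energy lam mu (\<lambda>x. c *\<^sub>R w x)"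
      by (rule le) (use False in simp)
    then have "coset_energy lam mu w \<le> coset_energy lam mu (\<lambda>x. c *\<^sub>R w x) / c\<^sup>2"
      using False by (simp add: divide_inverse power_inverse mult.commute)
    then show ?thesis using le[OF False, of w] False by (simp add: field_simps)
  qed
qed

text \<open>Competitors u and u' for v and w give the competitors u + u' and u - u' for v + w and v
  - w, which proves one inequality without any minimiser. Applied to v + w and v - w, together with
  scaling by 2, it yields the converse.\<close>

lemma coset_energy_parallelogram:
  assumes L: "lame lam mu" and tv: "test_field v" "test_field w"
  shows "coset_energy lam mu (\<lambda>x. v x + w x) + coset_energy lam mu (\<lambda>x. v x - w x)
    = 2 * coset_energy lam mu v + 2 * coset_energy lam mu w"
proof -
  have le: "coset_energy lam mu (\<lambda>x. v x + w x) + coset_energy lam mu (\<lambda>x. v x - w x)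
    \<le> 2 * coset_energy lam mu v + 2 * coset_energy lam mu w" if tv: "test_field v" "test_field w" for v w
  proof -
    let ?m = "coset_energy lam mu (\<lambda>x. v x + w x) + coset_energy lam mu (\<lambda>x. v x - w x)"
    have key: "?m \<le> 2 * Hel lam mu (\<lambda>x. v x + u x) + 2 * Hel lam mu (\<lambda>x. w x + u' x)"
      if u: "closed_field u" "closed_field u'" for u u'
    proof -
      have tu: "test_field u" "test_field u'" using u by (auto simp: closed_field_def)
      have "coset_energy lam mu (\<lambda>x. v x + w x) \<le> Hel lam mu (\<lambda>x. v x + w x + (u x + u' x))"
        by (rule coset_energy_le[OF L closed_field_add[OF u]])
      moreover have "coset_energy lam mu (\<lambda>x. v x - w x) \<le> Hel lam mu (\<lambda>x. v x - w x + (u x + (-1) *\<^sub>R u' x))"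
        by (rule coset_energy_le[OF L closed_field_add[OF u(1) closed_field_scale[OF u(2)]]])
      moreover have "Hel lam mu (\<lambda>x. v x + w x + (u x + u' x)) + Hel lam mu (\<lambda>x. v x - w x + (u x + (-1) *\<^sub>R u' x))
         = 2 * Hel lam mu (\<lambda>x. v x + u x) + 2 * Hel lam mu (\<lambda>x. w x + u' x)"
        using Hel_parallelogram[OF test_field_add[OF tv(1) tu(1)] test_field_add[OF tv(2) tu(2)], of lam mu]
        by (simp add: algebra_simps)
      ultimately show ?thesis by linarith
    qed
    have "?m / 2 - coset_energy lam mu w \<le> coset_energy lam mu v"
    proof (rule coset_energy_ge)
      fix u assume u: "closed_field u"
      have "?m / 2 - Hel lam mu (\<lambda>x. v x + u x) \<le> coset_energy lam mu w"
        by (rule coset_energy_ge) (use key[OF u] in \<open>simp add: field_simps\<close>)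
      then show "?m / 2 - coset_energy lam mu w \<le> Hel lam mu (\<lambda>x. v x + u x)" by simp
    qed
    moreover have "m \<le> 2 * a + 2 * b" if "m / 2 - b \<le> a" for m a b :: real using that by simp
    ultimately show ?thesis by blast
  qed
  have "coset_energy lam mu (\<lambda>x. (v x + w x) + (v x - w x)) + coset_energy lam mu (\<lambda>x. (v x + w x) - (v x - w x))
    \<le> 2 * coset_energy lam mu (\<lambda>x. v x + w x) + 2 * coset_energy lam mu (\<lambda>x. v x - w x)"
    by (rule le[OF test_field_add[OF tv] test_field_diff[OF tv]])
  moreover have "(\<lambda>x. (v x + w x) + (v x - w x)) = (\<lambda>x. 2 *\<^sub>R v x)" "(\<lambda>x. (v x + w x) - (v x - w x)) = (\<lambda>x. 2 *\<^sub>R w x)"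
    by (auto simp: scaleR_2)
  ultimately have "4 * coset_energy lam mu v + 4 * coset_energy lam mu w
    \<le> 2 * coset_energy lam mu (\<lambda>x. v x + w x) + 2 * coset_energy lam mu (\<lambda>x. v x - w x)"
    by (simp only: coset_energy_scale[OF L]) simp
  then show ?thesis using le[OF tv] by simp
qed

lemma Hel_star_coset_energy:
  assumes \<phi>: "smooth \<phi>" "compact_supp \<phi>" and fin: "finite E"
    and ne: "\<And>e. e \<in> E \<Longrightarrow> fst e \<noteq> snd e" and I: "I \<in> Icfg G E"
  shows "Hel_star lam mu \<phi> E I = coset_energy lam mu (cone_field \<phi> E I)"
proof -
  let ?w = "cone_field \<phi> E I"
  have tw: "test_field ?w" using smooth_cone_field[OF \<phi>(1)] compact_supp_cone_field[OF \<phi>(2)] by (simp add: test_field_def)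
  note dw = d1_cone_field[OF \<phi>(1) fin ne I]
  have "{Hel lam mu w |w. smooth w \<and> compact_supp w \<and> (\<forall>x i j k. d1 w x i j k = bfield \<phi> E I i j k x)}
     = {Hel lam mu (\<lambda>x. ?w x + u x) |u. closed_field u}" (is "?A = ?B")
  proof
    show "?A \<subseteq> ?B"
    proof
      fix h assume "h \<in> ?A"
      then obtain w where w: "h = Hel lam mu w" "test_field w" "\<And>x i j k. d1 w x i j k = bfield \<phi> E I i j k x"
        by (auto simp: test_field_def)
      let ?u = "\<lambda>x. w x + (-1) *\<^sub>R ?w x"
      have "closed_field ?u"
        unfolding closed_field_def
      proof (intro conjI allI)
        show "test_field ?u" by (rule test_field_add[OF w(2) test_field_scale[OF tw]])
        show "d1 ?u x i j k = 0" for x i j k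
        proof -
          have "d1 ?u x i j k = d1 w x i j k + d1 (\<lambda>x. (-1) *\<^sub>R ?w x) x i j k"
            by (rule d1_add) (use w(2) test_field_scale[OF tw, of "-1"] in \<open>simp_all only: test_field_def\<close>)
          also have "d1 (\<lambda>x. (-1) *\<^sub>R ?w x) x i j k = (-1) * d1 ?w x i j k"
            by (rule d1_scale) (use tw in \<open>simp only: test_field_def\<close>)
          finally show ?thesis using w(3)[of x i j k] dw[of x i j k] by simp
        qed
      qed
      moreover have "h = Hel lam mu (\<lambda>x. ?w x + ?u x)" using w(1) by simp
      ultimately show "h \<in> ?B" by (intro CollectI exI[of _ ?u] conjI)
    qed
    show "?B \<subseteq> ?A"
    proof
      fix h assume "h \<in> ?B"
      then obtain u where u: "closed_field u" "h = Hel lam mu (\<lambda>x. ?w x + u x)" by blast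
      have "test_field (\<lambda>x. ?w x + u x)" using u(1) tw test_field_add by (auto simp: closed_field_def)
      moreover have "d1 (\<lambda>x. ?w x + u x) x i j k = bfield \<phi> E I i j k x" for x i j k
        using u(1) tw dw by (subst d1_add) (auto simp: closed_field_def test_field_def)
      ultimately show "h \<in> ?A" using u(2) by (auto simp: test_field_def)
    qed
  qed
  then show ?thesis by (simp add: Hel_star_def coset_energy_def)
qed

text \<open>\<open>cone_field\<close> is linear in arbitrary real currents, not only in those of
  \<open>Icfg\<close>. The energy of its coset is therefore a positive semidefinite quadratic form
  on all of \<open>edge \<times> 3 \<Rightarrow> real\<close>, to which the algebra of the previous
  section applies; on \<open>Icfg\<close> it agrees with \<open>Hel_star\<close>.\<close>

lemma Hel_star_sum_of_squares:
  assumes \<phi>: "smooth \<phi>" "compact_supp \<phi>" and fin: "finite E"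
    and ne: "\<And>e. e \<in> E \<Longrightarrow> fst e \<noteq> snd e" and L: "lame lam mu"
  shows "\<exists>(n::nat) c. \<forall>I\<in>Icfg G E. Hel_star lam mu \<phi> E I = (\<Sum>m<n. (\<Sum>e\<in>E. c m e \<bullet> I e)\<^sup>2)"
proof -
  define cfg :: "(edge \<times> 3 \<Rightarrow> real) \<Rightarrow> edge \<Rightarrow> vec" where "cfg z e = (\<chi> i. z (e,i))" for z e
  define Q where "Q z = coset_energy lam mu (cone_field \<phi> E (cfg z))" for z
  have tw: "test_field (cone_field \<phi> E I)" for I
    using smooth_cone_field[OF \<phi>(1)] compact_supp_cone_field[OF \<phi>(2)] by (simp add: test_field_def)
  have add: "cone_field \<phi> E (cfg (\<lambda>k. y k + z k)) = (\<lambda>x. cone_field \<phi> E (cfg y) x + cone_field \<phi> E (cfg z) x)" for y z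
    by (rule ext) (simp add: cone_field_def cfg_def vec_eq_iff sum_component sum.distrib algebra_simps)
  have sc: "cone_field \<phi> E (cfg (\<lambda>k. c * z k)) = (\<lambda>x. c *\<^sub>R cone_field \<phi> E (cfg z) x)" for c z
    by (rule ext) (simp add: cone_field_def cfg_def vec_eq_iff sum_component sum_distrib_left algebra_simps)
  have diff: "cone_field \<phi> E (cfg (\<lambda>k. y k - z k)) = (\<lambda>x. cone_field \<phi> E (cfg y) x - cone_field \<phi> E (cfg z) x)" for y z
    using add[of y "\<lambda>k. -1 * z k"] unfolding sc by simp
  have "\<exists>B. fun_bilinear B \<and> (\<forall>z. Q z = B z z)"
  proof (rule jordan_von_neumann)
    show "Q (\<lambda>k. y k + z k) + Q (\<lambda>k. y k - z k) = 2 * Q y + 2 * Q z" for y z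
      unfolding Q_def add diff by (rule coset_energy_parallelogram[OF L tw tw])
    show "Q (\<lambda>k. c * z k) = c\<^sup>2 * Q z" for c z
      unfolding Q_def sc by (rule coset_energy_scale[OF L])
    show "0 \<le> Q z" for z unfolding Q_def by (rule coset_energy_nonneg[OF L])
  qed
  then obtain B where B: "fun_bilinear B" "\<And>z. Q z = B z z" by blast
  have "finite (E \<times> (UNIV :: 3 set))" using fin by simp
  moreover have "0 \<le> B z z" for z unfolding B(2)[symmetric] Q_def by (rule coset_energy_nonneg[OF L])
  ultimately obtain n :: nat and l where
    l: "\<And>z. (\<forall>k. k \<notin> E \<times> UNIV \<longrightarrow> z k = 0) \<Longrightarrow> B z z = (\<Sum>m<n. (\<Sum>j\<in>E \<times> UNIV. l m j * z j)\<^sup>2)"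
    using psd_sum_of_squares[OF _ B(1), of "E \<times> UNIV"] by blast
  have "Hel_star lam mu \<phi> E I = (\<Sum>m<n. (\<Sum>e\<in>E. (\<chi> i. l m (e,i)) \<bullet> I e)\<^sup>2)" if I: "I \<in> Icfg G E" for I
  proof -
    let ?z = "\<lambda>(e,i). I e $ i"
    have cz: "cfg ?z = I" by (auto simp: cfg_def vec_eq_iff)
    have "Hel_star lam mu \<phi> E I = Q ?z"
      unfolding Q_def cz by (rule Hel_star_coset_energy[OF \<phi> fin ne I])
    also have "\<dots> = (\<Sum>m<n. (\<Sum>j\<in>E \<times> UNIV. l m j * ?z j)\<^sup>2)"
      unfolding B(2) by (rule l) (use I in \<open>auto simp: Icfg_def\<close>)
    also have "\<dots> = (\<Sum>m<n. (\<Sum>e\<in>E. (\<chi> i. l m (e,i)) \<bullet> I e)\<^sup>2)"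
    proof -
      have "(\<Sum>j\<in>E \<times> UNIV. l m j * ?z j) = (\<Sum>e\<in>E. \<Sum>i\<in>UNIV. l m (e,i) * I e $ i)" for m
        by (subst sum.cartesian_product) (simp add: split_beta)
      then show ?thesis by (simp add: inner_vec_def)
    qed
    finally show ?thesis .
  qed
  then show ?thesis by (intro exI[of _ n] exI[of _ "\<lambda>m e. \<chi> i. l m (e,i)"]) blast
qed

section \<open>Fourier transforms of test functions\<close>

lemma borel_measurable_cis [measurable (raw)]:
  "f \<in> borel_measurable M \<Longrightarrow> (\<lambda>x. cis (f x)) \<in> borel_measurable M"
  by (rule measurable_compose[where g = cis]) (auto intro!: borel_measurable_continuous_onI continuous_intros)

lemma borel_measurable_complex_of_real [measurable (raw)]:
  "f \<in> borel_measurable M \<Longrightarrow> (\<lambda>x. complex_of_real (f x)) \<in> borel_measurable M"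
  by (rule measurable_compose[where g = complex_of_real]) (auto intro!: borel_measurable_continuous_onI continuous_intros)

lemma integral_translate:
  fixes f :: "vec \<Rightarrow> complex"
  assumes [measurable]: "f \<in> borel_measurable borel"
  shows "(\<integral>x. f (c + x) \<partial>lborel) = (\<integral>x. f x \<partial>lborel)"
proof -
  have "(\<integral>x. f x \<partial>distr lborel borel ((+) c)) = (\<integral>x. f (c + x) \<partial>lborel)"
    by (rule integral_distr) auto
  then show ?thesis by (simp add: lborel_distr_plus)
qed

lemma compact_supp_pd:
  assumes "compact_supp f" shows "compact_supp (pd i f)"
proof -
  obtain R where R: "\<And>x. R < norm x \<Longrightarrow> f x = 0" using assms unfolding compact_supp_def by blast
  have "pd i f x = 0" if "R < norm x" for x
  proof -
    have "open {x::vec. R < norm x}" by (intro open_Collect_less continuous_intros)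
    then have "(f has_derivative (\<lambda>h. 0)) (at x)"
      using R that by (intro has_derivative_transform_within_open[of "\<lambda>x. 0" "\<lambda>h. 0" x UNIV "{x. R < norm x}" f]) auto
    from pd_has_derivative[OF this] show ?thesis by simp
  qed
  then show ?thesis unfolding compact_supp_def by blast
qed

lemma compact_supp_iter_pd: "compact_supp f \<Longrightarrow> compact_supp (iter_pd ds f)"
  by (induction ds) (auto intro: compact_supp_pd)

lemma continuous_compact_supp_bounded:
  fixes f :: "vec \<Rightarrow> real"
  assumes "continuous_on UNIV f" "compact_supp f"
  shows "\<exists>M. \<forall>x. \<bar>f x\<bar> \<le> M"
proof -
  obtain R where R: "\<And>x. R < norm x \<Longrightarrow> f x = 0" using assms(2) unfolding compact_supp_def by blast
  have "bounded (f ` cball 0 R)"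
    using assms(1) by (intro compact_imp_bounded compact_continuous_image) (auto intro: continuous_on_subset)
  then obtain M where M0: "\<forall>y\<in>f ` cball 0 R. norm y \<le> M" unfolding bounded_iff by blast
  have M: "\<bar>f x\<bar> \<le> M" if "x \<in> cball 0 R" for x using M0 that by auto
  have "\<bar>f x\<bar> \<le> max M 0" for x
    using M[of x] R[of x] by (cases "norm x \<le> R") auto
  then show ?thesis by blast
qed

text \<open>Translation invariance computes the transform of a difference quotient exactly, as (cis
  (\<xi>$i h) - 1) / h times the transform of f. Both sides converge as h tends to 0, the integral
  by dominated convergence.\<close>

lemma ft_pd:
  assumes f: "smooth f" "compact_supp f"
  shows "(\<integral>x. cis (- (\<xi> \<bullet> x)) * complex_of_real (pd i f x) \<partial>lborel)
     = \<i> * of_real (\<xi> $ i) * (\<integral>x. cis (- (\<xi> \<bullet> x)) * complex_of_real (f x) \<partial>lborel)"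
proof -
  let ?e = "axis i 1 :: vec"
  define h where "h n = 1 / real (Suc n)" for n
  have h: "0 < h n" "h n \<le> 1" for n by (auto simp: h_def)
  have hlim: "h \<longlonglongrightarrow> 0" unfolding h_def[abs_def] by (rule LIMSEQ_Suc[OF lim_inverse_n'])
  have ha: "filterlim h (at 0) sequentially" using hlim h by (auto simp: filterlim_at less_le)
  obtain R where R: "\<And>x. R < norm x \<Longrightarrow> f x = 0" using f(2) unfolding compact_supp_def by blast
  obtain M where M: "\<And>x. \<bar>pd i f x\<bar> \<le> M"
    using continuous_compact_supp_bounded[OF smooth_continuous[OF smooth_pd[OF f(1)]] compact_supp_pd[OF f(2)]] by blast
  have cf: "continuous_on UNIV f" by (rule smooth_continuous[OF f(1)])
  have [measurable]: "f \<in> borel_measurable borel" using cf by (rule borel_measurable_continuous_onI)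
  have [measurable]: "pd i f \<in> borel_measurable borel"
    using smooth_continuous[OF smooth_pd[OF f(1)]] by (rule borel_measurable_continuous_onI)
  have der: "((\<lambda>s. f (x + s *\<^sub>R ?e)) has_real_derivative pd i f (x + s *\<^sub>R ?e)) (at s)" for x s
  proof -
    have 1: "((\<lambda>s. x + s *\<^sub>R ?e) has_derivative (\<lambda>t. t *\<^sub>R ?e)) (at s)" by (auto intro!: derivative_eq_intros)
    from has_derivative_compose[OF 1 grad_has_derivative[OF smooth_differentiable0[OF f(1)]]]
    show ?thesis
      by (simp add: has_field_derivative_def inner_axis grad_def mult_commute_abs)
  qed
  have lip: "\<bar>f (x + s *\<^sub>R ?e) - f x\<bar> \<le> M * s" if s0: "0 < s" for x s
  proof -
    obtain z where "f (x + s *\<^sub>R ?e) - f (x + 0 *\<^sub>R ?e) = (s - 0) * pd i f (x + z *\<^sub>R ?e)"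
      using MVT2[OF s0, of "\<lambda>s. f (x + s *\<^sub>R ?e)" "\<lambda>s. pd i f (x + s *\<^sub>R ?e)"] der by blast
    then show ?thesis using M[of "x + z *\<^sub>R ?e"] s0 by (simp add: abs_mult mult.commute[of s] mult_right_mono)
  qed
  have int: "integrable lborel (\<lambda>x. cis (- (\<xi> \<bullet> x)) * complex_of_real (g x))"
    if "continuous_on UNIV g" "compact_supp g" for g
  proof (rule integrable_continuous_compact_supp)
    show "continuous_on UNIV (\<lambda>x. cis (- (\<xi> \<bullet> x)) * complex_of_real (g x))"
      by (intro continuous_intros that)
    show "compact_supp (\<lambda>x. cis (- (\<xi> \<bullet> x)) * complex_of_real (g x))"
      using that(2) unfolding compact_supp_def by fastforce
  qed
  let ?F = "\<integral>x. cis (- (\<xi> \<bullet> x)) * complex_of_real (f x) \<partial>lborel"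
  define q where "q n x = cis (- (\<xi> \<bullet> x)) * complex_of_real ((f (x + h n *\<^sub>R ?e) - f x) / h n)" for n x
  have "(\<lambda>n. \<integral>x. q n x \<partial>lborel) \<longlonglongrightarrow> (\<integral>x. cis (- (\<xi> \<bullet> x)) * complex_of_real (pd i f x) \<partial>lborel)"
  \<comment> \<open>Since h n \<le> 1, all difference quotients live in the ball of radius R + 1,
    and the mean value theorem bounds them by M.\<close>
  proof (rule integral_dominated_convergence[where w = "\<lambda>x. M * indicator (cball 0 (R + 1)) x"])
    show "integrable lborel (\<lambda>x::vec. M * indicator (cball 0 (R + 1)) x)"
      by (intro integrable_mult_right integrable_real_indicator)
        (use emeasure_lborel_cball_finite[of "0::vec" "R + 1"] in auto)
    show "(\<lambda>x. cis (- (\<xi> \<bullet> x)) * complex_of_real (pd i f x)) \<in> borel_measurable lborel" by measurable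
    show "q n \<in> borel_measurable lborel" for n unfolding q_def by measurable
    show "AE x in lborel. (\<lambda>n. q n x) \<longlonglongrightarrow> cis (- (\<xi> \<bullet> x)) * complex_of_real (pd i f x)"
    proof (rule AE_I2)
      fix x
      have "(\<lambda>t. (f (x + (0 + t) *\<^sub>R ?e) - f (x + 0 *\<^sub>R ?e)) / t) \<midarrow>0\<rightarrow> pd i f (x + 0 *\<^sub>R ?e)"
        using der[of x 0] unfolding DERIV_def by simp
      then have "(\<lambda>n. (f (x + (0 + h n) *\<^sub>R ?e) - f (x + 0 *\<^sub>R ?e)) / h n) \<longlonglongrightarrow> pd i f (x + 0 *\<^sub>R ?e)"
        by (rule filterlim_compose[OF _ ha])
      then show "(\<lambda>n. q n x) \<longlonglongrightarrow> cis (- (\<xi> \<bullet> x)) * complex_of_real (pd i f x)"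
        unfolding q_def by (intro tendsto_intros) simp
    qed
    show "AE x in lborel. norm (q n x) \<le> M * indicator (cball 0 (R + 1)) x" for n
    proof (rule AE_I2)
      fix x
      have "norm (q n x) = \<bar>f (x + h n *\<^sub>R ?e) - f x\<bar> / h n" using h[of n] unfolding q_def norm_mult norm_of_real by simp
      also have "\<dots> \<le> M * indicator (cball 0 (R + 1)) x"
      proof (cases "norm x \<le> R + 1")
        case True
        then show ?thesis using lip[OF h(1)[of n], of x] h(1)[of n] by (simp add: field_simps)
      next
        case False
        have "norm (h n *\<^sub>R ?e) \<le> 1" using h[of n] by simp
        moreover have "norm x \<le> norm (x + h n *\<^sub>R ?e) + norm (h n *\<^sub>R ?e)"
          by (metis add_diff_cancel_right' norm_triangle_ineq4)
        ultimately have "R < norm (x + h n *\<^sub>R ?e)" "R < norm x" using False by linarith+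
        then show ?thesis using False R by simp
      qed
      finally show "norm (q n x) \<le> M * indicator (cball 0 (R + 1)) x" .
    qed
  qed
  moreover have "(\<integral>x. q n x \<partial>lborel) = (cis (\<xi> $ i * h n) - 1) / of_real (h n) * ?F" for n
  proof -
    have cs: "compact_supp (\<lambda>x. f (x + h n *\<^sub>R ?e))"
      unfolding compact_supp_def
    proof (intro exI[of _ "R + 1"] allI impI)
      fix x :: vec assume "R + 1 < norm x"
      moreover have "norm x \<le> norm (x + h n *\<^sub>R ?e) + norm (h n *\<^sub>R ?e)"
        by (metis add_diff_cancel_right' norm_triangle_ineq4)
      moreover have "norm (h n *\<^sub>R ?e) \<le> 1" using h[of n] by simp
      ultimately show "f (x + h n *\<^sub>R ?e) = 0" by (intro R) linarith
    qed
    have cc: "continuous_on UNIV (\<lambda>x. f (x + h n *\<^sub>R ?e))"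
      by (intro continuous_on_compose2[OF cf] continuous_intros) auto
    have shift: "(\<integral>x. cis (- (\<xi> \<bullet> x)) * complex_of_real (f (x + h n *\<^sub>R ?e)) \<partial>lborel) = cis (\<xi> $ i * h n) * ?F"
    proof -
      have "(\<integral>x. cis (- (\<xi> \<bullet> x)) * complex_of_real (f (x + h n *\<^sub>R ?e)) \<partial>lborel)
          = (\<integral>x. cis (- (\<xi> \<bullet> (- h n *\<^sub>R ?e + x))) * complex_of_real (f (- h n *\<^sub>R ?e + x + h n *\<^sub>R ?e)) \<partial>lborel)"
        by (rule integral_translate[symmetric]) measurable
      also have "\<dots> = (\<integral>x. cis (\<xi> $ i * h n) * (cis (- (\<xi> \<bullet> x)) * complex_of_real (f x)) \<partial>lborel)"
        by (rule Bochner_Integration.integral_cong[OF refl])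
          (simp add: inner_diff_right inner_add_right inner_axis cis_mult algebra_simps)
      also have "\<dots> = cis (\<xi> $ i * h n) * ?F" by simp
      finally show ?thesis .
    qed
    have "(\<integral>x. q n x \<partial>lborel) = (\<integral>x. (cis (- (\<xi> \<bullet> x)) * complex_of_real (f (x + h n *\<^sub>R ?e))
        - cis (- (\<xi> \<bullet> x)) * complex_of_real (f x)) / of_real (h n) \<partial>lborel)"
      unfolding q_def by (rule Bochner_Integration.integral_cong[OF refl]) (simp add: algebra_simps diff_divide_distrib)
    also have "\<dots> = (cis (\<xi> $ i * h n) * ?F - ?F) / of_real (h n)"
      using int[OF cf f(2)] int[OF cc cs] by (simp add: shift)
    finally show ?thesis by (simp add: algebra_simps diff_divide_distrib)
  qed
  moreover have "(\<lambda>n. (cis (\<xi> $ i * h n) - 1) / of_real (h n) * ?F) \<longlonglongrightarrow> \<i> * of_real (\<xi> $ i) * ?F"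
  proof (intro tendsto_mult tendsto_const)
    have hc: "filterlim (\<lambda>n. complex_of_real (h n)) (at 0) sequentially"
      using tendsto_of_real[OF hlim, where 'a = complex] h by (auto simp: filterlim_at less_le)
    have "((\<lambda>z. exp (\<i> * of_real (\<xi> $ i) * z)) has_field_derivative \<i> * of_real (\<xi> $ i)) (at 0)"
      by (auto intro!: derivative_eq_intros)
    then have "((\<lambda>z. (exp (\<i> * of_real (\<xi> $ i) * z) - 1) / z) \<longlongrightarrow> \<i> * of_real (\<xi> $ i)) (at 0)"
      by (simp add: DERIV_def)
    from filterlim_compose[OF this hc]
    show "(\<lambda>n. (cis (\<xi> $ i * h n) - 1) / of_real (h n)) \<longlonglongrightarrow> \<i> * of_real (\<xi> $ i)"
      by (simp add: cis_conv_exp mult.assoc)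
  qed
  ultimately show ?thesis using LIMSEQ_unique by auto
qed

section \<open>A Bessel inequality for separated sets\<close>

lemma gaussian_ft_1d:
  assumes R: "0 < R"
  shows "integrable lborel (\<lambda>s. complex_of_real (exp (- (s\<^sup>2 / (2 * R\<^sup>2)))) * cis (s * y))"
    and "(\<integral>s. complex_of_real (exp (- (s\<^sup>2 / (2 * R\<^sup>2)))) * cis (s * y) \<partial>lborel)
      = complex_of_real (R * sqrt (2 * pi) * exp (- ((R * y)\<^sup>2 / 2)))"
proof -
  let ?g = "\<lambda>u::real. complex_of_real (exp (- (u\<^sup>2 / 2))) * cis (u * (R * y))"
  have d: "std_normal_density u = exp (- (u\<^sup>2 / 2)) / sqrt (2 * pi)" for u by (simp add: std_normal_density_def)
  have sq: "0 < sqrt (2 * pi)" by simp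
  have int1: "integrable lborel (\<lambda>u. std_normal_density u *\<^sub>R iexp (R * y * u))"
  proof (rule Bochner_Integration.integrable_bound)
    show "integrable lborel std_normal_density" by simp
    show "(\<lambda>u. std_normal_density u *\<^sub>R iexp (R * y * u)) \<in> borel_measurable lborel" by measurable
  qed (auto simp: norm_exp_eq_Re)
  have geq: "?g = (\<lambda>u. sqrt (2 * pi) *\<^sub>R (std_normal_density u *\<^sub>R iexp (R * y * u)))"
    using sq by (auto simp: fun_eq_iff d cis_conv_exp scaleR_conv_of_real mult_ac)
  have int: "integrable lborel ?g" unfolding geq by (intro integrable_scaleR_right int1)
  have "(\<integral>u. std_normal_density u *\<^sub>R iexp (R * y * u) \<partial>lborel) = (\<integral>u. iexp (R * y * u) \<partial>std_normal_distribution)"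
    by (subst integral_density) (auto simp: normal_density_nonneg)
  also have "\<dots> = complex_of_real (exp (- ((R * y)\<^sup>2) / 2))"
    using fun_cong[OF char_std_normal_distribution, of "R * y"] by (simp add: char_def)
  finally have A: "(\<integral>u. std_normal_density u *\<^sub>R iexp (R * y * u) \<partial>lborel) = complex_of_real (exp (- ((R * y)\<^sup>2) / 2))" .
  have "(\<integral>u. ?g u \<partial>lborel) = sqrt (2 * pi) *\<^sub>R complex_of_real (exp (- ((R * y)\<^sup>2) / 2))"
    unfolding geq by (simp only: integral_scaleR_right A)
  with int have hb: "has_bochner_integral lborel ?g (sqrt (2 * pi) *\<^sub>R complex_of_real (exp (- ((R * y)\<^sup>2) / 2)))"
    by (simp add: has_bochner_integral_iff)
  let ?f = "\<lambda>s. complex_of_real (exp (- (s\<^sup>2 / (2 * R\<^sup>2)))) * cis (s * y)"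
  have "?f (0 + R * u) = ?g u" for u using R by (simp add: power_mult_distrib mult_ac)
  then have "has_bochner_integral lborel ?f (\<bar>R\<bar> *\<^sub>R (sqrt (2 * pi) *\<^sub>R complex_of_real (exp (- ((R * y)\<^sup>2) / 2))))"
    using hb R by (subst lborel_has_bochner_integral_real_affine_iff[where c = R and t = 0])
      (auto simp: mult.assoc[symmetric])
  then show "integrable lborel ?f" "(\<integral>s. ?f s \<partial>lborel) = complex_of_real (R * sqrt (2 * pi) * exp (- ((R * y)\<^sup>2 / 2)))"
    using R by (auto simp: has_bochner_integral_iff scaleR_conv_of_real)
qed

lemma lborel_integral_prod:
  fixes f :: "'a::euclidean_space \<Rightarrow> real \<Rightarrow> complex"
  assumes int: "\<And>b. b \<in> Basis \<Longrightarrow> integrable lborel (f b)"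
  shows "integrable lborel (\<lambda>x::'a. \<Prod>b\<in>Basis. f b (x \<bullet> b))"
    and "(\<integral>x. (\<Prod>b\<in>Basis. f b (x \<bullet> b)) \<partial>lborel) = (\<Prod>b\<in>Basis. \<integral>s. f b s \<partial>lborel)"
proof -
  interpret product_sigma_finite "\<lambda>b::'a. lborel :: real measure" by standard
  let ?T = "\<lambda>g. \<Sum>b\<in>Basis. g b *\<^sub>R b :: 'a"
  have [measurable]: "f b \<in> borel_measurable borel" if "b \<in> Basis" for b using int[OF that] by auto
  have m: "(\<lambda>x::'a. \<Prod>b\<in>Basis. f b (x \<bullet> b)) \<in> borel_measurable borel" by measurable
  have T: "?T \<in> measurable (Pi\<^sub>M Basis (\<lambda>b. lborel)) borel" by measurable
  have eq: "(\<Prod>b\<in>Basis. f b (?T g \<bullet> b)) = (\<Prod>b\<in>Basis. f b (g b))" for g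
    by (rule prod.cong) (auto simp: inner_sum_left inner_Basis if_distrib cong: if_cong)
  have i: "integrable (Pi\<^sub>M Basis (\<lambda>b. lborel)) (\<lambda>g. \<Prod>b\<in>Basis. f b (g b))"
    by (rule product_integrable_prod) (use int in auto)
  have "integrable (distr (Pi\<^sub>M Basis (\<lambda>b. lborel)) borel ?T) (\<lambda>x::'a. \<Prod>b\<in>Basis. f b (x \<bullet> b))"
    unfolding integrable_distr_eq[OF T m] eq by (rule i)
  then show "integrable lborel (\<lambda>x::'a. \<Prod>b\<in>Basis. f b (x \<bullet> b))" by (simp add: lborel_eq[symmetric])
  have "(\<integral>x. (\<Prod>b\<in>Basis. f b (x \<bullet> b)) \<partial>distr (Pi\<^sub>M Basis (\<lambda>b. lborel)) borel ?T)
      = (\<integral>g. (\<Prod>b\<in>Basis. f b (g b)) \<partial>Pi\<^sub>M Basis (\<lambda>b. lborel))"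
    unfolding integral_distr[OF T m] eq ..
  also have "\<dots> = (\<Prod>b\<in>Basis. \<integral>s. f b s \<partial>lborel)"
    by (rule product_integral_prod) (use int in auto)
  finally show "(\<integral>x. (\<Prod>b\<in>Basis. f b (x \<bullet> b)) \<partial>lborel) = (\<Prod>b\<in>Basis. \<integral>s. f b s \<partial>lborel)"
    by (simp add: lborel_eq[symmetric])
qed

lemma gaussian_ft:
  fixes y :: vec
  assumes R: "0 < R"
  shows "integrable lborel (\<lambda>\<xi>::vec. complex_of_real (exp (- ((norm \<xi>)\<^sup>2 / (2 * R\<^sup>2)))) * cis (\<xi> \<bullet> y))"
    and "(\<integral>\<xi>. complex_of_real (exp (- ((norm \<xi>)\<^sup>2 / (2 * R\<^sup>2)))) * cis (\<xi> \<bullet> y) \<partial>lborel)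
      = complex_of_real ((R * sqrt (2 * pi)) ^ 3 * exp (- ((R * norm y)\<^sup>2 / 2)))"
proof -
  let ?f = "\<lambda>(b::vec) s. complex_of_real (exp (- (s\<^sup>2 / (2 * R\<^sup>2)))) * cis (s * (y \<bullet> b))"
  have nsq: "(norm z)\<^sup>2 = (\<Sum>b\<in>Basis. (z \<bullet> b)\<^sup>2)" for z :: vec
    unfolding power2_norm_eq_inner by (subst euclidean_inner) (simp add: power2_eq_square)
  have cisp: "cis (\<Sum>b\<in>A. g b) = (\<Prod>b\<in>A. cis (g b))" if "finite A" for g :: "vec \<Rightarrow> real" and A
    using that by (induction A rule: finite_induct) (auto simp: cis_mult[symmetric])
  have eq: "complex_of_real (exp (- ((norm \<xi>)\<^sup>2 / (2 * R\<^sup>2)))) * cis (\<xi> \<bullet> y) = (\<Prod>b\<in>Basis. ?f b (\<xi> \<bullet> b))" for \<xi> :: vec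
  proof -
    have "exp (- ((norm \<xi>)\<^sup>2 / (2 * R\<^sup>2))) = (\<Prod>b\<in>Basis. exp (- ((\<xi> \<bullet> b)\<^sup>2 / (2 * R\<^sup>2))))"
      unfolding nsq by (simp add: exp_sum[symmetric] sum_divide_distrib sum_negf)
    moreover have "cis (\<xi> \<bullet> y) = (\<Prod>b\<in>Basis. cis ((\<xi> \<bullet> b) * (y \<bullet> b)))"
      by (subst euclidean_inner) (simp add: cisp)
    ultimately show ?thesis by (simp add: prod.distrib)
  qed
  show "integrable lborel (\<lambda>\<xi>::vec. complex_of_real (exp (- ((norm \<xi>)\<^sup>2 / (2 * R\<^sup>2)))) * cis (\<xi> \<bullet> y))"
    unfolding eq by (rule lborel_integral_prod(1)) (rule gaussian_ft_1d(1)[OF R])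
  have "(\<integral>\<xi>. complex_of_real (exp (- ((norm \<xi>)\<^sup>2 / (2 * R\<^sup>2)))) * cis (\<xi> \<bullet> y) \<partial>lborel)
     = (\<Prod>b\<in>Basis. complex_of_real (R * sqrt (2 * pi) * exp (- ((R * (y \<bullet> b))\<^sup>2 / 2))))"
    unfolding eq by (subst lborel_integral_prod(2)) (simp_all only: gaussian_ft_1d[OF R])
  also have "\<dots> = complex_of_real ((\<Prod>b\<in>(Basis::vec set). R * sqrt (2 * pi)) * (\<Prod>b\<in>Basis. exp (- ((R * (y \<bullet> b))\<^sup>2 / 2))))"
    by (simp only: of_real_prod[symmetric] prod.distrib)
  also have "(\<Prod>b\<in>(Basis::vec set). R * sqrt (2 * pi)) = (R * sqrt (2 * pi)) ^ 3" by simp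
  also have "(\<Prod>b\<in>Basis. exp (- ((R * (y \<bullet> b))\<^sup>2 / 2))) = exp (- ((R * norm y)\<^sup>2 / 2))"
    unfolding power_mult_distrib nsq by (simp add: exp_sum[symmetric] sum_distrib_left sum_divide_distrib sum_negf)
  finally show "(\<integral>\<xi>. complex_of_real (exp (- ((norm \<xi>)\<^sup>2 / (2 * R\<^sup>2)))) * cis (\<xi> \<bullet> y) \<partial>lborel)
      = complex_of_real ((R * sqrt (2 * pi)) ^ 3 * exp (- ((R * norm y)\<^sup>2 / 2)))" .
qed

definition trig :: "vec set \<Rightarrow> (vec \<Rightarrow> complex) \<Rightarrow> vec \<Rightarrow> complex" where
  "trig S c \<xi> = (\<Sum>l\<in>S. c l * cis (- (\<xi> \<bullet> l)))"

text \<open>Expanding the square gives a quadratic form in c with Gaussian matrix entries in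
  \<open>m - l\<close>. Schur's test bounds it, the row sums being controlled by separation; the
  factor R ^ 3 is the mass of the Gaussian of width R.\<close>

lemma gaussian_trig_bound:
  assumes \<epsilon>: "0 < \<epsilon>"
  shows "\<exists>C>0. \<forall>S c R. finite S \<and> separated \<epsilon> S \<and> 1 \<le> R \<longrightarrow>
    integrable lborel (\<lambda>\<xi>. exp (- ((norm \<xi>)\<^sup>2 / (2 * R\<^sup>2))) * (norm (trig S c \<xi>))\<^sup>2) \<and>
    (\<integral>\<xi>. exp (- ((norm \<xi>)\<^sup>2 / (2 * R\<^sup>2))) * (norm (trig S c \<xi>))\<^sup>2 \<partial>lborel) \<le> C * R ^ 3 * (\<Sum>l\<in>S. (norm (c l))\<^sup>2)"
proof -
  obtain C where C: "0 < C" "\<And>S p. finite S \<Longrightarrow> separated \<epsilon> S \<Longrightarrow> (\<Sum>l\<in>S. exp (- 1 * norm (p - l))) \<le> C"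
    using separated_exp_sum[OF \<epsilon>, of 1] by auto
  define K where "K = sqrt (2 * pi) ^ 3 * exp (1 / 2)"
  have K: "0 < K" by (simp add: K_def)
  have "integrable lborel (\<lambda>\<xi>. exp (- ((norm \<xi>)\<^sup>2 / (2 * R\<^sup>2))) * (norm (trig S c \<xi>))\<^sup>2) \<and>
    (\<integral>\<xi>. exp (- ((norm \<xi>)\<^sup>2 / (2 * R\<^sup>2))) * (norm (trig S c \<xi>))\<^sup>2 \<partial>lborel) \<le> (K * C) * R ^ 3 * (\<Sum>l\<in>S. (norm (c l))\<^sup>2)"
    if S: "finite S" "separated \<epsilon> S" and R: "1 \<le> R" for S c R
  proof -
    let ?w = "\<lambda>\<xi>::vec. exp (- ((norm \<xi>)\<^sup>2 / (2 * R\<^sup>2)))"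
    let ?I = "\<lambda>y::vec. \<lambda>\<xi>. complex_of_real (?w \<xi>) * cis (\<xi> \<bullet> y)"
    have R0: "0 < R" using R by simp
    have eq: "complex_of_real (?w \<xi> * (norm (trig S c \<xi>))\<^sup>2) = (\<Sum>l\<in>S. \<Sum>m\<in>S. (c l * cnj (c m)) * ?I (m - l) \<xi>)" for \<xi>
    proof -
      have "complex_of_real ((norm (trig S c \<xi>))\<^sup>2) = trig S c \<xi> * cnj (trig S c \<xi>)"
        by (rule complex_norm_square)
      also have "\<dots> = (\<Sum>l\<in>S. \<Sum>m\<in>S. (c l * cis (- (\<xi> \<bullet> l))) * cnj (c m * cis (- (\<xi> \<bullet> m))))"
        by (simp add: trig_def sum_product)
      also have "\<dots> = (\<Sum>l\<in>S. \<Sum>m\<in>S. (c l * cnj (c m)) * cis (\<xi> \<bullet> (m - l)))"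
      proof (intro sum.cong refl)
        fix l m
        have "cis (\<xi> \<bullet> (m - l)) = cis (\<xi> \<bullet> m) * cis (- (\<xi> \<bullet> l))" by (simp add: cis_mult inner_diff_right)
        then show "(c l * cis (- (\<xi> \<bullet> l))) * cnj (c m * cis (- (\<xi> \<bullet> m))) = (c l * cnj (c m)) * cis (\<xi> \<bullet> (m - l))"
          by (simp add: cis_cnj mult_ac)
      qed
      finally show ?thesis by (simp add: sum_distrib_left sum_distrib_right mult_ac)
    qed
    have int: "integrable lborel (\<lambda>\<xi>. \<Sum>l\<in>S. \<Sum>m\<in>S. (c l * cnj (c m)) * ?I (m - l) \<xi>)"
      by (intro Bochner_Integration.integrable_sum integrable_mult_right gaussian_ft[OF R0])
    have intr: "integrable lborel (\<lambda>\<xi>. ?w \<xi> * (norm (trig S c \<xi>))\<^sup>2)"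
      using integrable_Re[OF int] unfolding eq[symmetric] by simp
    have "complex_of_real (\<integral>\<xi>. ?w \<xi> * (norm (trig S c \<xi>))\<^sup>2 \<partial>lborel) = (\<integral>\<xi>. (\<Sum>l\<in>S. \<Sum>m\<in>S. (c l * cnj (c m)) * ?I (m - l) \<xi>) \<partial>lborel)"
      unfolding eq[symmetric] by (rule integral_complex_of_real[symmetric])
    also have "\<dots> = (\<Sum>l\<in>S. \<Sum>m\<in>S. (c l * cnj (c m)) * complex_of_real ((R * sqrt (2 * pi)) ^ 3 * exp (- ((R * norm (m - l))\<^sup>2 / 2))))"
      by (simp add: Bochner_Integration.integral_sum integrable_mult_right gaussian_ft[OF R0])
    finally have "(\<integral>\<xi>. ?w \<xi> * (norm (trig S c \<xi>))\<^sup>2 \<partial>lborel)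
      = Re (\<Sum>l\<in>S. \<Sum>m\<in>S. (c l * cnj (c m)) * complex_of_real ((R * sqrt (2 * pi)) ^ 3 * exp (- ((R * norm (m - l))\<^sup>2 / 2))))"
      by (metis Re_complex_of_real)
    also have "\<dots> \<le> norm (\<Sum>l\<in>S. \<Sum>m\<in>S. (c l * cnj (c m)) * complex_of_real ((R * sqrt (2 * pi)) ^ 3 * exp (- ((R * norm (m - l))\<^sup>2 / 2))))"
      by (rule complex_Re_le_cmod)
    also have "\<dots> \<le> (\<Sum>l\<in>S. \<Sum>m\<in>S. (norm (c l))\<^sup>2 / 2 * (K * R ^ 3 * exp (- 1 * norm (l - m))) + (norm (c m))\<^sup>2 / 2 * (K * R ^ 3 * exp (- 1 * norm (m - l))))"
    proof (intro order_trans[OF norm_sum] sum_mono)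
      fix l m :: vec
      let ?n = "norm (m - l)"
      \<comment> \<open>For R \<ge> 1 the Gaussian entry is at most exp (1/2) exp (- |m - l|),
        uniformly in R, so that \<open>separated_exp_sum\<close> applies at rate 1.\<close>
      have "?n \<le> (R * ?n)\<^sup>2 / 2 + 1 / 2"
      proof -
        have "?n \<le> R * ?n" using R by (simp add: mult_le_cancel_right1)
        moreover have "0 \<le> (R * ?n - 1)\<^sup>2" by simp
        ultimately show ?thesis by (simp add: power2_diff)
      qed
      then have "exp (- ((R * ?n)\<^sup>2 / 2)) \<le> exp (1 / 2 + - 1 * ?n)" by simp
      then have e: "(R * sqrt (2 * pi)) ^ 3 * exp (- ((R * ?n)\<^sup>2 / 2)) \<le> (R * sqrt (2 * pi)) ^ 3 * (exp (1 / 2) * exp (- 1 * ?n))"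
        unfolding exp_add using R0 by (intro mult_left_mono) auto
      have n: "norm (c l) * norm (c m) \<le> (norm (c l))\<^sup>2 / 2 + (norm (c m))\<^sup>2 / 2"
        using sum_squares_bound[of "norm (c l)" "norm (c m)"] by (simp add: power2_eq_square)
      have "norm ((c l * cnj (c m)) * complex_of_real ((R * sqrt (2 * pi)) ^ 3 * exp (- ((R * ?n)\<^sup>2 / 2))))
         = (norm (c l) * norm (c m)) * ((R * sqrt (2 * pi)) ^ 3 * exp (- ((R * ?n)\<^sup>2 / 2)))"
        using R0 by (simp add: norm_mult norm_power)
      also have "\<dots> \<le> ((norm (c l))\<^sup>2 / 2 + (norm (c m))\<^sup>2 / 2) * ((R * sqrt (2 * pi)) ^ 3 * (exp (1 / 2) * exp (- 1 * ?n)))"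
        using R0 by (intro mult_mono n e) auto
      also have "\<dots> = (norm (c l))\<^sup>2 / 2 * (K * R ^ 3 * exp (- 1 * norm (l - m))) + (norm (c m))\<^sup>2 / 2 * (K * R ^ 3 * exp (- 1 * ?n))"
        by (simp add: K_def power_mult_distrib norm_minus_commute algebra_simps)
      finally show "norm ((c l * cnj (c m)) * complex_of_real ((R * sqrt (2 * pi)) ^ 3 * exp (- ((R * ?n)\<^sup>2 / 2))))
        \<le> (norm (c l))\<^sup>2 / 2 * (K * R ^ 3 * exp (- 1 * norm (l - m))) + (norm (c m))\<^sup>2 / 2 * (K * R ^ 3 * exp (- 1 * ?n))" .
    qed
    also have "\<dots> = (\<Sum>l\<in>S. \<Sum>m\<in>S. (norm (c l))\<^sup>2 / 2 * (K * R ^ 3 * exp (- 1 * norm (l - m))))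
        + (\<Sum>m\<in>S. \<Sum>l\<in>S. (norm (c m))\<^sup>2 / 2 * (K * R ^ 3 * exp (- 1 * norm (m - l))))"
    proof -
      have "(\<Sum>l\<in>S. \<Sum>m\<in>S. (norm (c m))\<^sup>2 / 2 * (K * R ^ 3 * exp (- 1 * norm (m - l))))
        = (\<Sum>m\<in>S. \<Sum>l\<in>S. (norm (c m))\<^sup>2 / 2 * (K * R ^ 3 * exp (- 1 * norm (m - l))))"
        by (rule sum.swap)
      then show ?thesis by (simp only: sum.distrib)
    qed
    also have "\<dots> = (\<Sum>l\<in>S. (norm (c l))\<^sup>2 * (K * R ^ 3 * (\<Sum>m\<in>S. exp (- 1 * norm (l - m)))))"
      by (simp add: sum_distrib_left sum.distrib[symmetric] mult_ac)
    also have "\<dots> \<le> (\<Sum>l\<in>S. (norm (c l))\<^sup>2 * (K * R ^ 3 * C))"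
      using K R0 by (intro sum_mono mult_left_mono C S) auto
    also have "\<dots> = (K * C) * R ^ 3 * (\<Sum>l\<in>S. (norm (c l))\<^sup>2)" by (simp add: sum_distrib_left mult_ac)
    finally show ?thesis using intr by simp
  qed
  then show ?thesis using K C by (intro exI[of _ "K * C"]) auto
qed

text \<open>The weight is dominated by a mixture of Gaussians of widths \<open>n = 1, 2, \<dots>\<close>.\<close>
lemma nn_integral_trig_bound:
  assumes \<epsilon>: "0 < \<epsilon>"
  shows "\<exists>C>0. \<forall>S c. finite S \<and> separated \<epsilon> S \<longrightarrow>
    (\<integral>\<^sup>+\<xi>. ennreal ((norm (trig S c \<xi>))\<^sup>2 / (1 + norm \<xi>) ^ 6) \<partial>lborel) \<le> ennreal (C * (\<Sum>l\<in>S. (norm (c l))\<^sup>2))"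
proof -
  obtain C where C: "0 < C" "\<And>S c R. finite S \<Longrightarrow> separated \<epsilon> S \<Longrightarrow> 1 \<le> R \<Longrightarrow>
    integrable lborel (\<lambda>\<xi>. exp (- ((norm \<xi>)\<^sup>2 / (2 * R\<^sup>2))) * (norm (trig S c \<xi>))\<^sup>2) \<and>
    (\<integral>\<xi>. exp (- ((norm \<xi>)\<^sup>2 / (2 * R\<^sup>2))) * (norm (trig S c \<xi>))\<^sup>2 \<partial>lborel) \<le> C * R ^ 3 * (\<Sum>l\<in>S. (norm (c l))\<^sup>2)"
    using gaussian_trig_bound[OF \<epsilon>] by blast
  define K where "K = 64 * exp (1 / 2 :: real)"
  have K: "0 < K" by (simp add: K_def)
  have sm: "summable (\<lambda>n. 1 / real (Suc n) ^ 3)"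
    using summable_Suc_iff[of "\<lambda>n. 1 / real n ^ 3"] inverse_power_summable[of 3, where 'a = real] by (simp add: inverse_eq_divide)
  define Z where "Z = (\<Sum>n. 1 / real (Suc n) ^ 3)"
  have Z: "0 < Z" unfolding Z_def by (rule suminf_pos[OF sm]) simp
  have "(\<integral>\<^sup>+\<xi>. ennreal ((norm (trig S c \<xi>))\<^sup>2 / (1 + norm \<xi>) ^ 6) \<partial>lborel) \<le> ennreal ((K * C * Z) * (\<Sum>l\<in>S. (norm (c l))\<^sup>2))"
    if S: "finite S" "separated \<epsilon> S" for S c
  proof -
    let ?A = "\<Sum>l\<in>S. (norm (c l))\<^sup>2"
    have A0: "0 \<le> ?A" by (intro sum_nonneg) auto
    have [measurable]: "trig S c \<in> borel_measurable borel" unfolding trig_def[abs_def] by measurable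
    define g where "g n \<xi> = K / real (Suc n) ^ 6 * (exp (- ((norm \<xi>)\<^sup>2 / (2 * (real (Suc n))\<^sup>2))) * (norm (trig S c \<xi>))\<^sup>2)" for n \<xi>
    have g0: "0 \<le> g n \<xi>" for n \<xi> using K by (simp add: g_def)
    have pw: "ennreal ((norm (trig S c \<xi>))\<^sup>2 / (1 + norm \<xi>) ^ 6) \<le> (\<Sum>n. ennreal (g n \<xi>))" for \<xi>
    proof -
      \<comment> \<open>The width \<open>Suc n\<close> lies between |\<xi>| and 2 (1 + |\<xi>|): the
        Gaussian of that width is at least exp (- 1/2) at \<xi>, and the power 6 costs 2 ^ 6 = 64.
        The coefficients (Suc n) ^ (-6) leave (Suc n) ^ (-3) after integration, which is
        summable.\<close>
      define n where "n = nat \<lceil>norm \<xi>\<rceil>"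
      have nc: "real n = of_int \<lceil>norm \<xi>\<rceil>" by (simp add: n_def)
      have n1: "norm \<xi> \<le> real (Suc n)" using le_of_int_ceiling[of "norm \<xi>"]
        unfolding of_nat_Suc nc by linarith
      have "real (Suc n) \<le> norm \<xi> + 2" using of_int_ceiling_le_add_one[of "norm \<xi>"]
        unfolding of_nat_Suc nc by linarith
      also have "\<dots> \<le> 2 * (1 + norm \<xi>)" by simp
      finally have n2: "real (Suc n) \<le> 2 * (1 + norm \<xi>)" .
      note n = n1 n2
      have "(norm \<xi>)\<^sup>2 \<le> (real (Suc n))\<^sup>2" using n by (intro power_mono) auto
      then have "(norm \<xi>)\<^sup>2 / (2 * (real (Suc n))\<^sup>2) \<le> 1 / 2" by (simp add: field_simps)
      then have e: "1 \<le> exp (1 / 2) * exp (- ((norm \<xi>)\<^sup>2 / (2 * (real (Suc n))\<^sup>2)))"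
        by (simp add: exp_add[symmetric])
      have "real (Suc n) ^ 6 \<le> (2 * (1 + norm \<xi>)) ^ 6" using n by (intro power_mono) auto
      also have "(2 * (1 + norm \<xi>)) ^ 6 = 64 * (1 + norm \<xi>) ^ 6" by (simp only: power_mult_distrib) simp
      finally have "64 / (64 * (1 + norm \<xi>) ^ 6) \<le> 64 / real (Suc n) ^ 6" by (intro frac_le) auto
      then have p: "1 / (1 + norm \<xi>) ^ 6 \<le> 64 / real (Suc n) ^ 6" by simp
      have "(1 / (1 + norm \<xi>) ^ 6) * 1 \<le> (64 / real (Suc n) ^ 6) * (exp (1 / 2) * exp (- ((norm \<xi>)\<^sup>2 / (2 * (real (Suc n))\<^sup>2))))"
        by (rule mult_mono[OF p e]) auto
      then have "(1 / (1 + norm \<xi>) ^ 6) * 1 * (norm (trig S c \<xi>))\<^sup>2 \<le> (64 / real (Suc n) ^ 6) * (exp (1 / 2) * exp (- ((norm \<xi>)\<^sup>2 / (2 * (real (Suc n))\<^sup>2)))) * (norm (trig S c \<xi>))\<^sup>2"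
        by (rule mult_right_mono) simp
      then have "(norm (trig S c \<xi>))\<^sup>2 / (1 + norm \<xi>) ^ 6 \<le> g n \<xi>" by (simp add: g_def K_def)
      then have "ennreal ((norm (trig S c \<xi>))\<^sup>2 / (1 + norm \<xi>) ^ 6) \<le> ennreal (g n \<xi>)" by (rule ennreal_leI)
      also have "\<dots> = (\<Sum>i\<in>{n}. ennreal (g i \<xi>))" by simp
      also have "\<dots> \<le> (\<Sum>n. ennreal (g n \<xi>))" by (intro sum_le_suminf summableI) auto
      finally show ?thesis .
    qed
    have gi: "(\<integral>\<^sup>+\<xi>. ennreal (g n \<xi>) \<partial>lborel) \<le> ennreal (K * C * ?A * (1 / real (Suc n) ^ 3))" for n
    proof -
      have *: "integrable lborel (\<lambda>\<xi>. exp (- ((norm \<xi>)\<^sup>2 / (2 * (real (Suc n))\<^sup>2))) * (norm (trig S c \<xi>))\<^sup>2)"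
        "(\<integral>\<xi>. exp (- ((norm \<xi>)\<^sup>2 / (2 * (real (Suc n))\<^sup>2))) * (norm (trig S c \<xi>))\<^sup>2 \<partial>lborel) \<le> C * real (Suc n) ^ 3 * ?A"
        using C(2)[OF S, of "real (Suc n)" c] by auto
      have "(\<integral>\<^sup>+\<xi>. ennreal (g n \<xi>) \<partial>lborel) = ennreal (\<integral>\<xi>. g n \<xi> \<partial>lborel)"
        by (rule nn_integral_eq_integral) (use *(1) g0 in \<open>auto simp: g_def[abs_def] intro!: integrable_mult_right\<close>)
      also have "(\<integral>\<xi>. g n \<xi> \<partial>lborel) \<le> K / real (Suc n) ^ 6 * (C * real (Suc n) ^ 3 * ?A)"
        unfolding g_def integral_mult_right_zero using K by (intro mult_left_mono *(2)) auto
      also have "\<dots> = K * C * ?A * (1 / real (Suc n) ^ 3)"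
        by (simp add: field_simps power_add[symmetric] flip: power_add)
      finally show ?thesis by (simp add: ennreal_leI)
    qed
    have "(\<integral>\<^sup>+\<xi>. ennreal ((norm (trig S c \<xi>))\<^sup>2 / (1 + norm \<xi>) ^ 6) \<partial>lborel) \<le> (\<integral>\<^sup>+\<xi>. (\<Sum>n. ennreal (g n \<xi>)) \<partial>lborel)"
      by (intro nn_integral_mono pw)
    also have "\<dots> = (\<Sum>n. \<integral>\<^sup>+\<xi>. ennreal (g n \<xi>) \<partial>lborel)"
      by (rule nn_integral_suminf) (simp add: g_def)
    also have "\<dots> \<le> (\<Sum>n. ennreal (K * C * ?A * (1 / real (Suc n) ^ 3)))"
      by (intro suminf_le gi summableI)
    also have "\<dots> = ennreal (\<Sum>n. K * C * ?A * (1 / real (Suc n) ^ 3))"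
      by (rule suminf_ennreal2[OF _ summable_mult[OF sm]]) (use K C(1) A0 in simp)
    also have "(\<Sum>n. K * C * ?A * (1 / real (Suc n) ^ 3)) = K * C * ?A * Z"
      unfolding Z_def by (rule suminf_mult[OF sm])
    finally show ?thesis by (simp add: mult_ac)
  qed
  then show ?thesis using K C(1) Z by (intro exI[of _ "K * C * Z"]) auto
qed

text \<open>Dyadic balls: near 0 the weight is of order 4 ^ n on a ball of volume of order 8 ^ (-
  n), which is summable because the dimension is three; far away it is at most 256 ^ (- n) on a
  volume of order 8 ^ n.\<close>

lemma nn_integral_singular_weight:
  "(\<integral>\<^sup>+\<xi>. ennreal (1 / ((norm (\<xi>::vec))\<^sup>2 * (1 + norm \<xi>) ^ 6)) \<partial>lborel) < \<infinity>"
proof -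
  define U where "U = unit_ball_vol (real DIM(vec))"
  have U: "0 \<le> U" by (simp add: U_def unit_ball_vol_nonneg)
  define f where "f n (\<xi>::vec) = (4::real) * 4 ^ n * indicator (cball 0 ((1/2) ^ n)) \<xi> + (1 / 256) ^ n * indicator (cball 0 (2 * 2 ^ n)) \<xi>" for n \<xi>
  have [measurable]: "cball (0::vec) r \<in> sets borel" for r by simp
  have f0: "0 \<le> f n \<xi>" for n \<xi> by (simp add: f_def)
  have pw: "ennreal (1 / ((norm \<xi>)\<^sup>2 * (1 + norm \<xi>) ^ 6)) \<le> (\<Sum>n. ennreal (f n \<xi>))" for \<xi> :: vec
  proof -
    have "\<exists>n. 1 / ((norm \<xi>)\<^sup>2 * (1 + norm \<xi>) ^ 6) \<le> f n \<xi>"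
    proof (cases "\<xi> = 0")
      case True
      then show ?thesis using f0 by auto
    next
      case False
      then have r0: "0 < norm \<xi>" by simp
      let ?r = "norm \<xi>"
      show ?thesis
      proof (cases "?r \<le> 1")
        case True
        obtain m where m: "(1/2::real) ^ m < ?r" using real_arch_pow_inv[OF r0, of "1/2"] by auto
        define k where "k = (LEAST m. (1/2::real) ^ m < ?r)"
        have k: "(1/2) ^ k < ?r" unfolding k_def by (rule LeastI[of _ m]) (rule m)
        have "k \<noteq> 0" using k True by (intro notI) simp
        then obtain n where n: "k = Suc n" using not0_implies_Suc by blast
        have "\<not> (1/2) ^ n < ?r" using not_less_Least[of n "\<lambda>m. (1/2::real) ^ m < ?r"] n by (simp add: k_def)
        then have in1: "\<xi> \<in> cball 0 ((1/2) ^ n)" by simp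
        have "((1/2) ^ Suc n)\<^sup>2 \<le> ?r\<^sup>2" using k n by (intro power_mono) auto
        then have "(1/4) ^ Suc n * 1 \<le> ?r\<^sup>2 * (1 + ?r) ^ 6"
          by (intro mult_mono) (auto simp: power_mult[symmetric] mult.commute power2_eq_square power_mult_distrib[symmetric])
        then have "(1/4) ^ Suc n \<le> ?r\<^sup>2 * (1 + ?r) ^ 6" by simp
        from frac_le[OF zero_le_one order_refl _ this]
        have "1 / (?r\<^sup>2 * (1 + ?r) ^ 6) \<le> 1 / ((1/4) ^ Suc n)" by simp
        also have "\<dots> = 4 * 4 ^ n" by (simp add: power_one_over)
        also have "\<dots> \<le> f n \<xi>" using in1 by (simp add: f_def)
        finally show ?thesis by blast
      next
        case False
        obtain m where m: "?r < (2::real) ^ m" using real_arch_pow[of 2 ?r] by auto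
        define k where "k = (LEAST m. ?r < (2::real) ^ m)"
        have k: "?r < 2 ^ k" unfolding k_def by (rule LeastI[of _ m]) (rule m)
        have "k \<noteq> 0" using k False by (intro notI) simp
        then obtain n where n: "k = Suc n" using not0_implies_Suc by blast
        have nn: "2 ^ n \<le> ?r" using not_less_Least[of n "\<lambda>m. ?r < (2::real) ^ m"] n by (simp add: k_def)
        have in2: "\<xi> \<in> cball 0 (2 * 2 ^ n)" using k n by simp
        have "(2 ^ n)\<^sup>2 * (2 ^ n) ^ 6 \<le> ?r\<^sup>2 * (1 + ?r) ^ 6"
          using nn by (intro mult_mono power_mono) auto
        also have "(2 ^ n)\<^sup>2 * (2 ^ n) ^ 6 = (256::real) ^ n"
        proof -
          have "(2 ^ n)\<^sup>2 * (2 ^ n) ^ 6 = ((2::real) ^ n) ^ 8" by (simp flip: power_add)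
          also have "\<dots> = (2 ^ 8) ^ n" by (simp only: power_mult[symmetric] mult.commute)
          finally show ?thesis by simp
        qed
        finally have "256 ^ n \<le> ?r\<^sup>2 * (1 + ?r) ^ 6" .
        from frac_le[OF zero_le_one order_refl _ this]
        have "1 / (?r\<^sup>2 * (1 + ?r) ^ 6) \<le> 1 / 256 ^ n" by simp
        also have "\<dots> \<le> f n \<xi>" using in2 by (simp add: f_def power_one_over)
        finally show ?thesis by blast
      qed
    qed
    then obtain n where "1 / ((norm \<xi>)\<^sup>2 * (1 + norm \<xi>) ^ 6) \<le> f n \<xi>" by blast
    then have "ennreal (1 / ((norm \<xi>)\<^sup>2 * (1 + norm \<xi>) ^ 6)) \<le> (\<Sum>i\<in>{n}. ennreal (f i \<xi>))" by (simp add: ennreal_leI)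
    also have "\<dots> \<le> (\<Sum>n. ennreal (f n \<xi>))" by (intro sum_le_suminf summableI) auto
    finally show ?thesis .
  qed
  have cb: "(\<integral>\<^sup>+\<xi>. ennreal (a * indicator (cball (0::vec) r) \<xi>) \<partial>lborel) = ennreal (a * (U * r ^ 3))" if "0 \<le> a" "0 \<le> r" for a r
  proof -
    have "(\<integral>\<^sup>+\<xi>. ennreal (a * indicator (cball (0::vec) r) \<xi>) \<partial>lborel) = (\<integral>\<^sup>+\<xi>. ennreal a * indicator (cball (0::vec) r) \<xi> \<partial>lborel)"
      by (rule nn_integral_cong) (auto simp: indicator_def)
    also have "\<dots> = ennreal a * emeasure lborel (cball (0::vec) r)" by (rule nn_integral_cmult_indicator) simp
    also have "\<dots> = ennreal (a * (U * r ^ 3))"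
      using that U by (simp add: emeasure_cball U_def ennreal_mult)
    finally show ?thesis .
  qed
  have fi: "(\<integral>\<^sup>+\<xi>. ennreal (f n \<xi>) \<partial>lborel) = ennreal (4 * U * (1/2) ^ n + 8 * U * (1/32) ^ n)" for n
  proof -
    have "(\<integral>\<^sup>+\<xi>. ennreal (f n \<xi>) \<partial>lborel)
       = (\<integral>\<^sup>+\<xi>. ennreal (4 * 4 ^ n * indicator (cball (0::vec) ((1/2) ^ n)) \<xi>) + ennreal ((1 / 256) ^ n * indicator (cball (0::vec) (2 * 2 ^ n)) \<xi>) \<partial>lborel)"
      unfolding f_def by (rule nn_integral_cong) (simp add: ennreal_plus)
    also have "\<dots> = ennreal (4 * 4 ^ n * (U * ((1/2) ^ n) ^ 3)) + ennreal ((1 / 256) ^ n * (U * (2 * 2 ^ n) ^ 3))"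
    proof -
      have 1: "(\<integral>\<^sup>+\<xi>. ennreal (4 * 4 ^ n * indicator (cball (0::vec) ((1/2) ^ n)) \<xi>) \<partial>lborel) = ennreal (4 * 4 ^ n * (U * ((1/2) ^ n) ^ 3))"
        by (rule cb) simp_all
      have 2: "(\<integral>\<^sup>+\<xi>. ennreal ((1 / 256) ^ n * indicator (cball (0::vec) (2 * 2 ^ n)) \<xi>) \<partial>lborel) = ennreal ((1 / 256) ^ n * (U * (2 * 2 ^ n) ^ 3))"
        by (rule cb) simp_all
      show ?thesis unfolding 1[symmetric] 2[symmetric] by (rule nn_integral_add; measurable)
    qed
    also have "\<dots> = ennreal (4 * 4 ^ n * (U * ((1/2) ^ n) ^ 3) + (1 / 256) ^ n * (U * (2 * 2 ^ n) ^ 3))"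
      using U by (intro ennreal_plus[symmetric]) auto
    also have "4 * 4 ^ n * (U * ((1/2) ^ n) ^ 3) + (1 / 256) ^ n * (U * (2 * 2 ^ n) ^ 3) = 4 * U * (1/2) ^ n + 8 * U * (1/32) ^ n"
    proof -
      have sw: "(a ^ n) ^ 3 = (a ^ 3) ^ n" for a :: real by (simp only: power_mult[symmetric] mult.commute)
      have "4 ^ n * ((1/2) ^ n) ^ 3 = (4 * (1/2::real) ^ 3) ^ n" "(1/256) ^ n * (2 ^ n) ^ 3 = ((1/256::real) * 2 ^ 3) ^ n"
        by (simp_all only: sw power_mult_distrib)
      then have "4 ^ n * ((1/2) ^ n) ^ 3 = (1/2::real) ^ n" "(1/256) ^ n * (2 ^ n) ^ 3 = (1/32::real) ^ n"
        by (simp_all add: power3_eq_cube)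
      then have "4 * U * (4 ^ n * ((1/2) ^ n) ^ 3) + U * 8 * ((1/256) ^ n * (2 ^ n) ^ 3) = 4 * U * (1/2) ^ n + U * 8 * (1/32) ^ n"
        by (simp only:)
      moreover have "4 * 4 ^ n * (U * ((1/2) ^ n) ^ 3) + (1 / 256) ^ n * (U * (2 * 2 ^ n) ^ 3) = 4 * U * (4 ^ n * ((1/2) ^ n) ^ 3) + U * 8 * ((1/256) ^ n * (2 ^ n) ^ 3)"
        unfolding power_mult_distrib[of 2 "2 ^ n"] by (simp only: mult_ac) simp
      ultimately show ?thesis by (simp only: mult.commute[of U])
    qed
    finally show ?thesis .
  qed
  have sm: "summable (\<lambda>n. 4 * U * (1/2) ^ n + 8 * U * (1/32) ^ n)"
    by (intro summable_add summable_mult summable_geometric) auto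
  have "(\<integral>\<^sup>+\<xi>. ennreal (1 / ((norm (\<xi>::vec))\<^sup>2 * (1 + norm \<xi>) ^ 6)) \<partial>lborel) \<le> (\<integral>\<^sup>+\<xi>. (\<Sum>n. ennreal (f n \<xi>)) \<partial>lborel)"
    by (intro nn_integral_mono pw)
  also have "\<dots> = (\<Sum>n. \<integral>\<^sup>+\<xi>. ennreal (f n \<xi>) \<partial>lborel)"
    unfolding f_def by (rule nn_integral_suminf) measurable
  also have "\<dots> = ennreal (\<Sum>n. 4 * U * (1/2) ^ n + 8 * U * (1/32) ^ n)"
    unfolding fi by (rule suminf_ennreal2) (use U sm in auto)
  also have "\<dots> < \<infinity>" by simp
  finally show ?thesis .
qed

text \<open>The dual form of \<open>nn_integral_trig_bound\<close>. Choosing the conjugates of the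
  integrals as coefficients writes their square sum \<open>A\<close> as a single integral of
  \<open>trig\<close> times \<open>h\<close>. Young's inequality with weight (1 + |\<xi>|) ^ 6
  bounds it by a constant times \<open>K\<^sup>2\<close> plus A / 2, and the finite A / 2 is
  absorbed.\<close>

lemma lattice_bessel:
  assumes \<epsilon>: "0 < \<epsilon>"
  shows "\<exists>C>0. \<forall>h K. h \<in> borel_measurable borel \<and> 0 \<le> K \<and> (\<forall>\<xi>::vec. norm (h \<xi>) \<le> K / (norm \<xi> * (1 + norm \<xi>) ^ 7)) \<longrightarrow>
    integrable lborel h \<and> (\<forall>S x. finite S \<and> separated \<epsilon> S \<longrightarrow>
      (\<Sum>l\<in>S. (norm (\<integral>\<xi>. cis (\<xi> \<bullet> (x - l)) * h \<xi> \<partial>lborel))\<^sup>2) \<le> C * K\<^sup>2)"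
proof -
  obtain C where C: "0 < C" "\<And>S c. finite S \<Longrightarrow> separated \<epsilon> S \<Longrightarrow>
    (\<integral>\<^sup>+\<xi>. ennreal ((norm (trig S c \<xi>))\<^sup>2 / (1 + norm \<xi>) ^ 6) \<partial>lborel) \<le> ennreal (C * (\<Sum>l\<in>S. (norm (c l))\<^sup>2))"
    using nn_integral_trig_bound[OF \<epsilon>] by blast
  let ?k = "\<lambda>\<xi>::vec. 1 / ((norm \<xi>)\<^sup>2 * (1 + norm \<xi>) ^ 6)"
  have kint: "integrable lborel ?k"
    using nn_integral_singular_weight by (intro integrableI_nonneg) auto
  define k0 where "k0 = (\<integral>\<xi>. ?k \<xi> \<partial>lborel)"
  have k0: "0 \<le> k0" unfolding k0_def by (intro Bochner_Integration.integral_nonneg) auto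
  have knn: "(\<integral>\<^sup>+\<xi>. ennreal (?k \<xi>) \<partial>lborel) = ennreal k0"
    unfolding k0_def by (rule nn_integral_eq_integral[OF kint]) auto
  have "integrable lborel h \<and> (\<forall>S x. finite S \<and> separated \<epsilon> S \<longrightarrow>
      (\<Sum>l\<in>S. (norm (\<integral>\<xi>. cis (\<xi> \<bullet> (x - l)) * h \<xi> \<partial>lborel))\<^sup>2) \<le> (C * (k0 + 1)) * K\<^sup>2)"
    if hm: "h \<in> borel_measurable borel" and K: "0 \<le> K" and hb: "\<And>\<xi>::vec. norm (h \<xi>) \<le> K / (norm \<xi> * (1 + norm \<xi>) ^ 7)" for h K
  proof -
    note [measurable] = hm
    \<comment> \<open>At \<xi> = 0 the bound on \<open>h\<close> reads 0, as division by zero yields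
      0, so \<open>h\<close> vanishes there.\<close>
    have h1: "norm (h \<xi>) \<le> K * ?k \<xi>" for \<xi>
    proof (cases "\<xi> = 0")
      case False
      have "norm \<xi> * norm \<xi> * (1 + norm \<xi>) ^ 6 \<le> norm \<xi> * (1 + norm \<xi>) * (1 + norm \<xi>) ^ 6"
        by (intro mult_right_mono mult_left_mono) auto
      then have "(norm \<xi>)\<^sup>2 * (1 + norm \<xi>) ^ 6 \<le> norm \<xi> * (1 + norm \<xi>) ^ 7"
        by (simp add: power2_eq_square power_Suc[symmetric] mult.assoc numeral_eq_Suc)
      moreover have "0 < (norm \<xi>)\<^sup>2 * (1 + norm \<xi>) ^ 6"
        using False by (intro mult_pos_pos zero_less_power) (auto intro: add_pos_nonneg)
      ultimately have "K / (norm \<xi> * (1 + norm \<xi>) ^ 7) \<le> K / ((norm \<xi>)\<^sup>2 * (1 + norm \<xi>) ^ 6)"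
        using K by (intro frac_le) auto
      then show ?thesis using hb[of \<xi>] by simp
    qed (use hb[of 0] in simp)
    have hint: "integrable lborel h"
      by (rule Bochner_Integration.integrable_bound[OF integrable_mult_right[OF kint, of K]])
        (use h1 K in \<open>auto intro!: AE_I2\<close>)
    have h2: "(norm (h \<xi>))\<^sup>2 * (1 + norm \<xi>) ^ 6 \<le> K\<^sup>2 * ?k \<xi>" for \<xi>
    proof (cases "\<xi> = 0")
      case False
      let ?r = "norm \<xi>"
      have r: "0 < ?r" using False by simp
      have "(norm (h \<xi>))\<^sup>2 * (1 + ?r) ^ 6 \<le> (K / (?r * (1 + ?r) ^ 7))\<^sup>2 * (1 + ?r) ^ 6"
        by (intro mult_right_mono power_mono hb) auto
      also have "\<dots> = K\<^sup>2 / (?r\<^sup>2 * (1 + ?r) ^ 8)"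
      proof -
        have e: "(1 + ?r) ^ 7 * (1 + ?r) ^ 7 = (1 + ?r) ^ 8 * (1 + ?r) ^ 6" by (simp flip: power_add)
        have p: "0 < (1 + ?r) ^ 6" by (intro zero_less_power add_pos_nonneg) auto
        have "(K / (?r * (1 + ?r) ^ 7))\<^sup>2 * (1 + ?r) ^ 6 = K\<^sup>2 * (1 + ?r) ^ 6 / (?r\<^sup>2 * ((1 + ?r) ^ 7 * (1 + ?r) ^ 7))"
          by (simp add: power2_eq_square mult_ac)
        also have "\<dots> = K\<^sup>2 * (1 + ?r) ^ 6 / (?r\<^sup>2 * (1 + ?r) ^ 8 * (1 + ?r) ^ 6)" unfolding e by (simp only: mult.assoc)
        also have "\<dots> = K\<^sup>2 / (?r\<^sup>2 * (1 + ?r) ^ 8)" using p by simp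
        finally show ?thesis .
      qed
      also have "\<dots> \<le> K\<^sup>2 / (?r\<^sup>2 * (1 + ?r) ^ 6)"
      proof (rule frac_le)
        show "?r\<^sup>2 * (1 + ?r) ^ 6 \<le> ?r\<^sup>2 * (1 + ?r) ^ 8" by (intro mult_left_mono power_increasing) auto
        show "0 < ?r\<^sup>2 * (1 + ?r) ^ 6" using r by (intro mult_pos_pos zero_less_power) (auto intro: add_pos_nonneg)
      qed auto
      finally show ?thesis by simp
    qed (use hb[of 0] in simp)
    have "(\<Sum>l\<in>S. (norm (\<integral>\<xi>. cis (\<xi> \<bullet> (x - l)) * h \<xi> \<partial>lborel))\<^sup>2) \<le> (C * (k0 + 1)) * K\<^sup>2"
      if S: "finite S" "separated \<epsilon> S" for S x
    proof -
      define g where "g l = (\<integral>\<xi>. cis (\<xi> \<bullet> (x - l)) * h \<xi> \<partial>lborel)" for l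
      define c where "c l = cnj (g l)" for l
      define A where "A = (\<Sum>l\<in>S. (norm (g l))\<^sup>2)"
      have A0: "0 \<le> A" unfolding A_def by (intro sum_nonneg) auto
      have [measurable]: "trig S c \<in> borel_measurable borel" unfolding trig_def[abs_def] by measurable
      have gint: "integrable lborel (\<lambda>\<xi>. cis (\<xi> \<bullet> (x - l)) * h \<xi>)" for l
        by (rule Bochner_Integration.integrable_bound[OF hint]) (auto simp: norm_mult intro!: AE_I2)
      have "complex_of_real A = (\<Sum>l\<in>S. c l * g l)"
        unfolding A_def of_real_sum by (intro sum.cong refl) (simp add: c_def complex_norm_square mult.commute del: of_real_power)
      also have "\<dots> = (\<integral>\<xi>. (\<Sum>l\<in>S. c l * (cis (\<xi> \<bullet> (x - l)) * h \<xi>)) \<partial>lborel)"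
        unfolding g_def by (simp add: Bochner_Integration.integral_sum integrable_mult_right gint)
      also have "\<dots> = (\<integral>\<xi>. cis (\<xi> \<bullet> x) * (trig S c \<xi> * h \<xi>) \<partial>lborel)"
      proof (rule Bochner_Integration.integral_cong[OF refl])
        fix \<xi>
        have "cis (\<xi> \<bullet> (x - l)) = cis (\<xi> \<bullet> x) * cis (- (\<xi> \<bullet> l))" for l by (simp add: cis_mult inner_diff_right)
        then show "(\<Sum>l\<in>S. c l * (cis (\<xi> \<bullet> (x - l)) * h \<xi>)) = cis (\<xi> \<bullet> x) * (trig S c \<xi> * h \<xi>)"
          by (simp add: trig_def sum_distrib_left sum_distrib_right mult_ac)
      qed
      finally have Aeq: "complex_of_real A = (\<integral>\<xi>. cis (\<xi> \<bullet> x) * (trig S c \<xi> * h \<xi>) \<partial>lborel)" .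
      define B where "B = (\<Sum>l\<in>S. norm (c l))"
      have B0: "0 \<le> B" unfolding B_def by (intro sum_nonneg) auto
      have trigB: "norm (trig S c \<xi>) \<le> B" for \<xi>
        unfolding trig_def B_def by (intro order_trans[OF norm_sum] sum_mono) (simp add: norm_mult)
      have pint: "integrable lborel (\<lambda>\<xi>. cis (\<xi> \<bullet> x) * (trig S c \<xi> * h \<xi>))"
      proof (rule Bochner_Integration.integrable_bound[OF integrable_mult_right[OF hint, of "complex_of_real B"]])
        show "(\<lambda>\<xi>. cis (\<xi> \<bullet> x) * (trig S c \<xi> * h \<xi>)) \<in> borel_measurable lborel" by measurable
        show "AE \<xi> in lborel. norm (cis (\<xi> \<bullet> x) * (trig S c \<xi> * h \<xi>)) \<le> norm (complex_of_real B * h \<xi>)"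
          using trigB B0 by (intro AE_I2) (simp add: norm_mult mult_right_mono)
      qed
      have "ennreal A = ennreal (norm (complex_of_real A))" using A0 by simp
      also have "\<dots> \<le> (\<integral>\<^sup>+\<xi>. ennreal (norm (cis (\<xi> \<bullet> x) * (trig S c \<xi> * h \<xi>))) \<partial>lborel)"
        unfolding Aeq by (rule integral_norm_bound_ennreal[OF pint])
      also have "\<dots> \<le> (\<integral>\<^sup>+\<xi>. ennreal (C * K\<^sup>2 / 2 * ?k \<xi>) + ennreal (1 / (2 * C) * ((norm (trig S c \<xi>))\<^sup>2 / (1 + norm \<xi>) ^ 6)) \<partial>lborel)"
      proof (rule nn_integral_mono)
        fix \<xi>
        let ?T = "norm (trig S c \<xi>)" and ?H = "norm (h \<xi>)" and ?w = "(1 + norm \<xi>) ^ 6"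
        have w: "0 < ?w" by (intro zero_less_power add_pos_nonneg) auto
        have "?T * ?H \<le> C / 2 * (?H\<^sup>2 * ?w) + 1 / (2 * C) * (?T\<^sup>2 / ?w)"
        proof -
          \<comment> \<open>The weights in the square are balanced so that the \<open>trig\<close>
            part, after the bound with constant \<open>C\<close>, contributes exactly A / 2.\<close>
          have "0 \<le> (C * ?w * ?H - ?T)\<^sup>2 / (2 * C * ?w)" using C(1) w by (intro divide_nonneg_pos) auto
          also have "\<dots> = C / 2 * (?H\<^sup>2 * ?w) + 1 / (2 * C) * (?T\<^sup>2 / ?w) - ?T * ?H"
            using C(1) w by (simp add: power2_diff field_simps power2_eq_square)
          finally show ?thesis by simp
        qed
        also have "\<dots> \<le> C / 2 * (K\<^sup>2 * ?k \<xi>) + 1 / (2 * C) * (?T\<^sup>2 / ?w)"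
          using C(1) by (intro add_right_mono mult_left_mono h2) auto
        finally have "norm (cis (\<xi> \<bullet> x) * (trig S c \<xi> * h \<xi>)) \<le> C * K\<^sup>2 / 2 * ?k \<xi> + 1 / (2 * C) * (?T\<^sup>2 / ?w)"
          by (simp add: norm_mult)
        then have "ennreal (norm (cis (\<xi> \<bullet> x) * (trig S c \<xi> * h \<xi>))) \<le> ennreal (C * K\<^sup>2 / 2 * ?k \<xi> + 1 / (2 * C) * (?T\<^sup>2 / ?w))"
          by (rule ennreal_leI)
        also have "\<dots> = ennreal (C * K\<^sup>2 / 2 * ?k \<xi>) + ennreal (1 / (2 * C) * (?T\<^sup>2 / ?w))"
          using C(1) w by (intro ennreal_plus) (auto intro!: mult_nonneg_nonneg divide_nonneg_nonneg)
        finally show "ennreal (norm (cis (\<xi> \<bullet> x) * (trig S c \<xi> * h \<xi>))) \<le> ennreal (C * K\<^sup>2 / 2 * ?k \<xi>) + ennreal (1 / (2 * C) * (?T\<^sup>2 / ?w))" .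
      qed
      also have "\<dots> = (\<integral>\<^sup>+\<xi>. ennreal (C * K\<^sup>2 / 2 * ?k \<xi>) \<partial>lborel) + (\<integral>\<^sup>+\<xi>. ennreal (1 / (2 * C) * ((norm (trig S c \<xi>))\<^sup>2 / (1 + norm \<xi>) ^ 6)) \<partial>lborel)"
        (is "_ = ?X + ?Y") by (rule nn_integral_add) auto
      finally have st: "ennreal A \<le> ?X + ?Y" .
      have X: "?X = ennreal (C * K\<^sup>2 / 2) * ennreal k0"
        unfolding knn[symmetric] using C(1) by (subst nn_integral_cmult[symmetric]) (auto simp: ennreal_mult[symmetric] intro!: nn_integral_cong)
      have "?Y = ennreal (1 / (2 * C)) * (\<integral>\<^sup>+\<xi>. ennreal ((norm (trig S c \<xi>))\<^sup>2 / (1 + norm \<xi>) ^ 6) \<partial>lborel)"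
        using C(1) by (subst nn_integral_cmult[symmetric]) (auto simp: ennreal_mult[symmetric] intro!: nn_integral_cong)
      also have "\<dots> \<le> ennreal (1 / (2 * C)) * ennreal (C * A)"
        using C(2)[OF S, of c] by (intro mult_left_mono) (auto simp: c_def A_def)
      finally have Y: "?Y \<le> ennreal (1 / (2 * C)) * ennreal (C * A)" .
      have "ennreal A \<le> ennreal (C * K\<^sup>2 / 2) * ennreal k0 + ennreal (1 / (2 * C)) * ennreal (C * A)"
        by (rule order_trans[OF st add_mono[OF eq_refl[OF X] Y]])
      also have "\<dots> = ennreal (C * K\<^sup>2 / 2 * k0 + A / 2)"
        using C(1) k0 A0 by (simp add: ennreal_mult[symmetric] ennreal_plus[symmetric] del: ennreal_plus)
      finally have "A \<le> C * K\<^sup>2 / 2 * k0 + A / 2"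
        using C(1) k0 A0 by (subst (asm) ennreal_le_iff) auto
      then have "A \<le> C * k0 * K\<^sup>2" by (simp add: field_simps)
      also have "\<dots> \<le> (C * (k0 + 1)) * K\<^sup>2" using C(1) by (intro mult_right_mono mult_left_mono) auto
      finally show ?thesis by (simp add: A_def g_def)
    qed
    then show ?thesis using hint by blast
  qed
  then show ?thesis using C(1) k0 by (intro exI[of _ "C * (k0 + 1)"]) (auto intro: mult_pos_pos add_nonneg_pos)
qed

section \<open>The observable as a sum over edges\<close>

lemma ft_iter_pd:
  assumes "smooth f" "compact_supp f"
  shows "(\<integral>x. cis (- (\<xi> \<bullet> x)) * complex_of_real (iter_pd (replicate n i) f x) \<partial>lborel)
     = (\<i> * of_real (\<xi> $ i)) ^ n * (\<integral>x. cis (- (\<xi> \<bullet> x)) * complex_of_real (f x) \<partial>lborel)"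
  by (induction n) (simp_all add: ft_pd[OF smooth_iter_pd[OF assms(1)] compact_supp_iter_pd[OF assms(2)]])

lemma integrable_cis_mult:
  assumes "continuous_on UNIV f" "compact_supp f"
  shows "integrable lborel (\<lambda>x::vec. cis (- (\<xi> \<bullet> x)) * complex_of_real (f x))"
proof (rule integrable_continuous_compact_supp)
  show "continuous_on UNIV (\<lambda>x. cis (- (\<xi> \<bullet> x)) * complex_of_real (f x))"
    by (intro continuous_intros assms)
  show "compact_supp (\<lambda>x. cis (- (\<xi> \<bullet> x)) * complex_of_real (f x))"
    using assms(2) unfolding compact_supp_def by fastforce
qed

text \<open>The transform times a seventh power of a coordinate is the transform of a seventh
  derivative, bounded by its L1 norm. The exponent 7 is the one that \<open>lattice_bessel\<close>
  asks for.\<close>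

lemma ft_decay:
  assumes f: "smooth f" "compact_supp f"
  shows "\<exists>C\<ge>0. \<forall>\<xi>. norm (ft (\<lambda>x. complex_of_real (f x)) \<xi>) \<le> C / (1 + norm \<xi>) ^ 7"
proof -
  define F where "F \<xi> = (\<integral>x. cis (- (\<xi> \<bullet> x)) * complex_of_real (f x) \<partial>lborel)" for \<xi>
  define d where "d n i = (\<integral>x. \<bar>iter_pd (replicate n i) f x\<bar> \<partial>lborel)" for n :: nat and i :: 3
  have d0: "0 \<le> d n i" for n i unfolding d_def by (intro Bochner_Integration.integral_nonneg) auto
  have b: "\<bar>\<xi> $ i\<bar> ^ n * norm (F \<xi>) \<le> d n i" for n i \<xi>
  proof -
    have "\<bar>\<xi> $ i\<bar> ^ n * norm (F \<xi>) = norm (\<integral>x. cis (- (\<xi> \<bullet> x)) * complex_of_real (iter_pd (replicate n i) f x) \<partial>lborel)"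
      unfolding ft_iter_pd[OF f] F_def by (simp add: norm_mult norm_power)
    also have "\<dots> \<le> (\<integral>x. norm (cis (- (\<xi> \<bullet> x)) * complex_of_real (iter_pd (replicate n i) f x)) \<partial>lborel)"
      by (rule integral_norm_bound)
    finally show ?thesis by (simp add: norm_mult d_def)
  qed
  define c where "c = (2 * pi) powr (-3/2)"
  have c: "0 \<le> c" by (simp add: c_def)
  define C where "C = c * (4 ^ 7 * (d 0 1 + d 7 1 + d 7 2 + d 7 3))"
  have "norm (ft (\<lambda>x. complex_of_real (f x)) \<xi>) \<le> C / (1 + norm \<xi>) ^ 7" for \<xi>
  proof -
    \<comment> \<open>The largest of 1 and the coordinates is comparable to 1 + |\<xi>|, up to the
      factor 4, and is one of four quantities for which a bound is known.\<close>
    define M where "M = Max {1, \<bar>\<xi> $ 1\<bar>, \<bar>\<xi> $ 2\<bar>, \<bar>\<xi> $ 3\<bar>}"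
    have M: "1 \<le> M" "\<bar>\<xi> $ 1\<bar> \<le> M" "\<bar>\<xi> $ 2\<bar> \<le> M" "\<bar>\<xi> $ 3\<bar> \<le> M" unfolding M_def by (intro Max_ge; simp)+
    have Min: "M \<in> {1, \<bar>\<xi> $ 1\<bar>, \<bar>\<xi> $ 2\<bar>, \<bar>\<xi> $ 3\<bar>}" unfolding M_def by (rule Max_in) auto
    have "norm \<xi> \<le> \<bar>\<xi> $ 1\<bar> + \<bar>\<xi> $ 2\<bar> + \<bar>\<xi> $ 3\<bar>"
      using norm_le_l1_cart[of \<xi>] by (simp add: sum_3)
    then have "1 + norm \<xi> \<le> 4 * M" using M by linarith
    then have "(1 + norm \<xi>) ^ 7 \<le> (4 * M) ^ 7" by (intro power_mono) auto
    then have p: "(1 + norm \<xi>) ^ 7 \<le> 4 ^ 7 * M ^ 7" by (simp only: power_mult_distrib)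
    have "M ^ 7 * norm (F \<xi>) \<le> d 0 1 + d 7 1 + d 7 2 + d 7 3"
    proof -
      have "M ^ 7 * norm (F \<xi>) \<in> {norm (F \<xi>), \<bar>\<xi> $ 1\<bar> ^ 7 * norm (F \<xi>), \<bar>\<xi> $ 2\<bar> ^ 7 * norm (F \<xi>), \<bar>\<xi> $ 3\<bar> ^ 7 * norm (F \<xi>)}"
        using Min by auto
      moreover have "norm (F \<xi>) \<le> d 0 1" using b[of \<xi> 1 0] by simp
      ultimately show ?thesis using b[of \<xi> 1 7] b[of \<xi> 2 7] b[of \<xi> 3 7] d0[of 0 1] d0[of 7 1] d0[of 7 2] d0[of 7 3]
        by (elim insertE emptyE) linarith+
    qed
    then have "4 ^ 7 * (M ^ 7 * norm (F \<xi>)) \<le> 4 ^ 7 * (d 0 1 + d 7 1 + d 7 2 + d 7 3)" by (rule mult_left_mono) simp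
    moreover have "(1 + norm \<xi>) ^ 7 * norm (F \<xi>) \<le> 4 ^ 7 * M ^ 7 * norm (F \<xi>)" by (rule mult_right_mono[OF p]) simp
    ultimately have "(1 + norm \<xi>) ^ 7 * norm (F \<xi>) \<le> 4 ^ 7 * (d 0 1 + d 7 1 + d 7 2 + d 7 3)" by (simp only: mult.assoc order_trans)
    from mult_left_mono[OF this c] have "(c * norm (F \<xi>)) * (1 + norm \<xi>) ^ 7 \<le> C" by (simp only: C_def mult_ac)
    moreover have "0 < (1 + norm \<xi>) ^ 7" by (intro zero_less_power add_pos_nonneg) auto
    ultimately have "c * norm (F \<xi>) \<le> C / (1 + norm \<xi>) ^ 7" by (simp add: pos_le_divide_eq)
    moreover have "norm (ft (\<lambda>x. complex_of_real (f x)) \<xi>) = c * norm (F \<xi>)"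
      using c unfolding ft_def F_def norm_mult norm_of_real c_def[symmetric] by simp
    ultimately show ?thesis by simp
  qed
  moreover have "0 \<le> C" unfolding C_def using c d0 by (intro mult_nonneg_nonneg add_nonneg_nonneg) auto
  ultimately show ?thesis by blast
qed

lemma conv_seg_param_int:
  "conv_seg \<phi> e = (\<lambda>x. norm (snd e - fst e) * param_int (cbox 0 1) (\<lambda>_. 1) (\<lambda>s. fst e + s *\<^sub>R (snd e - fst e)) \<phi> x)"
  by (simp add: fun_eq_iff conv_seg_def param_int_def)

lemma smooth_conv_seg: "smooth \<phi> \<Longrightarrow> smooth (conv_seg \<phi> e)"
  unfolding conv_seg_param_int
  by (intro smooth_linear[OF bounded_linear_mult_right] smooth_param_int continuous_intros)

lemma compact_supp_conv_seg: "compact_supp \<phi> \<Longrightarrow> compact_supp (conv_seg \<phi> e)"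
  unfolding conv_seg_param_int
  by (intro compact_supp_map[where T = "\<lambda>r. norm (snd e - fst e) * r"] compact_supp_param_int continuous_intros) auto

lemma smooth_bfield: "smooth \<phi> \<Longrightarrow> smooth (bfield \<phi> E I i j k)"
  unfolding bfield_def[abs_def] convJ_def
  by (intro smooth_sum smooth_linear[OF bounded_linear_mult_right] smooth_conv_seg)

lemma compact_supp_bfield: "compact_supp \<phi> \<Longrightarrow> compact_supp (bfield \<phi> E I i j k)"
  unfolding bfield_def[abs_def] convJ_def
  by (intro compact_supp_sum compact_supp_map[where T = "\<lambda>r. c * r" for c :: real] compact_supp_conv_seg) auto

text \<open>Decomposition into unit currents on single edges. These violate Kirchhoff's law, but the
  density and the symbol are explicit formulas, linear in arbitrary currents.\<close>

lemma bfield_superposition: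
  "bfield \<phi> E I i j k x = (\<Sum>e\<in>E. \<Sum>m\<in>UNIV. I e $ m * bfield \<phi> {e} (\<lambda>_. axis m 1) i j k x)"
proof -
  have "(\<Sum>m\<in>UNIV. I e $ m * bfield \<phi> {e} (\<lambda>_. axis m 1) i j k x) = (\<Sum>l\<in>UNIV. levi_civita i j l * (edge_dir e $ l * I e $ k * conv_seg \<phi> e x))" for e
  proof -
    have "(\<Sum>m\<in>UNIV. I e $ m * bfield \<phi> {e} (\<lambda>_. axis m 1) i j k x)
       = (\<Sum>m\<in>UNIV. if m = k then I e $ k * (\<Sum>l\<in>UNIV. levi_civita i j l * (edge_dir e $ l * conv_seg \<phi> e x)) else 0)"
      by (rule sum.cong) (auto simp: bfield_def convJ_def axis_def)
    then show ?thesis by (simp add: sum_distrib_left mult_ac)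
  qed
  then have "(\<Sum>e\<in>E. \<Sum>m\<in>UNIV. I e $ m * bfield \<phi> {e} (\<lambda>_. axis m 1) i j k x)
      = (\<Sum>l\<in>UNIV. \<Sum>e\<in>E. levi_civita i j l * (edge_dir e $ l * I e $ k * conv_seg \<phi> e x))"
    by (simp only:) (rule sum.swap)
  then show ?thesis by (simp add: bfield_def convJ_def sum_distrib_left)
qed

lemma bhat_superposition:
  assumes \<phi>: "smooth \<phi>" "compact_supp \<phi>"
  shows "bhat \<phi> E I i j k \<xi> = (\<Sum>e\<in>E. \<Sum>m\<in>UNIV. of_real (I e $ m) * bhat \<phi> {e} (\<lambda>_. axis m 1) i j k \<xi>)"
proof -
  let ?b = "\<lambda>e m x. bfield \<phi> {e} (\<lambda>_. axis m 1) i j k x"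
  have int: "integrable lborel (\<lambda>x. cis (- (\<xi> \<bullet> x)) * complex_of_real (?b e m x))" for e m
    by (rule integrable_cis_mult[OF smooth_continuous[OF smooth_bfield[OF \<phi>(1)]] compact_supp_bfield[OF \<phi>(2)]])
  have "(\<integral>x. cis (- (\<xi> \<bullet> x)) * complex_of_real (bfield \<phi> E I i j k x) \<partial>lborel)
     = (\<integral>x. (\<Sum>e\<in>E. \<Sum>m\<in>UNIV. of_real (I e $ m) * (cis (- (\<xi> \<bullet> x)) * complex_of_real (?b e m x))) \<partial>lborel)"
    by (subst bfield_superposition) (simp add: sum_distrib_left mult_ac)
  also have "\<dots> = (\<Sum>e\<in>E. \<Sum>m\<in>UNIV. of_real (I e $ m) * (\<integral>x. cis (- (\<xi> \<bullet> x)) * complex_of_real (?b e m x) \<partial>lborel))"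
    by (simp add: Bochner_Integration.integral_sum integrable_mult_right int)
  finally show ?thesis by (simp add: bhat_def ft_def sum_distrib_left mult_ac)
qed

text \<open>The symbol as a function of the 27 values of the transformed density at one \<xi>.
  Superposition, translation and the size estimate then all reduce to its linearity and one norm
  bound.\<close>

definition wstar_functional :: "real \<Rightarrow> real \<Rightarrow> 3 \<Rightarrow> 3 \<Rightarrow> vec \<Rightarrow> (3 \<Rightarrow> 3 \<Rightarrow> 3 \<Rightarrow> complex) \<Rightarrow> complex" where
  "wstar_functional lam mu i j \<xi> b =
     (\<Sum>l\<in>UNIV. sym_invlap \<xi> * sym_d l \<xi> * b l i j)
     + (- sym_d i \<xi> * sym_invlap2 \<xi> *
        (\<Sum>k\<in>UNIV. \<Sum>l\<in>UNIV.
           sym_d k \<xi> * sym_d l \<xi> * b l j k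
           + complex_of_real (lam / (2 * mu + lam)) * sym_d j \<xi> * sym_d l \<xi> * b l k k))"

lemma wstar_symbol_functional:
  "wstar_symbol lam mu \<phi> E I i j \<xi> = wstar_functional lam mu i j \<xi> (\<lambda>p q r. bhat \<phi> E I p q r \<xi>)"
  by (simp only: wstar_symbol_def wstar_functional_def)

lemma wstar_functional_add:
  "wstar_functional lam mu i j \<xi> (\<lambda>p q r. b p q r + b' p q r)
    = wstar_functional lam mu i j \<xi> b + wstar_functional lam mu i j \<xi> b'"
  unfolding wstar_functional_def by (simp only: distrib_left sum.distrib) (simp add: sum.distrib algebra_simps)

lemma wstar_functional_scale:
  "wstar_functional lam mu i j \<xi> (\<lambda>p q r. c * b p q r) = c * wstar_functional lam mu i j \<xi> b"
  unfolding wstar_functional_def by (simp add: sum_distrib_left algebra_simps)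

lemma wstar_functional_sum:
  "wstar_functional lam mu i j \<xi> (\<lambda>p q r. \<Sum>e\<in>E. b e p q r) = (\<Sum>e\<in>E. wstar_functional lam mu i j \<xi> (b e))"
proof (induction E rule: infinite_finite_induct)
  case (insert e E)
  then show ?case by (simp add: wstar_functional_add)
qed (use wstar_functional_scale[of lam mu i j \<xi> 0 "\<lambda>_ _ _. 0"] in simp_all)

lemma wstar_symbol_superposition:
  assumes \<phi>: "smooth \<phi>" "compact_supp \<phi>"
  shows "wstar_symbol lam mu \<phi> E I i j \<xi>
    = (\<Sum>e\<in>E. \<Sum>m\<in>UNIV. of_real (I e $ m) * wstar_symbol lam mu \<phi> {e} (\<lambda>_. axis m 1) i j \<xi>)"
  unfolding wstar_symbol_functional by (subst bhat_superposition[OF \<phi>])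
    (simp only: wstar_functional_sum wstar_functional_scale)

text \<open>The only place where the Lame constants enter the size of the observable; the bound 1
  makes all later constants independent of them.\<close>

lemma lame_ratio: "lame lam mu \<Longrightarrow> \<bar>lam / (2 * mu + lam)\<bar> \<le> 1"
  unfolding lame_def by (auto simp: abs_le_iff divide_le_eq le_divide_eq field_simps)

text \<open>Both parts are homogeneous of degree - 1 in \<xi>. The constant counts terms: 3 from the
  first sum and 2 * 9 from the second.\<close>

lemma wstar_functional_bound:
  assumes L: "lame lam mu" and b: "\<And>p q r. norm (b p q r) \<le> B"
  shows "norm (wstar_functional lam mu i j \<xi> b) \<le> 21 * B / norm \<xi>"
proof (cases "\<xi> = 0")
  case True
  then show ?thesis by (simp add: wstar_functional_def sym_d_def)
next
  case False
  let ?r = "norm \<xi>"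
  have r: "0 < ?r" using False by simp
  have B: "0 \<le> B" using b[of 1 1 1] norm_ge_zero order_trans by blast
  have d: "norm (sym_d l \<xi>) \<le> ?r" for l by (simp add: sym_d_def norm_mult component_le_norm_cart)
  have i1: "norm (sym_invlap \<xi>) = 1 / ?r\<^sup>2" by (simp add: sym_invlap_def norm_power inverse_eq_divide norm_divide)
  have i2: "norm (sym_invlap2 \<xi>) = 1 / ?r ^ 4" by (simp add: sym_invlap2_def norm_power inverse_eq_divide norm_divide)
  have t1: "norm (sym_invlap \<xi> * sym_d l \<xi> * b l i j) \<le> B / ?r" for l
  proof -
    have "norm (sym_invlap \<xi> * sym_d l \<xi> * b l i j) \<le> 1 / ?r\<^sup>2 * ?r * B"
      unfolding norm_mult i1 by (intro mult_mono d b) (auto simp: B)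
    also have "\<dots> = B / ?r" using r by (simp add: power2_eq_square)
    finally show ?thesis .
  qed
  have t2: "norm (sym_d k \<xi> * sym_d l \<xi> * b l j k + complex_of_real (lam / (2 * mu + lam)) * sym_d j \<xi> * sym_d l \<xi> * b l k k) \<le> 2 * (?r\<^sup>2 * B)" for k l
  proof -
    have 1: "norm (sym_d k \<xi> * sym_d l \<xi> * b l j k) \<le> ?r * ?r * B"
      unfolding norm_mult by (intro mult_mono d b) (auto simp: B)
    have 2: "norm (complex_of_real (lam / (2 * mu + lam)) * sym_d j \<xi> * sym_d l \<xi> * b l k k) \<le> 1 * ?r * ?r * B"
      unfolding norm_mult norm_of_real by (intro mult_mono d b lame_ratio[OF L]) (auto simp: B)
    have "?r * ?r * B + 1 * ?r * ?r * B = 2 * (?r\<^sup>2 * B)" by (simp add: power2_eq_square)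
    then show ?thesis using norm_triangle_mono[OF 1 2] by (simp only:)
  qed
  have "norm (\<Sum>l\<in>UNIV. sym_invlap \<xi> * sym_d l \<xi> * b l i j) \<le> (\<Sum>l\<in>(UNIV::3 set). B / ?r)"
    by (intro order_trans[OF norm_sum] sum_mono t1)
  then have A1: "norm (\<Sum>l\<in>UNIV. sym_invlap \<xi> * sym_d l \<xi> * b l i j) \<le> 3 * (B / ?r)" by simp
  have "norm (\<Sum>k\<in>UNIV. \<Sum>l\<in>UNIV. sym_d k \<xi> * sym_d l \<xi> * b l j k + complex_of_real (lam / (2 * mu + lam)) * sym_d j \<xi> * sym_d l \<xi> * b l k k)
     \<le> (\<Sum>k\<in>(UNIV::3 set). \<Sum>l\<in>(UNIV::3 set). 2 * (?r\<^sup>2 * B))"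
    by (intro order_trans[OF norm_sum] sum_mono t2)
  then have A2: "norm (\<Sum>k\<in>UNIV. \<Sum>l\<in>UNIV. sym_d k \<xi> * sym_d l \<xi> * b l j k + complex_of_real (lam / (2 * mu + lam)) * sym_d j \<xi> * sym_d l \<xi> * b l k k) \<le> 18 * (?r\<^sup>2 * B)"
    by simp
  have "norm (- sym_d i \<xi> * sym_invlap2 \<xi> * (\<Sum>k\<in>UNIV. \<Sum>l\<in>UNIV. sym_d k \<xi> * sym_d l \<xi> * b l j k + complex_of_real (lam / (2 * mu + lam)) * sym_d j \<xi> * sym_d l \<xi> * b l k k))
     \<le> ?r * (1 / ?r ^ 4) * (18 * (?r\<^sup>2 * B))"
    unfolding norm_mult norm_minus_cancel i2 by (intro mult_mono d A2) auto
  also have "\<dots> = 18 * (B / ?r)" using r by (simp add: field_simps power2_eq_square power4_eq_xxxx)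
  finally have "norm (wstar_functional lam mu i j \<xi> b) \<le> 3 * (B / ?r) + 18 * (B / ?r)"
    unfolding wstar_functional_def by (rule norm_triangle_mono[OF A1])
  then show ?thesis by simp
qed

lemma borel_measurable_ft [measurable]:
  assumes [measurable]: "f \<in> borel_measurable borel"
  shows "ft f \<in> borel_measurable borel"
proof -
  have "(\<lambda>\<xi>. \<integral>x. cis (- (\<xi> \<bullet> x)) * f x \<partial>lborel) \<in> borel_measurable borel"
    by (rule lborel.borel_measurable_lebesgue_integral) measurable
  then show ?thesis unfolding ft_def[abs_def] by simp
qed

lemma borel_measurable_wstar_symbol:
  assumes \<phi>: "smooth \<phi>"
  shows "wstar_symbol lam mu \<phi> E I i j \<in> borel_measurable borel"
proof -
  have [measurable]: "bfield \<phi> E I p q r \<in> borel_measurable borel" for p q r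
    by (rule borel_measurable_continuous_onI[OF smooth_continuous[OF smooth_bfield[OF \<phi>]]])
  have [measurable]: "bhat \<phi> E I p q r \<in> borel_measurable borel" for p q r
    unfolding bhat_def by measurable
  have [measurable]: "(\<lambda>\<xi>::vec. \<xi> $ l) \<in> borel_measurable borel" for l
    by (intro borel_measurable_continuous_onI continuous_intros)
  have [measurable]: "sym_d l \<in> borel_measurable borel" "sym_invlap \<in> borel_measurable borel" "sym_invlap2 \<in> borel_measurable borel" for l
    unfolding sym_d_def[abs_def] sym_invlap_def[abs_def] sym_invlap2_def[abs_def] by measurable
  show ?thesis unfolding wstar_symbol_def[abs_def] by measurable
qed

lemma wstar_symbol_edge_bound:
  assumes \<phi>: "smooth \<phi>" "compact_supp \<phi>"
  shows "\<exists>K\<ge>0. \<forall>lam mu i j m \<xi>. lame lam mu \<longrightarrow>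
    norm (wstar_symbol lam mu \<phi> {e} (\<lambda>_. axis m 1) i j \<xi>) \<le> K / (norm \<xi> * (1 + norm \<xi>) ^ 7)"
proof -
  have "\<exists>C\<ge>0. \<forall>\<xi>. norm (bhat \<phi> {e} (\<lambda>_. axis m 1) p q r \<xi>) \<le> C / (1 + norm \<xi>) ^ 7" for m p q r
    unfolding bhat_def by (rule ft_decay[OF smooth_bfield[OF \<phi>(1)] compact_supp_bfield[OF \<phi>(2)]])
  then obtain C where C: "\<And>m p q r. 0 \<le> C m p q r"
    "\<And>m p q r \<xi>. norm (bhat \<phi> {e} (\<lambda>_. axis m 1) p q r \<xi>) \<le> C m p q r / (1 + norm \<xi>) ^ 7" by metis
  define B where "B = (\<Sum>m\<in>UNIV. \<Sum>p\<in>UNIV. \<Sum>q\<in>UNIV. \<Sum>r\<in>UNIV. C m p q r)"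
  have CB: "C m p q r \<le> B" for m p q r
    unfolding B_def
    by (intro order_trans[OF _ member_le_sum[of m UNIV]] order_trans[OF _ member_le_sum[of p UNIV]]
        order_trans[OF _ member_le_sum[of q UNIV]] member_le_sum[of r UNIV] sum_nonneg C(1)) auto
  have B0: "0 \<le> B" using C(1) CB order_trans by blast
  have "norm (wstar_symbol lam mu \<phi> {e} (\<lambda>_. axis m 1) i j \<xi>) \<le> 21 * B / (norm \<xi> * (1 + norm \<xi>) ^ 7)"
    if "lame lam mu" for lam mu i j m \<xi>
  proof -
    have "norm (bhat \<phi> {e} (\<lambda>_. axis m 1) p q r \<xi>) \<le> B / (1 + norm \<xi>) ^ 7" for p q r
      by (rule order_trans[OF C(2) divide_right_mono[OF CB]]) simp
    from wstar_functional_bound[OF that this, of i j \<xi>] show ?thesis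
      unfolding wstar_symbol_functional by (simp add: mult_ac)
  qed
  then show ?thesis using B0 by (intro exI[of _ "21 * B"]) auto
qed

lemma bhat_translate:
  assumes \<phi>: "smooth \<phi>"
  shows "bhat \<phi> {(a + l, b + l)} (\<lambda>_. v) i j k \<xi> = cis (- (\<xi> \<bullet> l)) * bhat \<phi> {(a, b)} (\<lambda>_. v) i j k \<xi>"
proof -
  let ?f = "bfield \<phi> {(a, b)} (\<lambda>_. v) i j k"
  have [measurable]: "?f \<in> borel_measurable borel"
    by (rule borel_measurable_continuous_onI[OF smooth_continuous[OF smooth_bfield[OF \<phi>]]])
  have tr: "bfield \<phi> {(a + l, b + l)} (\<lambda>_. v) i j k (l + x) = ?f x" for x
    by (simp add: bfield_def convJ_def conv_seg_def edge_dir_def algebra_simps)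
  have [measurable]: "bfield \<phi> {(a + l, b + l)} (\<lambda>_. v) i j k \<in> borel_measurable borel"
    by (rule borel_measurable_continuous_onI[OF smooth_continuous[OF smooth_bfield[OF \<phi>]]])
  have "(\<integral>x. cis (- (\<xi> \<bullet> x)) * complex_of_real (bfield \<phi> {(a + l, b + l)} (\<lambda>_. v) i j k x) \<partial>lborel)
      = (\<integral>x. cis (- (\<xi> \<bullet> (l + x))) * complex_of_real (bfield \<phi> {(a + l, b + l)} (\<lambda>_. v) i j k (l + x)) \<partial>lborel)"
    by (rule integral_translate[symmetric]) measurable
  also have "\<dots> = (\<integral>x. cis (- (\<xi> \<bullet> l)) * (cis (- (\<xi> \<bullet> x)) * complex_of_real (?f x)) \<partial>lborel)"
  proof (rule Bochner_Integration.integral_cong[OF refl])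
    fix x
    have "cis (- (\<xi> \<bullet> (l + x))) = cis (- (\<xi> \<bullet> l)) * cis (- (\<xi> \<bullet> x))" by (simp add: cis_mult inner_add_right)
    then show "cis (- (\<xi> \<bullet> (l + x))) * complex_of_real (bfield \<phi> {(a + l, b + l)} (\<lambda>_. v) i j k (l + x))
      = cis (- (\<xi> \<bullet> l)) * (cis (- (\<xi> \<bullet> x)) * complex_of_real (?f x))" unfolding tr by simp
  qed
  also have "\<dots> = cis (- (\<xi> \<bullet> l)) * (\<integral>x. cis (- (\<xi> \<bullet> x)) * complex_of_real (?f x) \<partial>lborel)" by simp
  finally show ?thesis by (simp add: bhat_def ft_def)
qed

lemma wstar_symbol_translate:
  assumes "smooth \<phi>"
  shows "wstar_symbol lam mu \<phi> {(a + l, b + l)} (\<lambda>_. v) i j \<xi>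
    = cis (- (\<xi> \<bullet> l)) * wstar_symbol lam mu \<phi> {(a, b)} (\<lambda>_. v) i j \<xi>"
  unfolding wstar_symbol_functional bhat_translate[OF assms] by (rule wstar_functional_scale)

definition wcoef :: "real \<Rightarrow> real \<Rightarrow> (vec \<Rightarrow> real) \<Rightarrow> 3 \<Rightarrow> 3 \<Rightarrow> vec \<Rightarrow> edge \<Rightarrow> vec" where
  "wcoef lam mu \<phi> i j x e = (\<chi> m. wstar lam mu \<phi> {e} (\<lambda>_. axis m 1) i j x)"

lemma wstar_symbol_integrable:
  assumes \<phi>: "smooth \<phi>" "compact_supp \<phi>" and L: "lame lam mu"
  shows "integrable lborel (\<lambda>\<xi>. cis (\<xi> \<bullet> x) * wstar_symbol lam mu \<phi> {e} (\<lambda>_. axis m 1) i j \<xi>)"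
proof -
  obtain K where K: "0 \<le> K" "\<And>\<xi>. norm (wstar_symbol lam mu \<phi> {e} (\<lambda>_. axis m 1) i j \<xi>) \<le> K / (norm \<xi> * (1 + norm \<xi>) ^ 7)"
    using wstar_symbol_edge_bound[OF \<phi>, of e] L by blast
  note m = borel_measurable_wstar_symbol[OF \<phi>(1)]
  have int: "integrable lborel (wstar_symbol lam mu \<phi> {e} (\<lambda>_. axis m 1) i j)"
    using lattice_bessel[OF zero_less_one] K m by blast
  note [measurable] = m
  show ?thesis
    by (rule Bochner_Integration.integrable_bound[OF int]) (auto simp: norm_mult intro!: AE_I2)
qed

lemma wstar_superposition:
  assumes \<phi>: "smooth \<phi>" "compact_supp \<phi>" and L: "lame lam mu"
  shows "wstar lam mu \<phi> E I i j x = (\<Sum>e\<in>E. wcoef lam mu \<phi> i j x e \<bullet> I e)"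
proof -
  let ?s = "\<lambda>e m. wstar_symbol lam mu \<phi> {e} (\<lambda>_. axis m 1) i j"
  have "(\<integral>\<xi>. cis (\<xi> \<bullet> x) * wstar_symbol lam mu \<phi> E I i j \<xi> \<partial>lborel)
     = (\<integral>\<xi>. (\<Sum>e\<in>E. \<Sum>m\<in>UNIV. of_real (I e $ m) * (cis (\<xi> \<bullet> x) * ?s e m \<xi>)) \<partial>lborel)"
    by (subst wstar_symbol_superposition[OF \<phi>]) (simp add: sum_distrib_left mult_ac)
  also have "\<dots> = (\<Sum>e\<in>E. \<Sum>m\<in>UNIV. of_real (I e $ m) * (\<integral>\<xi>. cis (\<xi> \<bullet> x) * ?s e m \<xi> \<partial>lborel))"
    by (simp add: Bochner_Integration.integral_sum integrable_mult_right wstar_symbol_integrable[OF \<phi> L])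
  finally have "ift (wstar_symbol lam mu \<phi> E I i j) x = (\<Sum>e\<in>E. \<Sum>m\<in>UNIV. of_real (I e $ m) * ift (?s e m) x)"
    by (simp add: ift_def sum_distrib_left mult_ac)
  then show ?thesis
    by (simp add: wstar_def wcoef_def inner_vec_def mult.commute)
qed

text \<open>Translating an edge by \<open>l\<close> multiplies its symbol by cis (- \<xi> . l), so
  the coefficients at x along one orbit of edges are the inverse transforms of a single symbol at
  the points x - l. The Bessel inequality for the period lattice bounds each orbit uniformly in x,
  and there are finitely many orbits.\<close>

lemma wstar_square_sum:
  assumes pg: "periodic_graph VL EL" and \<phi>: "smooth \<phi>" "compact_supp \<phi>"
  shows "\<exists>C\<ge>0. \<forall>lam mu E i j x. lame lam mu \<and> finite E \<and> E \<subseteq> EL \<longrightarrow>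
    (\<Sum>e\<in>E. (norm (wcoef lam mu \<phi> i j x e))\<^sup>2) \<le> C"
proof -
  obtain L Fe where L: "is_lattice L" and Fe: "finite Fe" "EL \<subseteq> {(a + l, b + l) |a b l. (a,b) \<in> Fe \<and> l \<in> L}"
    using pg unfolding periodic_graph_def by blast
  obtain \<epsilon> where \<epsilon>: "0 < \<epsilon>" "separated \<epsilon> L" using lattice_separated[OF L] by blast
  obtain C where C1: "0 < C" and Cb: "\<forall>h K. h \<in> borel_measurable borel \<and> 0 \<le> K \<and> (\<forall>\<xi>::vec. norm (h \<xi>) \<le> K / (norm \<xi> * (1 + norm \<xi>) ^ 7)) \<longrightarrow>
    integrable lborel h \<and> (\<forall>S x. finite S \<and> separated \<epsilon> S \<longrightarrow>
      (\<Sum>l\<in>S. (norm (\<integral>\<xi>. cis (\<xi> \<bullet> (x - l)) * h \<xi> \<partial>lborel))\<^sup>2) \<le> C * K\<^sup>2)"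
    using lattice_bessel[OF \<epsilon>(1)] by (elim exE conjE) (rule that)
  have C2: "(\<Sum>l\<in>S. (norm (\<integral>\<xi>. cis (\<xi> \<bullet> (x - l)) * h \<xi> \<partial>lborel))\<^sup>2) \<le> C * K\<^sup>2"
    if "h \<in> borel_measurable borel" "0 \<le> K" "\<And>\<xi>::vec. norm (h \<xi>) \<le> K / (norm \<xi> * (1 + norm \<xi>) ^ 7)"
      "finite S" "separated \<epsilon> S" for h K S x
  proof -
    have "h \<in> borel_measurable borel \<and> 0 \<le> K \<and> (\<forall>\<xi>::vec. norm (h \<xi>) \<le> K / (norm \<xi> * (1 + norm \<xi>) ^ 7))"
      using that(1-3) by blast
    from Cb[THEN spec, THEN spec, THEN mp, OF this] that(4,5) show ?thesis by blast
  qed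
  note C = C1 C2
  have "\<forall>e. \<exists>K\<ge>0. \<forall>lam mu i j m \<xi>. lame lam mu \<longrightarrow>
    norm (wstar_symbol lam mu \<phi> {e} (\<lambda>_. axis m 1) i j \<xi>) \<le> K / (norm \<xi> * (1 + norm \<xi>) ^ 7)"
    using wstar_symbol_edge_bound[OF \<phi>] by blast
  from choice[OF this] obtain K where K: "\<And>e. 0 \<le> K e"
    "\<And>e lam mu i j m \<xi>. lame lam mu \<Longrightarrow> norm (wstar_symbol lam mu \<phi> {e} (\<lambda>_. axis m 1) i j \<xi>) \<le> K e / (norm \<xi> * (1 + norm \<xi>) ^ 7)"
    by blast
  define c where "c = (2 * pi) powr (-3/2)"
  define sh where "sh p = (fst (fst p) + snd p, snd (fst p) + snd p)" for p :: "edge \<times> vec"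
  define B where "B = (\<Sum>f\<in>Fe. 3 * (c\<^sup>2 * (C * (K f)\<^sup>2)))"
  have "(\<Sum>e\<in>E. (norm (wcoef lam mu \<phi> i j x e))\<^sup>2) \<le> B" if Lm: "lame lam mu" and E: "finite E" "E \<subseteq> EL" for lam mu E i j x
  proof -
    let ?G = "\<lambda>e. (norm (wcoef lam mu \<phi> i j x e))\<^sup>2"
    define S where "S f = {l\<in>L. sh (f, l) \<in> E}" for f
    have finS: "finite (S f)" for f
    proof (rule finite_imageD)
      show "finite ((\<lambda>l. sh (f, l)) ` S f)" by (rule finite_subset[OF _ E(1)]) (auto simp: S_def)
      show "inj_on (\<lambda>l. sh (f, l)) (S f)" by (auto simp: inj_on_def sh_def)
    qed
    have sepS: "separated \<epsilon> (S f)" for f by (rule separated_subset[OF \<epsilon>(2)]) (auto simp: S_def)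
    let ?I = "\<lambda>f m l. \<integral>\<xi>. cis (\<xi> \<bullet> (x - l)) * wstar_symbol lam mu \<phi> {f} (\<lambda>_. axis m 1) i j \<xi> \<partial>lborel"
    have w: "?G (sh (f, l)) \<le> (\<Sum>m\<in>UNIV. c\<^sup>2 * (norm (?I f m l))\<^sup>2)" for f l
    proof -
      have "\<bar>wcoef lam mu \<phi> i j x (sh (f, l)) $ m\<bar> \<le> c * norm (?I f m l)" for m
      proof -
        have "(\<integral>\<xi>. cis (\<xi> \<bullet> x) * wstar_symbol lam mu \<phi> {sh (f, l)} (\<lambda>_. axis m 1) i j \<xi> \<partial>lborel) = ?I f m l"
        proof (rule Bochner_Integration.integral_cong[OF refl])
          fix \<xi>
          have "cis (\<xi> \<bullet> (x - l)) = cis (\<xi> \<bullet> x) * cis (- (\<xi> \<bullet> l))" by (simp add: cis_mult inner_diff_right)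
          then show "cis (\<xi> \<bullet> x) * wstar_symbol lam mu \<phi> {sh (f, l)} (\<lambda>_. axis m 1) i j \<xi>
            = cis (\<xi> \<bullet> (x - l)) * wstar_symbol lam mu \<phi> {f} (\<lambda>_. axis m 1) i j \<xi>"
            using wstar_symbol_translate[OF \<phi>(1), of lam mu "fst f" l "snd f" "axis m 1" i j \<xi>] by (simp add: sh_def)
        qed
        then have "ift (wstar_symbol lam mu \<phi> {sh (f, l)} (\<lambda>_. axis m 1) i j) x = complex_of_real c * ?I f m l"
          by (simp add: ift_def c_def)
        then have "norm (ift (wstar_symbol lam mu \<phi> {sh (f, l)} (\<lambda>_. axis m 1) i j) x) = c * norm (?I f m l)"
          by (simp add: norm_mult c_def)
        then show ?thesis
          using abs_Re_le_cmod[of "ift (wstar_symbol lam mu \<phi> {sh (f, l)} (\<lambda>_. axis m 1) i j) x"]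
          by (simp add: wcoef_def wstar_def)
      qed
      then have sq: "(wcoef lam mu \<phi> i j x (sh (f, l)) $ m)\<^sup>2 \<le> c\<^sup>2 * (norm (?I f m l))\<^sup>2" for m
        using power_mono[OF _ abs_ge_zero, of "wcoef lam mu \<phi> i j x (sh (f, l)) $ m" "c * norm (?I f m l)" 2]
        by (simp only: power2_abs power_mult_distrib)
      have "?G (sh (f, l)) = (\<Sum>m\<in>UNIV. (wcoef lam mu \<phi> i j x (sh (f, l)) $ m)\<^sup>2)"
        unfolding power2_norm_eq_inner inner_vec_def by (simp add: power2_eq_square)
      also have "\<dots> \<le> (\<Sum>m\<in>UNIV. c\<^sup>2 * (norm (?I f m l))\<^sup>2)" by (intro sum_mono sq)
      finally show ?thesis .
    qed
    have fin: "finite (Sigma Fe S)" using Fe(1) finS by auto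
    have "E \<subseteq> sh ` Sigma Fe S"
    proof
      fix e assume e: "e \<in> E"
      then obtain a b l where "e = (a + l, b + l)" "(a,b) \<in> Fe" "l \<in> L" using E(2) Fe(2) by blast
      then show "e \<in> sh ` Sigma Fe S" using e by (intro image_eqI[of _ _ "((a,b),l)"]) (auto simp: S_def sh_def)
    qed
    \<comment> \<open>An edge may have several representations as a translate; counting it
      repeatedly only increases the sum.\<close>
    then have "(\<Sum>e\<in>E. ?G e) \<le> (\<Sum>e\<in>sh ` Sigma Fe S. ?G e)" by (intro sum_mono2 finite_imageI fin) auto
    also have "\<dots> \<le> (\<Sum>p\<in>Sigma Fe S. ?G (sh p))"
      using sum_image_le[OF fin, of ?G sh] by (simp add: o_def)
    also have "\<dots> = (\<Sum>f\<in>Fe. \<Sum>l\<in>S f. ?G (sh (f, l)))"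
      using Fe(1) finS by (subst sum.Sigma) (auto simp: split_beta)
    also have "\<dots> \<le> (\<Sum>f\<in>Fe. 3 * (c\<^sup>2 * (C * (K f)\<^sup>2)))"
    proof (rule sum_mono)
      fix f
      have "(\<Sum>l\<in>S f. ?G (sh (f, l))) \<le> (\<Sum>l\<in>S f. \<Sum>m\<in>UNIV. c\<^sup>2 * (norm (?I f m l))\<^sup>2)"
        by (intro sum_mono w)
      also have "\<dots> = (\<Sum>m\<in>UNIV. c\<^sup>2 * (\<Sum>l\<in>S f. (norm (?I f m l))\<^sup>2))"
        unfolding sum_distrib_left by (rule sum.swap)
      also have "\<dots> \<le> (\<Sum>m\<in>(UNIV::3 set). c\<^sup>2 * (C * (K f)\<^sup>2))"
        by (intro sum_mono mult_left_mono C(2) K borel_measurable_wstar_symbol[OF \<phi>(1)] Lm finS sepS) auto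
      finally show "(\<Sum>l\<in>S f. ?G (sh (f, l))) \<le> 3 * (c\<^sup>2 * (C * (K f)\<^sup>2))" by simp
    qed
    finally show ?thesis by (simp add: B_def)
  qed
  moreover have "0 \<le> B" unfolding B_def using C(1) by (intro sum_nonneg) auto
  ultimately show ?thesis by blast
qed

section \<open>Truncated configurations and the limit\<close>

declare split_paired_All [simp del] split_paired_Ex [simp del]

lemma lattice_add: "is_lattice G \<Longrightarrow> x \<in> G \<Longrightarrow> y \<in> G \<Longrightarrow> x + y \<in> G"
  unfolding is_lattice_def by (metis add_diff_cancel_left' diff_0 diff_minus_eq_add)

lemma lattice_uminus: "is_lattice G \<Longrightarrow> x \<in> G \<Longrightarrow> - x \<in> G"
  unfolding is_lattice_def by (metis diff_0)

lemma lattice_zero: "is_lattice G \<Longrightarrow> 0 \<in> G"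
  unfolding is_lattice_def by blast

text \<open>The cutoff is on each edge separately, because a bound on the total current would not
  survive the joining of two configurations with disjoint supports.\<close>

definition trunc_cfg :: "vec set \<Rightarrow> edge set \<Rightarrow> real \<Rightarrow> (edge \<Rightarrow> vec) set" where
  "trunc_cfg G E R = {I \<in> Icfg G E. \<forall>e. norm (I e) \<le> R}"

lemma csupp_Icfg: "I \<in> Icfg G E \<Longrightarrow> csupp I \<subseteq> E"
  by (auto simp: Icfg_def csupp_def)

lemma Icfg_range: "is_lattice G \<Longrightarrow> I \<in> Icfg G E \<Longrightarrow> I e \<in> G"
  using lattice_zero[of G] by (cases "e \<in> E") (simp_all add: Icfg_def)

lemma finite_trunc_cfg:
  assumes "is_lattice G" "finite E"
  shows "finite (trunc_cfg G E R)"
proof (rule finite_subset)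
  show "finite {I. \<forall>e. (e \<in> E \<longrightarrow> I e \<in> {g\<in>G. norm g \<le> R}) \<and> (e \<notin> E \<longrightarrow> I e = (0::vec))}"
    by (rule finite_set_of_finite_funs[OF assms(2) lattice_bounded_finite[OF assms(1)]])
qed (auto simp: trunc_cfg_def Icfg_def)

lemma Icfg_zero: "is_lattice G \<Longrightarrow> (\<lambda>_. 0) \<in> Icfg G E"
  by (auto simp: Icfg_def lattice_zero)

lemma Icfg_add:
  assumes "is_lattice G" "I \<in> Icfg G E" "J \<in> Icfg G E"
  shows "(\<lambda>e. I e + J e) \<in> Icfg G E"
  using assms lattice_add by (auto simp: Icfg_def scaleR_add_right sum.distrib)

lemma Icfg_uminus:
  assumes "is_lattice G" "I \<in> Icfg G E"
  shows "(\<lambda>e. - I e) \<in> Icfg G E"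
  using assms lattice_uminus by (auto simp: Icfg_def sum_negf)

lemma touch_vertex: "Defs.sinc v e \<noteq> 0 \<Longrightarrow> Defs.sinc v f \<noteq> 0 \<Longrightarrow> touch e f"
  by (auto simp: touch_def Defs.sinc_def split: if_splits)

text \<open>Kirchhoff's law is inherited by a part of the support that touches no other part:
  at each vertex the part carries either all or none of the current.\<close>
lemma Icfg_split:
  assumes G: "is_lattice G" and I: "I \<in> Icfg G E"
    and sep: "\<And>e f. e \<in> csupp I \<Longrightarrow> e \<in> S \<Longrightarrow> f \<in> csupp I \<Longrightarrow> f \<notin> S \<Longrightarrow> \<not> touch e f"
  shows "(\<lambda>e. if e \<in> S then I e else 0) \<in> Icfg G E"
proof -
  have "(\<Sum>e\<in>E. Defs.sinc v e *\<^sub>R (if e \<in> S then I e else 0)) = 0" if v: "v \<in> verts E" for v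
  proof (cases "\<exists>e0\<in>csupp I. e0 \<in> S \<and> Defs.sinc v e0 \<noteq> 0")
    case True
    then obtain e0 where e0: "e0 \<in> csupp I" "e0 \<in> S" "Defs.sinc v e0 \<noteq> 0" by blast
    have "Defs.sinc v e *\<^sub>R (if e \<in> S then I e else 0) = Defs.sinc v e *\<^sub>R I e" for e
      using sep[OF e0(1,2), of e] touch_vertex[OF e0(3), of e] by (auto simp: csupp_def)
    then have "(\<Sum>e\<in>E. Defs.sinc v e *\<^sub>R (if e \<in> S then I e else 0)) = (\<Sum>e\<in>E. Defs.sinc v e *\<^sub>R I e)"
      by (simp only:)
    also have "\<dots> = 0" using I v by (simp add: Icfg_def)
    finally show ?thesis .
  next
    case False
    then have z: "Defs.sinc v e *\<^sub>R (if e \<in> S then I e else 0) = 0" for e by (auto simp: csupp_def)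
    show ?thesis by (simp only: z sum.neutral_const)
  qed
  then show ?thesis using I lattice_zero[OF G] by (auto simp: Icfg_def)
qed

lemma trunc_config_space:
  assumes G: "is_lattice G" and E: "finite E" "E \<subseteq> EL" and R: "0 \<le> R"
    and D: "\<And>e. e \<in> E \<Longrightarrow> card {f\<in>E. touch e f} \<le> D"
  shows "config_space E touch (trunc_cfg G E R) D"
proof
  show "finite E" by (rule E(1))
  show "finite (trunc_cfg G E R)" by (rule finite_trunc_cfg[OF G E(1)])
  show "touch e e" for e by (auto simp: touch_def)
  show "touch e f \<Longrightarrow> touch f e" for e f by (auto simp: touch_def)
  show "card {f\<in>E. touch e f} \<le> D" if "e \<in> E" for e by (rule D[OF that])
  show "(\<lambda>_. 0) \<in> trunc_cfg G E R" using Icfg_zero[OF G] R by (simp add: trunc_cfg_def)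
  show "csupp I \<subseteq> E" if "I \<in> trunc_cfg G E R" for I using that csupp_Icfg by (auto simp: trunc_cfg_def)
  show "(\<lambda>e. if e \<in> S then I e else 0) \<in> trunc_cfg G E R"
    if "I \<in> trunc_cfg G E R" "\<And>e f. e \<in> csupp I \<Longrightarrow> e \<in> S \<Longrightarrow> f \<in> csupp I \<Longrightarrow> f \<notin> S \<Longrightarrow> \<not> touch e f" for I S
    using that Icfg_split[OF G, of I E S] R by (auto simp: trunc_cfg_def)
  show "(\<lambda>e. I e + J e) \<in> trunc_cfg G E R"
    if "I \<in> trunc_cfg G E R" "J \<in> trunc_cfg G E R" "\<And>e f. e \<in> csupp I \<Longrightarrow> f \<in> csupp J \<Longrightarrow> \<not> touch e f" for I J
  proof -
    have "norm (I e + J e) \<le> R" for e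
    proof -
      have "touch e e" by (auto simp: touch_def)
      then have "I e = 0 \<or> J e = 0" using that(3)[of e e] by (auto simp: csupp_def)
      then show ?thesis using that(1,2) by (auto simp: trunc_cfg_def)
    qed
    then show ?thesis using that(1,2) Icfg_add[OF G] by (auto simp: trunc_cfg_def)
  qed
qed

text \<open>The local factor of \<open>gweight\<close>: it is multiplicative over components,
  whereas the elastic factor is not. Infinite energy has weight 0, which is consistent with products
  since energies are nonnegative.\<close>

definition dweight :: "real \<Rightarrow> (edge set \<Rightarrow> (edge \<Rightarrow> vec) \<Rightarrow> ereal) \<Rightarrow> edge set \<Rightarrow> (edge \<Rightarrow> vec) \<Rightarrow> real" where
  "dweight \<beta> Hd E I = (if Hd E I = \<infinity> then 0 else exp (- \<beta> * real_of_ereal (Hd E I)))"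

lemma gweight_dweight: "gweight \<beta> lam mu \<phi> Hd E I = dweight \<beta> Hd E I * exp (- \<beta> * Hel_star lam mu \<phi> E I)"
  by (simp add: gweight_def dweight_def exp_add[symmetric] algebra_simps)

lemma dweight_nonneg: "0 \<le> dweight \<beta> Hd E I"
  by (simp add: dweight_def)

lemma disl_energyD:
  assumes "disl_energy G EL c Hd" "finite E" "E \<subseteq> EL"
  shows "I \<in> Icfg G E \<Longrightarrow> 0 \<le> Hd E I" "I \<in> Icfg G E \<Longrightarrow> Hd E (\<lambda>e. - I e) = Hd E I"
    "I \<in> Icfg G E \<Longrightarrow> ereal (c * norm1 E I) \<le> Hd E I" "Hd E (\<lambda>_. 0) = 0"
    "I1 \<in> Icfg G E \<Longrightarrow> I2 \<in> Icfg G E \<Longrightarrow> (\<And>e1 e2. e1 \<in> supp E I1 \<Longrightarrow> e2 \<in> supp E I2 \<Longrightarrow> {fst e1, snd e1} \<inter> {fst e2, snd e2} = {})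
         \<Longrightarrow> Hd E (\<lambda>e. I1 e + I2 e) = Hd E I1 + Hd E I2"
proof -
  note h = assms(1)[unfolded disl_energy_def, THEN spec, THEN mp, OF conjI[OF assms(2,3)]]
  note h1 = h[THEN conjunct1, THEN bspec] and h2 = h[THEN conjunct2, THEN conjunct1]
    and h3 = h[THEN conjunct2, THEN conjunct2, THEN bspec, THEN bspec, THEN mp]
  show "I \<in> Icfg G E \<Longrightarrow> 0 \<le> Hd E I" by (rule h1[THEN conjunct1])
  show "I \<in> Icfg G E \<Longrightarrow> Hd E (\<lambda>e. - I e) = Hd E I" by (rule h1[THEN conjunct2, THEN conjunct1])
  show "I \<in> Icfg G E \<Longrightarrow> ereal (c * norm1 E I) \<le> Hd E I" by (rule h1[THEN conjunct2, THEN conjunct2])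
  show "Hd E (\<lambda>_. 0) = 0" by (rule h2)
  show "Hd E (\<lambda>e. I1 e + I2 e) = Hd E I1 + Hd E I2"
    if "I1 \<in> Icfg G E" "I2 \<in> Icfg G E" "\<And>e1 e2. e1 \<in> supp E I1 \<Longrightarrow> e2 \<in> supp E I2 \<Longrightarrow> {fst e1, snd e1} \<inter> {fst e2, snd e2} = {}"
    by (rule h3[OF that(1,2)]) (use that(3) in blast)
qed

lemma dweight_le:
  assumes d: "disl_energy G EL c Hd" "finite E" "E \<subseteq> EL" and I: "I \<in> Icfg G E" and \<beta>: "0 \<le> \<beta>"
  shows "dweight \<beta> Hd E I \<le> exp (- (\<beta> * c) * norm1 E I)"
proof (cases "Hd E I = \<infinity>")
  case False
  have "0 \<le> Hd E I" "ereal (c * norm1 E I) \<le> Hd E I" using disl_energyD[OF d] I by blast+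
  with False obtain r where r: "Hd E I = ereal r" "c * norm1 E I \<le> r" by (cases "Hd E I") auto
  have "\<beta> * (c * norm1 E I) \<le> \<beta> * r" by (rule mult_left_mono[OF r(2) \<beta>])
  then show ?thesis using r(1) by (simp add: dweight_def mult.assoc)
qed (simp add: dweight_def)

lemma dweight_add:
  assumes "0 \<le> Hd E I" "0 \<le> Hd E J" "Hd E (\<lambda>e. I e + J e) = Hd E I + Hd E J"
  shows "dweight \<beta> Hd E (\<lambda>e. I e + J e) = dweight \<beta> Hd E I * dweight \<beta> Hd E J"
  using assms by (cases "Hd E I"; cases "Hd E J") (auto simp: dweight_def exp_add[symmetric] algebra_simps)

lemma trunc_even_gas:
  assumes G: "is_lattice G" and d: "disl_energy G EL c Hd" "finite E" "E \<subseteq> EL" and R: "0 \<le> R" and \<beta>: "0 \<le> \<beta>"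
    and D: "\<And>e. e \<in> E \<Longrightarrow> card {f\<in>E. touch e f} \<le> D"
    and q: "(\<Sum>g\<in>{g\<in>G. norm g \<le> R} - {0}. exp (- (\<beta> * c - 2) * norm g)) \<le> q"
    and small: "(real D)\<^sup>2 * (2 ^ D * q) \<le> 1/4"
  shows "even_gas E touch (trunc_cfg G E R) D (dweight \<beta> Hd E) (\<beta> * c) q {g\<in>G. norm g \<le> R}"
proof -
  interpret config_space E touch "trunc_cfg G E R" D by (rule trunc_config_space[OF G d(2,3) R D])
  note h = disl_energyD[OF d]
  show ?thesis
  proof
    show "(\<lambda>e. - I e) \<in> trunc_cfg G E R" if "I \<in> trunc_cfg G E R" for I
      using that Icfg_uminus[OF G] by (auto simp: trunc_cfg_def)
    show "0 \<le> dweight \<beta> Hd E I" for I by (rule dweight_nonneg)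
    show "dweight \<beta> Hd E I \<le> exp (- (\<beta> * c) * len I)" if "I \<in> trunc_cfg G E R" for I
      using dweight_le[OF d _ \<beta>, of I] that by (simp add: trunc_cfg_def len_def norm1_def)
    show "dweight \<beta> Hd E (\<lambda>e. - I e) = dweight \<beta> Hd E I" if "I \<in> trunc_cfg G E R" for I
      using h(2)[of I] that by (simp add: trunc_cfg_def dweight_def)
    show "mult_weight (dweight \<beta> Hd E)"
      unfolding mult_weight_def
    proof (intro conjI ballI impI)
      show "dweight \<beta> Hd E (\<lambda>_. 0) = 1" by (simp add: dweight_def h(4))
      fix I J assume IJ: "I \<in> trunc_cfg G E R" "J \<in> trunc_cfg G E R" "\<forall>e\<in>csupp I. \<forall>f\<in>csupp J. \<not> touch e f"
      then have I: "I \<in> Icfg G E" and J: "J \<in> Icfg G E" by (auto simp: trunc_cfg_def)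
      have "Hd E (\<lambda>e. I e + J e) = Hd E I + Hd E J"
      proof (rule h(5)[OF I J])
        fix e1 e2 assume "e1 \<in> supp E I" "e2 \<in> supp E J"
        then have "e1 \<in> csupp I" "e2 \<in> csupp J" by (simp_all add: supp_def csupp_def)
        then have "\<not> touch e1 e2" using IJ(3) by blast
        then show "{fst e1, snd e1} \<inter> {fst e2, snd e2} = {}" by (simp only: touch_def not_not)
      qed
      then show "dweight \<beta> Hd E (\<lambda>e. I e + J e) = dweight \<beta> Hd E I * dweight \<beta> Hd E J"
        by (intro dweight_add h(1) I J)
    qed
    show "finite {g\<in>G. norm g \<le> R}" by (rule lattice_bounded_finite[OF G])
    show "I f \<in> {g\<in>G. norm g \<le> R}" if "I \<in> trunc_cfg G E R" for I f
      using that Icfg_range[OF G, of I E f] by (simp add: trunc_cfg_def)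
  qed (use q small in auto)
qed

text \<open>\<open>second_difference\<close> holds for the dislocation weight with every phase
  \<open>a\<close>; \<open>gaussian_factors\<close> then inserts the elastic weight square by
  square, and the phase 0 gives the claim.\<close>

lemma trunc_inequality:
  assumes G: "is_lattice G" and d: "disl_energy G EL c Hd" "finite E" "E \<subseteq> EL" and R: "0 \<le> R" and \<beta>: "0 \<le> \<beta>"
    and D: "\<And>e. e \<in> E \<Longrightarrow> card {f\<in>E. touch e f} \<le> D"
    and q: "(\<Sum>g\<in>{g\<in>G. norm g \<le> R} - {0}. exp (- (\<beta> * c - 2) * norm g)) \<le> q"
    and small: "(real D)\<^sup>2 * (2 ^ D * q) \<le> 1/4"
    and \<phi>: "smooth \<phi>" "compact_supp \<phi>" and ne: "\<And>e. e \<in> E \<Longrightarrow> fst e \<noteq> snd e" and L: "lame lam mu"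
  shows "0 \<le> (\<Sum>I\<in>trunc_cfg G E R. gweight \<beta> lam mu \<phi> Hd E I *
    (cos (t * (\<Sum>e\<in>E. \<gamma> e \<bullet> I e)) - exp (- (t\<^sup>2 / 2) * (2 * ((real D)\<^sup>2 * (2 ^ D * q)) * (\<Sum>e\<in>E. (norm (\<gamma> e))\<^sup>2)))))"
proof -
  interpret even_gas E touch "trunc_cfg G E R" D "dweight \<beta> Hd E" "\<beta> * c" q "{g\<in>G. norm g \<le> R}"
    by (rule trunc_even_gas[OF G d R \<beta> D q small])
  obtain n :: nat and s where s: "\<And>I. I \<in> Icfg G E \<Longrightarrow> Hel_star lam mu \<phi> E I = (\<Sum>m<n. (\<Sum>e\<in>E. s m e \<bullet> I e)\<^sup>2)"
    using Hel_star_sum_of_squares[OF \<phi> d(2) ne L, of G] by blast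
  \<comment> \<open>The factor sqrt (2 \<beta>) makes half the sum of squares equal to \<beta> times
    the elastic energy.\<close>
  define s' where "s' m e = sqrt (2 * \<beta>) *\<^sub>R s m e" for m e
  let ?\<kappa> = "\<lambda>I. dweight \<beta> Hd E I * (cos (t * pair \<gamma> I) - exp (- (t\<^sup>2 / 2) * (\<eta> * (\<Sum>e\<in>E. (norm (\<gamma> e))\<^sup>2))))"
  have "0 \<le> (\<Sum>I\<in>trunc_cfg G E R. ?\<kappa> I * exp (- (\<Sum>m\<in>{..<n}. (pair (s' m) I)\<^sup>2) / 2) * cos (pair (\<lambda>_. 0) I))"
    by (rule gaussian_factors[OF finite_lessThan second_difference])
  also have "\<dots> = (\<Sum>I\<in>trunc_cfg G E R. gweight \<beta> lam mu \<phi> Hd E I *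
    (cos (t * (\<Sum>e\<in>E. \<gamma> e \<bullet> I e)) - exp (- (t\<^sup>2 / 2) * (2 * ((real D)\<^sup>2 * (2 ^ D * q)) * (\<Sum>e\<in>E. (norm (\<gamma> e))\<^sup>2)))))"
  proof (rule sum.cong[OF refl])
    fix I assume "I \<in> trunc_cfg G E R"
    then have I: "I \<in> Icfg G E" by (simp add: trunc_cfg_def)
    have "(pair (s' m) I)\<^sup>2 = 2 * \<beta> * (\<Sum>e\<in>E. s m e \<bullet> I e)\<^sup>2" for m
      using \<beta> by (simp add: pair_def s'_def sum_distrib_left[symmetric] power_mult_distrib)
    then have "- (\<Sum>m\<in>{..<n}. (pair (s' m) I)\<^sup>2) / 2 = - \<beta> * Hel_star lam mu \<phi> E I"
      by (simp add: s[OF I] sum_distrib_left sum_divide_distrib sum_negf)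
    then show "?\<kappa> I * exp (- (\<Sum>m\<in>{..<n}. (pair (s' m) I)\<^sup>2) / 2) * cos (pair (\<lambda>_. 0) I) = gweight \<beta> lam mu \<phi> Hd E I *
      (cos (t * (\<Sum>e\<in>E. \<gamma> e \<bullet> I e)) - exp (- (t\<^sup>2 / 2) * (2 * ((real D)\<^sup>2 * (2 ^ D * q)) * (\<Sum>e\<in>E. (norm (\<gamma> e))\<^sup>2))))"
      unfolding gweight_dweight \<eta>_def by (simp add: pair_def mult_ac)
  qed
  finally show ?thesis .
qed

text \<open>Relaxing the node law to independent values on the edges bounds all finite partial sums
  by a product of one-edge sums, hence gives summability of the Gibbs weights over the infinite set
  of configurations.\<close>

lemma sum_exp_norm1_le:
  assumes T: "finite T" "T \<subseteq> Icfg G E" and E: "finite E"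
    and C: "\<And>V. finite V \<Longrightarrow> V \<subseteq> G \<Longrightarrow> (\<Sum>g\<in>V. exp (- b * norm g)) \<le> C"
  shows "(\<Sum>I\<in>T. exp (- b * norm1 E I)) \<le> C ^ card E"
proof -
  define V where "V = (\<Union>I\<in>T. I ` E)"
  have V: "finite V" "V \<subseteq> G" using T E by (auto simp: V_def Icfg_def)
  let ?r = "\<lambda>I. restrict I E"
  have inj: "inj_on ?r T"
  proof (rule inj_onI, rule ext)
    fix I J e assume IJ: "I \<in> T" "J \<in> T" "?r I = ?r J"
    have "I e = J e" if "e \<in> E" using fun_cong[OF IJ(3), of e] that by simp
    moreover have "I e = 0 \<and> J e = 0" if "e \<notin> E" using IJ(1,2) T(2) that by (auto simp: Icfg_def)
    ultimately show "I e = J e" by (cases "e \<in> E") simp_all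
  qed
  have "(\<Sum>I\<in>T. exp (- b * norm1 E I)) = (\<Sum>I\<in>T. \<Prod>e\<in>E. exp (- b * norm (?r I e)))"
  proof (rule sum.cong[OF refl])
    fix I
    have "exp (- b * norm1 E I) = (\<Prod>e\<in>E. exp (- b * norm (I e)))"
      unfolding norm1_def by (simp only: sum_distrib_left exp_sum[OF E])
    also have "\<dots> = (\<Prod>e\<in>E. exp (- b * norm (?r I e)))" by (rule prod.cong) auto
    finally show "exp (- b * norm1 E I) = (\<Prod>e\<in>E. exp (- b * norm (?r I e)))" .
  qed
  also have "\<dots> = (\<Sum>J\<in>?r ` T. \<Prod>e\<in>E. exp (- b * norm (J e)))"
    by (simp only: sum.reindex[OF inj] o_def)
  also have "\<dots> \<le> (\<Sum>J\<in>PiE E (\<lambda>_. V). \<Prod>e\<in>E. exp (- b * norm (J e)))"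
  proof (rule sum_mono2)
    show "finite (PiE E (\<lambda>_. V))" using E V by (intro finite_PiE) auto
    show "?r ` T \<subseteq> PiE E (\<lambda>_. V)" by (rule image_subsetI) (auto simp: restrict_PiE_iff V_def)
  qed (auto intro: prod_nonneg)
  also have "\<dots> = (\<Prod>e\<in>E. \<Sum>g\<in>V. exp (- b * norm g))"
    by (rule prod_sum_PiE[symmetric]) (use E V in auto)
  also have "\<dots> = (\<Sum>g\<in>V. exp (- b * norm g)) ^ card E" by (rule prod_constant)
  also have "\<dots> \<le> C ^ card E" by (intro power_mono C V sum_nonneg) auto
  finally show ?thesis .
qed

section \<open>Removal of the truncation and moments\<close>

lemma trunc_exhausts:
  assumes "is_lattice G" "finite E"
  shows "filterlim (\<lambda>n. trunc_cfg G E (real n)) (finite_subsets_at_top (Icfg G E)) sequentially"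
  unfolding filterlim_finite_subsets_at_top
proof (intro allI impI)
  fix X assume X: "finite X \<and> X \<subseteq> Icfg G E"
  define B where "B = (\<Sum>I\<in>X. norm1 E I)"
  have B: "norm (I e) \<le> B" if I: "I \<in> X" for I e
  proof (cases "e \<in> E")
    case True
    have "norm (I e) \<le> norm1 E I" unfolding norm1_def by (rule member_le_sum) (use True assms in auto)
    also have "\<dots> \<le> B" unfolding B_def by (rule member_le_sum) (use I X in \<open>auto simp: norm1_def sum_nonneg\<close>)
    finally show ?thesis .
  next
    case False
    then have "I e = 0" using I X by (auto simp: Icfg_def)
    moreover have "0 \<le> B" unfolding B_def norm1_def by (intro sum_nonneg) auto
    ultimately show ?thesis by simp
  qed
  show "\<forall>\<^sub>F n in sequentially. finite (trunc_cfg G E (real n)) \<and> X \<subseteq> trunc_cfg G E (real n) \<and> trunc_cfg G E (real n) \<subseteq> Icfg G E"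
  proof (rule eventually_sequentiallyI[of "nat \<lceil>B\<rceil>"])
    fix n assume "nat \<lceil>B\<rceil> \<le> n"
    then have Bn: "B \<le> real n" by linarith
    have "X \<subseteq> trunc_cfg G E (real n)"
    proof
      fix I assume I: "I \<in> X"
      have "norm (I e) \<le> real n" for e using B[OF I, of e] Bn by (rule order_trans)
      then show "I \<in> trunc_cfg G E (real n)" using I X by (auto simp: trunc_cfg_def)
    qed
    then show "finite (trunc_cfg G E (real n)) \<and> X \<subseteq> trunc_cfg G E (real n) \<and> trunc_cfg G E (real n) \<subseteq> Icfg G E"
      using finite_trunc_cfg[OF assms] by (auto simp: trunc_cfg_def)
  qed
qed

lemma infsum_trunc_nonneg:
  assumes "is_lattice G" "finite E" "f summable_on Icfg G E"
    and "\<And>n. 0 \<le> (\<Sum>I\<in>trunc_cfg G E (real n). f I)"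
  shows "(0::real) \<le> (\<Sum>\<^sub>\<infinity>I\<in>Icfg G E. f I)"
proof -
  have "(sum f \<longlongrightarrow> (\<Sum>\<^sub>\<infinity>I\<in>Icfg G E. f I)) (finite_subsets_at_top (Icfg G E))"
    using has_sum_infsum[OF assms(3)] by (simp add: has_sum_def)
  from filterlim_compose[OF this trunc_exhausts[OF assms(1,2)]]
  show ?thesis by (rule LIMSEQ_le_const) (use assms(4) in auto)
qed

lemma infsum_odd_zero:
  fixes f :: "(edge \<Rightarrow> vec) \<Rightarrow> real"
  assumes G: "is_lattice G" and f: "\<And>I. I \<in> Icfg G E \<Longrightarrow> f (\<lambda>e. - I e) = - f I"
  shows "(\<Sum>\<^sub>\<infinity>I\<in>Icfg G E. f I) = 0"
proof -
  have "bij_betw (\<lambda>I e. - I e) (Icfg G E) (Icfg G E)"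
    by (rule bij_betwI[where g = "\<lambda>I e. - I e"]) (use Icfg_uminus[OF G] in auto)
  from infsum_reindex_bij_betw[OF this, of f]
  have "(\<Sum>\<^sub>\<infinity>I\<in>Icfg G E. f I) = (\<Sum>\<^sub>\<infinity>I\<in>Icfg G E. f (\<lambda>e. - I e))" by simp
  also have "\<dots> = (\<Sum>\<^sub>\<infinity>I\<in>Icfg G E. - f I)" by (rule infsum_cong) (rule f)
  also have "\<dots> = - (\<Sum>\<^sub>\<infinity>I\<in>Icfg G E. f I)" by (rule infsum_uminus)
  finally show ?thesis by simp
qed

lemma Hel_star_nonneg: "lame lam mu \<Longrightarrow> smooth \<phi> \<Longrightarrow> compact_supp \<phi> \<Longrightarrow> finite E \<Longrightarrow> (\<And>e. e \<in> E \<Longrightarrow> fst e \<noteq> snd e)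
    \<Longrightarrow> I \<in> Icfg G E \<Longrightarrow> 0 \<le> Hel_star lam mu \<phi> E I"
  by (subst Hel_star_coset_energy) (auto intro: coset_energy_nonneg)

lemma Hel_star_uminus:
  assumes "lame lam mu" "smooth \<phi>" "compact_supp \<phi>" "finite E" "\<And>e. e \<in> E \<Longrightarrow> fst e \<noteq> snd e" "is_lattice G" "I \<in> Icfg G E"
  shows "Hel_star lam mu \<phi> E (\<lambda>e. - I e) = Hel_star lam mu \<phi> E I"
proof -
  obtain n :: nat and s where s: "\<And>I. I \<in> Icfg G E \<Longrightarrow> Hel_star lam mu \<phi> E I = (\<Sum>m<n. (\<Sum>e\<in>E. s m e \<bullet> I e)\<^sup>2)"
    using Hel_star_sum_of_squares[OF assms(2-5,1), of G] by blast
  show ?thesis using s[OF assms(7)] s[OF Icfg_uminus[OF assms(6,7)]] by (simp add: sum_negf)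
qed

lemma summable_on_dominated:
  fixes f :: "'a \<Rightarrow> 'b::banach" and P :: "'a \<Rightarrow> real"
  assumes "\<And>x. x \<in> A \<Longrightarrow> 0 \<le> P x" "P summable_on A" "\<And>x. x \<in> A \<Longrightarrow> norm (f x) \<le> P x"
  shows "f summable_on A"
proof -
  have "(\<lambda>x. norm (P x)) summable_on A" 
    using assms(2) summable_on_iff_abs_summable_on_real[of P A] by blast
  moreover have "norm (f x) \<le> norm (P x)" if "x \<in> A" for x using assms(1,3)[OF that] by simp
  ultimately have "(\<lambda>x. norm (f x)) summable_on A" by (rule Infinite_Sum.abs_summable_on_comparison_test)
  then show ?thesis by (rule Infinite_Sum.abs_summable_summable)
qed

text \<open>The second moment is read off from the characteristic function at \<open>s \<rightarrow> 0\<close>, using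
  \<open>2 (1 - cos (s x)) / s\<^sup>2 \<rightarrow> x\<^sup>2\<close> on finite sets of configurations.\<close>
lemma second_moment_from_char:
  fixes P X :: "'a \<Rightarrow> real"
  assumes P: "\<And>I. I \<in> A \<Longrightarrow> 0 \<le> P I" "P summable_on A" "(\<Sum>\<^sub>\<infinity>I\<in>A. P I) = 1"
    and ch: "\<And>s. exp (- (s\<^sup>2 / 2) * v) \<le> (\<Sum>\<^sub>\<infinity>I\<in>A. P I * cos (s * X I))"
  shows "(\<lambda>I. P I * (X I)\<^sup>2) summable_on A" "(\<Sum>\<^sub>\<infinity>I\<in>A. P I * (X I)\<^sup>2) \<le> v"
proof -
  have cosm: "(\<lambda>I. P I * cos (s * X I)) summable_on A" for s
    by (rule summable_on_dominated[OF P(1,2)]) (use P(1) abs_cos_le_one in \<open>auto simp: abs_mult intro!: mult_left_le\<close>)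
  have fin: "(\<Sum>I\<in>T. P I * (X I)\<^sup>2) \<le> v" if T: "finite T" "T \<subseteq> A" for T
  proof -
    have b: "(\<Sum>I\<in>T. P I * (2 * (1 - cos (s * X I)) / s\<^sup>2)) \<le> v" if "s \<noteq> 0" for s
    proof -
      have dsm: "(\<lambda>I. P I * (1 - cos (s * X I))) summable_on A"
      proof (rule summable_on_dominated[where P = "\<lambda>I. P I * 2"])
        show "(\<lambda>I. P I * 2) summable_on A" by (rule summable_on_cmult_left[OF P(2)])
        show "norm (P I * (1 - cos (s * X I))) \<le> P I * 2" if "I \<in> A" for I
          unfolding real_norm_def abs_mult abs_of_nonneg[OF P(1)[OF that]]
          by (rule mult_left_mono[OF _ P(1)[OF that]]) (use cos_ge_minus_one[of "s * X I"] cos_le_one[of "s * X I"] in simp)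
      qed (use P(1) in simp)
      have "(\<Sum>I\<in>T. P I * (1 - cos (s * X I))) \<le> (\<Sum>\<^sub>\<infinity>I\<in>A. P I * (1 - cos (s * X I)))"
      proof (rule finite_sum_le_infsum[OF dsm T])
        show "0 \<le> P I * (1 - cos (s * X I))" if "I \<in> A - T" for I using P(1) that by simp
      qed
      also have "\<dots> = 1 - (\<Sum>\<^sub>\<infinity>I\<in>A. P I * cos (s * X I))"
        using infsum_add[OF dsm cosm[of s]] P(3) by (simp add: right_diff_distrib)
      also have "\<dots> \<le> 1 - exp (- (s\<^sup>2 / 2) * v)" using ch[of s] by simp
      also have "\<dots> \<le> s\<^sup>2 / 2 * v" using exp_ge_add_one_self[of "- (s\<^sup>2 / 2) * v"] by simp
      finally have "2 / s\<^sup>2 * (\<Sum>I\<in>T. P I * (1 - cos (s * X I))) \<le> 2 / s\<^sup>2 * (s\<^sup>2 / 2 * v)"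
        by (rule mult_left_mono) simp
      then show ?thesis using that by (simp add: sum_distrib_left mult_ac)
    qed
    have lim1: "((\<lambda>s. 2 * (1 - cos (s * x)) / s\<^sup>2) \<longlongrightarrow> x\<^sup>2) (at 0)" for x :: real
    proof -
      have lim: "((\<lambda>s. (sin (s * (x / 2)) / s)\<^sup>2 * 4) \<longlongrightarrow> (x / 2)\<^sup>2 * 4) (at 0)"
      proof (intro tendsto_mult tendsto_power tendsto_const)
        have "((\<lambda>s. sin (s * (x / 2))) has_real_derivative x / 2) (at 0)"
          by (auto intro!: derivative_eq_intros)
        then show "((\<lambda>s. sin (s * (x / 2)) / s) \<longlongrightarrow> x / 2) (at 0)" by (simp add: DERIV_def)
      qed
      \<comment> \<open>The half-angle formula; at s = 0 both sides are 0 by the convention for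
        division.\<close>
      have eq: "2 * (1 - cos (s * x)) / s\<^sup>2 = (sin (s * (x / 2)) / s)\<^sup>2 * 4" for s
      proof -
        have "cos (s * x) = 1 - 2 * (sin (s * (x / 2)))\<^sup>2"
          using cos_double_sin[of "s * (x / 2)"] by (simp add: mult_ac)
        then show ?thesis by (simp add: power_divide)
      qed
      have x2: "(x / 2)\<^sup>2 * 4 = x\<^sup>2" by (simp add: power_divide)
      show ?thesis using lim unfolding eq x2 .
    qed
    have "((\<lambda>s. \<Sum>I\<in>T. P I * (2 * (1 - cos (s * X I)) / s\<^sup>2)) \<longlongrightarrow> (\<Sum>I\<in>T. P I * (X I)\<^sup>2)) (at 0)"
      by (intro tendsto_sum tendsto_mult tendsto_const lim1)
    then show ?thesis
    proof (rule tendsto_upperbound)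
      show "\<forall>\<^sub>F s in at 0. (\<Sum>I\<in>T. P I * (2 * (1 - cos (s * X I)) / s\<^sup>2)) \<le> v"
        unfolding eventually_at_filter by (rule always_eventually) (use b in blast)
    qed simp
  qed
  show sm: "(\<lambda>I. P I * (X I)\<^sup>2) summable_on A"
    by (rule nonneg_bdd_above_summable_on) (use P(1) fin in \<open>auto intro!: bdd_aboveI[of _ v]\<close>)
  show "(\<Sum>\<^sub>\<infinity>I\<in>A. P I * (X I)\<^sup>2) \<le> v" by (rule infsum_le_finite_sums[OF sm fin])
qed

section \<open>Choice of the constants and conclusion\<close>

theorem theorem1:
  fixes G :: "vec set" and VL :: "vec set" and EL :: "edge set"
    and \<phi> :: "vec \<Rightarrow> real" and c :: real
  assumes "is_lattice G" and "periodic_graph VL EL" and "form_function \<phi>" and "0 < c"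
  shows "\<exists>c2>0. \<exists>\<beta>0::real. \<forall>lam mu Hd. lame lam mu \<and> disl_energy G EL c Hd \<longrightarrow>
     (\<forall>\<beta>>\<beta>0. \<forall>t::real. \<forall>E. finite E \<and> E \<subseteq> EL \<longrightarrow> (\<forall>x y i j.
        let P = gibbs G \<beta> lam mu \<phi> Hd E;
            X = (\<lambda>I. wstar lam mu \<phi> E I i j x - wstar lam mu \<phi> E I i j y);
            ch = (\<Sum>\<^sub>\<infinity>I\<in>Icfg G E. complex_of_real (P I) * cis (t * X I));
            m = (\<Sum>\<^sub>\<infinity>I\<in>Icfg G E. P I * X I)
        in Im ch = 0 \<and> exp (- (t\<^sup>2 / 2) * exp (- c2 * \<beta>)) \<le> Re ch
           \<and> (\<lambda>I. P I * (X I)\<^sup>2) summable_on Icfg G E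
           \<and> (\<Sum>\<^sub>\<infinity>I\<in>Icfg G E. P I * (X I - m)\<^sup>2) \<le> exp (- c2 * \<beta>)))"
proof -
  note G = assms(1)
  have \<phi>: "smooth \<phi>" "compact_supp \<phi>" using assms(3) by (auto simp: form_function_def)
  obtain \<epsilon> where \<epsilon>: "0 < \<epsilon>" "separated \<epsilon> G" using lattice_separated[OF G] by blast
  have g\<epsilon>: "\<epsilon> \<le> norm g" if "g \<in> G" "g \<noteq> 0" for g
    using \<epsilon>(2) that lattice_zero[OF G] unfolding separated_def by (metis diff_zero)
  obtain D :: nat where D: "\<And>e E. e \<in> EL \<Longrightarrow> E \<subseteq> EL \<Longrightarrow> card {f\<in>E. touch e f} \<le> D"
    using periodic_graph_degree[OF assms(2)] by blast
  obtain C1 where C1: "0 < C1" "\<And>S p. finite S \<Longrightarrow> separated \<epsilon> S \<Longrightarrow> (\<Sum>l\<in>S. exp (- 1 * norm (p - l))) \<le> C1"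
    using separated_exp_sum[OF \<epsilon>(1), of 1] by auto
  have C1G: "(\<Sum>g\<in>V. exp (- norm g)) \<le> C1" if "finite V" "V \<subseteq> G" for V
    using C1(2)[OF that(1) separated_subset[OF \<epsilon>(2) that(2)], of 0] by simp
  obtain Cw where Cw: "0 \<le> Cw" "\<And>lam mu E i j x. lame lam mu \<Longrightarrow> finite E \<Longrightarrow> E \<subseteq> EL \<Longrightarrow>
      (\<Sum>e\<in>E. (norm (wcoef lam mu \<phi> i j x e))\<^sup>2) \<le> Cw"
    using wstar_square_sum[OF assms(2) \<phi>] by blast
  have neq: "fst e \<noteq> snd e" if "e \<in> EL" for e
    using assms(2) that unfolding periodic_graph_def by fastforce
  \<comment> \<open>With u = exp (- c2 \<beta>), \<open>k\<close> is the constant in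
    \<open>(real D)\<^sup>2 * (2 ^ D * q)\<close> = k u^2.\<close>
  define k where "k = (real D)\<^sup>2 * (2 ^ D * (C1 * exp (3 * \<epsilon>)))"
  have k0: "0 \<le> k" using C1(1) by (simp add: k_def)
  \<comment> \<open>\<open>M\<close> dominates both constants that have to be absorbed by one factor
    u, namely 4 k for the smallness condition and 8 k Cw for the variance; \<open>M \<ge> 1\<close>
    makes its logarithm meaningful.\<close>
  define M where "M = 4 * k * (4 * Cw + 1) + 1"
  have M1: "1 \<le> M" using k0 Cw(1) by (simp add: M_def)
  define c2 where "c2 = c * \<epsilon> / 2"
  have c2: "0 < c2" using assms(4) \<epsilon>(1) by (simp add: c2_def)
  \<comment> \<open>The first entry gives \<beta> c > 3: two units are spent in
    \<open>even_gas\<close>, and the third makes the sum over the lattice converge with a constant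
    free of \<beta>. The second gives M u \<le> 1.\<close>
  define \<beta>0 where "\<beta>0 = max (3 / c) (ln M / c2)"
  have "Im ch = 0 \<and> exp (- (t\<^sup>2 / 2) * exp (- c2 * \<beta>)) \<le> Re ch
           \<and> (\<lambda>I. P I * (X I)\<^sup>2) summable_on Icfg G E
           \<and> (\<Sum>\<^sub>\<infinity>I\<in>Icfg G E. P I * (X I - m)\<^sup>2) \<le> exp (- c2 * \<beta>)"
    if L: "lame lam mu" and d: "disl_energy G EL c Hd" and \<beta>: "\<beta>0 < \<beta>" and E: "finite E" "E \<subseteq> EL"
      and P_def: "P = gibbs G \<beta> lam mu \<phi> Hd E"
      and X_def: "X = (\<lambda>I. wstar lam mu \<phi> E I i j x - wstar lam mu \<phi> E I i j y)"
      and ch_def: "ch = (\<Sum>\<^sub>\<infinity>I\<in>Icfg G E. complex_of_real (P I) * cis (t * X I))"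
      and m_def: "m = (\<Sum>\<^sub>\<infinity>I\<in>Icfg G E. P I * X I)"
    for lam mu Hd \<beta> t E x y i j P X ch m
  proof -
    let ?A = "Icfg G E"
    have \<beta>c: "3 < \<beta> * c" using \<beta> assms(4) by (simp add: \<beta>0_def divide_less_eq)
    have "0 < \<beta> * c" using \<beta>c by linarith
    then have \<beta>pos: "0 < \<beta>" using assms(4) by (rule zero_less_mult_pos2)
    have "ln M \<le> c2 * \<beta>" using \<beta> c2 by (simp add: \<beta>0_def divide_less_eq mult.commute)
    then have "exp (ln M) \<le> exp (c2 * \<beta>)" by simp
    then have "M \<le> exp (c2 * \<beta>)" using M1 by simp
    then have Mb: "M * exp (- c2 * \<beta>) \<le> 1" by (simp add: exp_minus field_simps)
    define q where "q = C1 * exp (3 * \<epsilon>) * (exp (- c2 * \<beta>) * exp (- c2 * \<beta>))"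
    have qk: "(real D)\<^sup>2 * (2 ^ D * q) = k * (exp (- c2 * \<beta>) * exp (- c2 * \<beta>))" by (simp add: q_def k_def)
    define u where "u = exp (- c2 * \<beta>)"
    have u: "0 < u" "u \<le> 1" using c2 \<beta>pos by (auto simp: u_def)
    have Mu: "M * u \<le> 1" using Mb by (simp only: u_def)
    have ku: "4 * k * u \<le> 1" "8 * k * Cw * u \<le> 1"
    proof -
      have "4 * k * u \<le> M * u" using u k0 Cw(1) by (intro mult_right_mono) (auto simp: M_def algebra_simps)
      with Mu show "4 * k * u \<le> 1" by simp
      have "8 * k * Cw * u \<le> M * u" using u k0 Cw(1) by (intro mult_right_mono) (auto simp: M_def algebra_simps)
      with Mu show "8 * k * Cw * u \<le> 1" by simp
    qed
    have small: "(real D)\<^sup>2 * (2 ^ D * q) \<le> 1/4"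
    proof -
      have "4 * (k * (u * u)) = (4 * k * u) * u" by simp
      also have "\<dots> \<le> 1 * 1" using ku(1) u by (intro mult_mono) auto
      finally show ?thesis unfolding qk u_def[symmetric] by simp
    qed
    \<comment> \<open>The exponent is split as (\<beta> c - 3) + 1: on nonzero lattice vectors the
      first part gains the minimal length \<epsilon>, and the second part is summed to
      \<open>C1\<close>. Since c \<epsilon> = 2 c2, this produces u^2.\<close>
    have qb: "(\<Sum>g\<in>V - {0}. exp (- (\<beta> * c - 2) * norm g)) \<le> q" if "finite V" "V \<subseteq> G" for V
    proof -
      have "(\<Sum>g\<in>V - {0}. exp (- (\<beta> * c - 2) * norm g)) \<le> (\<Sum>g\<in>V - {0}. exp (- (\<beta> * c - 3) * \<epsilon>) * exp (- norm g))"
      proof (rule sum_mono)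
        fix g assume g: "g \<in> V - {0}"
        then have "(\<beta> * c - 3) * \<epsilon> \<le> (\<beta> * c - 3) * norm g" using g\<epsilon>[of g] that \<beta>c by (intro mult_left_mono) auto
        then have "- (\<beta> * c - 2) * norm g \<le> - (\<beta> * c - 3) * \<epsilon> + - norm g" by (simp add: algebra_simps)
        then show "exp (- (\<beta> * c - 2) * norm g) \<le> exp (- (\<beta> * c - 3) * \<epsilon>) * exp (- norm g)"
          by (simp only: exp_add[symmetric] exp_le_cancel_iff)
      qed
      also have "\<dots> = exp (- (\<beta> * c - 3) * \<epsilon>) * (\<Sum>g\<in>V - {0}. exp (- norm g))" by (simp only: sum_distrib_left)
      also have "\<dots> \<le> exp (- (\<beta> * c - 3) * \<epsilon>) * C1" by (intro mult_left_mono C1G) (use that in auto)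
      also have "exp (- (\<beta> * c - 3) * \<epsilon>) = exp (3 * \<epsilon>) * (exp (- c2 * \<beta>) * exp (- c2 * \<beta>))"
        unfolding exp_add[symmetric] c2_def by (simp add: algebra_simps)
      finally show ?thesis by (simp add: q_def mult_ac)
    qed
    define \<gamma> where "\<gamma> e = wcoef lam mu \<phi> i j x e - wcoef lam mu \<phi> i j y e" for e
    have X: "X I = (\<Sum>e\<in>E. \<gamma> e \<bullet> I e)" for I
      unfolding X_def \<gamma>_def wstar_superposition[OF \<phi> L] by (simp add: inner_diff_left sum_subtractf)
    have \<gamma>sum: "(\<Sum>e\<in>E. (norm (\<gamma> e))\<^sup>2) \<le> 4 * Cw"
    proof -
      have "(norm (\<gamma> e))\<^sup>2 \<le> 2 * (norm (wcoef lam mu \<phi> i j x e))\<^sup>2 + 2 * (norm (wcoef lam mu \<phi> i j y e))\<^sup>2" for e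
      proof -
        have "(norm (\<gamma> e))\<^sup>2 + (norm (wcoef lam mu \<phi> i j x e + wcoef lam mu \<phi> i j y e))\<^sup>2
          = 2 * (norm (wcoef lam mu \<phi> i j x e))\<^sup>2 + 2 * (norm (wcoef lam mu \<phi> i j y e))\<^sup>2"
          unfolding \<gamma>_def power2_norm_eq_inner by (simp add: inner_simps inner_commute)
        then show ?thesis using zero_le_power2[of "norm (wcoef lam mu \<phi> i j x e + wcoef lam mu \<phi> i j y e)"] by linarith
      qed
      then have "(\<Sum>e\<in>E. (norm (\<gamma> e))\<^sup>2) \<le> (\<Sum>e\<in>E. 2 * (norm (wcoef lam mu \<phi> i j x e))\<^sup>2 + 2 * (norm (wcoef lam mu \<phi> i j y e))\<^sup>2)"
        by (rule sum_mono)
      also have "\<dots> = 2 * (\<Sum>e\<in>E. (norm (wcoef lam mu \<phi> i j x e))\<^sup>2) + 2 * (\<Sum>e\<in>E. (norm (wcoef lam mu \<phi> i j y e))\<^sup>2)"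
        by (simp add: sum.distrib sum_distrib_left)
      finally show ?thesis using Cw(2)[OF L E, of i j x] Cw(2)[OF L E, of i j y] by linarith
    qed
    \<comment> \<open>The variance bound of \<open>second_difference\<close>. It is at most 8 k Cw
      u^2, where 4 Cw bounds the square sum for the difference of two base points; one factor u
      absorbs the constants.\<close>
    define v where "v = 2 * ((real D)\<^sup>2 * (2 ^ D * q)) * (\<Sum>e\<in>E. (norm (\<gamma> e))\<^sup>2)"
    have vu: "v \<le> u"
    proof -
      have "v \<le> 2 * (k * (u * u)) * (4 * Cw)"
        unfolding v_def qk u_def[symmetric] using k0 u by (intro mult_left_mono \<gamma>sum) auto
      also have "\<dots> = (8 * k * Cw * u) * u" by simp
      also have "\<dots> \<le> 1 * u" using ku(2) u by (intro mult_right_mono) auto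
      finally show ?thesis by simp
    qed
    let ?g = "gweight \<beta> lam mu \<phi> Hd E"
    have ne: "fst e \<noteq> snd e" if "e \<in> E" for e using neq that E(2) by blast
    have g0: "0 \<le> ?g I" for I by (simp add: gweight_dweight dweight_nonneg)
    have gle: "?g I \<le> exp (- (\<beta> * c) * norm1 E I)" if I: "I \<in> ?A" for I
    proof -
      have "?g I \<le> dweight \<beta> Hd E I * 1"
        unfolding gweight_dweight using Hel_star_nonneg[OF L \<phi> E(1) ne I] \<beta>pos
        by (intro mult_left_mono dweight_nonneg) simp
      also have "\<dots> \<le> exp (- (\<beta> * c) * norm1 E I)" using dweight_le[OF d E I] \<beta>pos by simp
      finally show ?thesis .
    qed
    have gsm: "?g summable_on ?A"
    proof (rule nonneg_bdd_above_summable_on)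
      show "bdd_above (sum ?g ` {T. T \<subseteq> ?A \<and> finite T})"
      proof (rule bdd_aboveI[of _ "C1 ^ card E"], elim imageE CollectE conjE)
        fix z T assume T: "T \<subseteq> ?A" "finite T" and z: "z = sum ?g T"
        have "z \<le> (\<Sum>I\<in>T. exp (- (\<beta> * c) * norm1 E I))" unfolding z by (rule sum_mono) (use gle T in blast)
        also have "\<dots> \<le> C1 ^ card E"
        proof (rule sum_exp_norm1_le[OF T(2,1) E(1)])
          fix V assume V: "finite V" "V \<subseteq> G"
          have "(\<Sum>g\<in>V. exp (- (\<beta> * c) * norm g)) \<le> (\<Sum>g\<in>V. exp (- norm g))"
          proof (rule sum_mono)
            fix g :: vec
            have "1 * norm g \<le> (\<beta> * c) * norm g" using \<beta>c by (intro mult_right_mono) auto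
            then show "exp (- (\<beta> * c) * norm g) \<le> exp (- norm g)" by simp
          qed
          also have "\<dots> \<le> C1" by (rule C1G[OF V])
          finally show "(\<Sum>g\<in>V. exp (- (\<beta> * c) * norm g)) \<le> C1" .
        qed
        finally show "z \<le> C1 ^ card E" .
      qed
    qed (rule g0)
    define Z where "Z = (\<Sum>\<^sub>\<infinity>I\<in>?A. ?g I)"
    have Z: "0 < Z"
    proof -
      have "sum ?g {\<lambda>_. 0} \<le> Z" unfolding Z_def
        by (rule finite_sum_le_infsum[OF gsm]) (use Icfg_zero[OF G] g0 in auto)
      moreover have "0 < ?g (\<lambda>_. 0)" by (simp add: gweight_def disl_energyD(4)[OF d E])
      ultimately show ?thesis by simp
    qed
    have P: "P I = ?g I / Z" for I by (simp add: P_def gibbs_def Z_def)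
    have P0: "0 \<le> P I" for I unfolding P using g0 Z by simp
    have Psm: "P summable_on ?A" unfolding P[abs_def] divide_inverse by (rule summable_on_cmult_left[OF gsm])
    have P1: "(\<Sum>\<^sub>\<infinity>I\<in>?A. P I) = 1"
      unfolding P divide_inverse using Z by (simp add: infsum_cmult_left[OF gsm] Z_def[symmetric])
    have csm: "(\<lambda>I. P I * cos (s * X I)) summable_on ?A" for s
      by (rule summable_on_dominated[OF P0 Psm]) (use P0 abs_cos_le_one in \<open>auto simp: abs_mult intro!: mult_left_le\<close>)
    have char: "exp (- (s\<^sup>2 / 2) * v) \<le> (\<Sum>\<^sub>\<infinity>I\<in>?A. P I * cos (s * X I))" for s
    proof -
      let ?q = "exp (- (s\<^sup>2 / 2) * v)"
      have fsm: "(\<lambda>I. P I * cos (s * X I) + P I * (- ?q)) summable_on ?A"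
        by (intro summable_on_add csm summable_on_cmult_left Psm)
      have "0 \<le> (\<Sum>\<^sub>\<infinity>I\<in>?A. P I * cos (s * X I) + P I * (- ?q))"
      proof (rule infsum_trunc_nonneg[OF G E(1) fsm])
        fix n :: nat
        have "0 \<le> (\<Sum>I\<in>trunc_cfg G E (real n). ?g I * (cos (s * (\<Sum>e\<in>E. \<gamma> e \<bullet> I e))
            - exp (- (s\<^sup>2 / 2) * (2 * ((real D)\<^sup>2 * (2 ^ D * q)) * (\<Sum>e\<in>E. (norm (\<gamma> e))\<^sup>2)))))"
        proof (rule trunc_inequality[OF G d E _ _ _ _ small \<phi> ne L])
          show "card {f\<in>E. touch e f} \<le> D" if "e \<in> E" for e by (rule D) (use that E in auto)
          show "(\<Sum>g\<in>{g\<in>G. norm g \<le> real n} - {0}. exp (- (\<beta> * c - 2) * norm g)) \<le> q"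
            by (rule qb[OF lattice_bounded_finite[OF G]]) auto
        qed (use \<beta>pos in auto)
        also have "\<dots> = (\<Sum>I\<in>trunc_cfg G E (real n). ?g I * (cos (s * X I) - ?q))"
          by (simp only: X v_def)
        finally have "0 \<le> (\<Sum>I\<in>trunc_cfg G E (real n). ?g I * (cos (s * X I) - ?q)) / Z" using Z by simp
        also have "\<dots> = (\<Sum>I\<in>trunc_cfg G E (real n). P I * cos (s * X I) + P I * (- ?q))"
          unfolding sum_divide_distrib P by (rule sum.cong) (simp_all add: right_diff_distrib diff_divide_distrib)
        finally show "0 \<le> (\<Sum>I\<in>trunc_cfg G E (real n). P I * cos (s * X I) + P I * (- ?q))" .
      qed
      also have "\<dots> = (\<Sum>\<^sub>\<infinity>I\<in>?A. P I * cos (s * X I)) + (\<Sum>\<^sub>\<infinity>I\<in>?A. P I * (- ?q))"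
        by (rule infsum_add[OF csm summable_on_cmult_left[OF Psm]])
      also have "(\<Sum>\<^sub>\<infinity>I\<in>?A. P I * (- ?q)) = - ?q"
        using infsum_cmult_left[OF Psm, of "- ?q"] P1 by simp
      finally show ?thesis by simp
    qed
    have gev: "?g (\<lambda>e. - I e) = ?g I" if I: "I \<in> ?A" for I
    proof -
      have "Hel_star lam mu \<phi> E (\<lambda>e. - I e) = Hel_star lam mu \<phi> E I"
        by (rule Hel_star_uminus[OF L \<phi> E(1) _ G I]) (rule ne)
      then show ?thesis unfolding gweight_def disl_energyD(2)[OF d E I] by (simp only:)
    qed
    have Pev: "P (\<lambda>e. - I e) = P I" if "I \<in> ?A" for I unfolding P gev[OF that] ..
    have Xodd: "X (\<lambda>e. - I e) = - X I" for I by (simp add: X sum_negf)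
    \<comment> \<open>The Gibbs weight is even and the observable odd, so the variance is the second
      moment, and the characteristic function is real.\<close>
    have m0: "m = 0" unfolding m_def by (rule infsum_odd_zero[OF G]) (simp add: Pev Xodd)
    have chsm: "(\<lambda>I. complex_of_real (P I) * cis (t * X I)) summable_on ?A"
      by (rule summable_on_dominated[OF P0 Psm]) (use P0 in \<open>simp add: norm_mult\<close>)
    have "Im ch = (\<Sum>\<^sub>\<infinity>I\<in>?A. P I * sin (t * X I))"
      unfolding ch_def infsum_Im[OF chsm, symmetric] by simp
    also have "\<dots> = 0" by (rule infsum_odd_zero[OF G]) (simp add: Pev Xodd)
    finally have Im0: "Im ch = 0" .
    have "Re ch = (\<Sum>\<^sub>\<infinity>I\<in>?A. P I * cos (t * X I))"
      unfolding ch_def infsum_Re[OF chsm, symmetric] by simp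
    then have "exp (- (t\<^sup>2 / 2) * v) \<le> Re ch" using char[of t] by simp
    moreover have "exp (- (t\<^sup>2 / 2) * exp (- c2 * \<beta>)) \<le> exp (- (t\<^sup>2 / 2) * v)"
      using mult_left_mono[OF vu, of "t\<^sup>2 / 2"] by (simp add: u_def)
    ultimately have Re: "exp (- (t\<^sup>2 / 2) * exp (- c2 * \<beta>)) \<le> Re ch" by (rule order_trans[rotated])
    note sm = second_moment_from_char[OF P0 Psm P1 char]
    have "(\<Sum>\<^sub>\<infinity>I\<in>?A. P I * (X I - m)\<^sup>2) \<le> exp (- c2 * \<beta>)"
      using order_trans[OF sm(2) vu] by (simp add: m0 u_def)
    then show ?thesis using Im0 Re sm(1) by blast
  qed
  then show ?thesis unfolding Let_def using c2 by blast
qed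

end
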